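(* Let $\rho\ge 0$, $d\ge 0$, $m\ge 1$ be integers with $m\ge d(\rho-1)$ if $\rho>1$, and with $d\ge 2$ or $d=0$ if $\rho\geq 1$. Let $U_{m,d}(\rho)$ be the $\rho$-removed uniform matroid of rank $d$ on $m+d$ elements, and for $i\ge 0$ let $c^i_{m,d}(\rho)$ be the coefficient of $t^i$ in its Kazhdan--Lusztig polynomial $P_{U_{m,d}(\rho)}(t)$. Then for every $i\ge 0$, $$c^i_{m,d}(\rho)=\#\,SkYT_\rho(m+1,i,d-2i+1).$$
   Context: **Kazhdan--Lusztig polynomial of a matroid.** For a matroid $M$ with lattice of flats $L(M)$, the characteristic polynomial is $\chi_M(t)=\sum_{F\in L(M)}\mu(\hat 0,F)\,t^{\operatorname{rk}M-\operatorname{rk}F}$, where $\mu$ is the Möbius function of $L(M)$ and $\hat 0$ its minimum. For a flat $F$, the localization $M^F$ is the matroid with ground set $F$ whose independent sets are the subsets of $F$ independent in $M$; the contraction $M_F$ is the matroid on the complement of $F$ whose independent sets are the subsets whose union with a basis of $F$ is independent in $M$. The Kazhdan--Lusztig polynomial $P_M(t)\in\mathbb Z[t]$ is the unique assignment with: (1) if $\operatorname{rk}M=0$ then $P_M(t)=1$; (2) if $\operatorname{rk}M>0$ then $\deg P_M<\tfrac12\operatorname{rk}M$; (3) $t^{\operatorname{rk}M}P_M(t^{-1})=\sum_{F\text{ a flat}}\chi_{M^F}(t)P_{M_F}(t)$. **$\rho$-removed uniform matroid.** $U_{m,d}$ is the uniform matroid of rank $d$ on $m+d$ elements. $U_{m,d}(\rho)$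 is the matroid whose bases are all $d$-subsets of $[m+d]$ except $\rho$ chosen pairwise disjoint ones (the choice is irrelevant up to isomorphism). By convention $U_{m,d}(0)=U_{m,d}$ and $U_{m,0}(\rho)=U_{m,0}$. **Skew tableaux.** For $i\ge 1$, $a,b\ge 2$ consider the skew shape with columns $1,\dots,i+1$ and rows $1,\dots,a+b-2$ (numbered top to bottom) having cells: rows $1,\dots,b-2$ contain only the cell in column $i+1$; rows $b-1$ and $b$ contain all columns $1,\dots,i+1$; rows $b+1,\dots,b+a-2$ contain only the cell in column $1$. So the left-most column has height $a$, it is followed by $i-1$ columns of height 2, then a right-most column of height $b$; the top two cells of the left-most column are in the same rows as the bottom two cells of the right-most one. A legal filling places each of $1,\dots,a+2i+b-2$ exactly once, with rows strictly increasing to the right and columns strictly increasing downward. $SkYT(a,i,b)$ is the set of legal fillings. Conventions: $\#SkYT(a,0,b)=1$; if $i>0$ and $a<2$ or $b<2$, then $\#SkYT(a,i,b)=0$. **$SkYT_\rho$.** $SkYT_\rho(m+1,i,d-2i+1)$ is the subset of those $\alpha\in SkYT(m+1,i,d-2i+1)$ satisfying at least one of: the top entry of the right-most column is $1$; the bottom entry of the right-most column is greater than $d+\rho$; the third entry from the top of the left-most column exists and is less than $d+1$. For $i=0$, by convention $\#SkYT_\rho(m+1,0,d+1)=1$. *)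

theory Defs
  imports "HOL-Computational_Algebra.Polynomial" "HOL-Library.FuncSet"
begin

section \<open>Matroids\<close>

datatype 'a matroid = Matroid (ground: "'a set") (indep: "'a set set")

definition is_matroid :: "'a matroid \<Rightarrow> bool" where
  "is_matroid M \<longleftrightarrow>
     finite (ground M) \<and>
     (\<forall>I\<in>indep M. I \<subseteq> ground M) \<and>
     {} \<in> indep M \<and>
     (\<forall>I\<in>indep M. \<forall>J. J \<subseteq> I \<longrightarrow> J \<in> indep M) \<and>
     (\<forall>I\<in>indep M. \<forall>J\<in>indep M. card J < card I \<longrightarrow>
        (\<exists>x\<in>I - J. insert x J \<in> indep M))"

definition matroid_of_bases :: "'a set \<Rightarrow> 'a set set \<Rightarrow> 'a matroid" where
  "matroid_of_bases E \<B> = Matroid E {I. \<exists>B\<in>\<B>. I \<subseteq> B}"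

definition is_basis_of :: "'a matroid \<Rightarrow> 'a set \<Rightarrow> 'a set \<Rightarrow> bool" where
  "is_basis_of M A B \<longleftrightarrow>
     B \<in> indep M \<and> B \<subseteq> A \<and> (\<forall>I\<in>indep M. B \<subseteq> I \<and> I \<subseteq> A \<longrightarrow> I = B)"

definition rk_of :: "'a matroid \<Rightarrow> 'a set \<Rightarrow> nat" where
  "rk_of M A = Max (card ` {I \<in> indep M. I \<subseteq> A})"

definition rk :: "'a matroid \<Rightarrow> nat" where
  "rk M = rk_of M (ground M)"

definition flats :: "'a matroid \<Rightarrow> 'a set set" where
  "flats M = {F. F \<subseteq> ground M \<and> (\<forall>x\<in>ground M - F. rk_of M F < rk_of M (insert x F))}"

definition localization :: "'a matroid \<Rightarrow> 'a set \<Rightarrow> 'a matroid" where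
  "localization M F = Matroid F {I \<in> indep M. I \<subseteq> F}"

definition contraction :: "'a matroid \<Rightarrow> 'a set \<Rightarrow> 'a matroid" where
  "contraction M F =
     Matroid (ground M - F)
       {I. I \<subseteq> ground M - F \<and> (\<exists>B. is_basis_of M F B \<and> I \<union> B \<in> indep M)}"


section \<open>Characteristic and Kazhdan--Lusztig polynomials\<close>

text \<open>
  The Moebius function of a family \<open>L\<close> of finite sets ordered by inclusion. The test
  \<open>finite Y\<close> only serves termination.
\<close>

function moebius :: "'a set set \<Rightarrow> 'a set \<Rightarrow> 'a set \<Rightarrow> int" where
  "moebius L X Y =
     (if X = Y then 1
      else if X \<subset> Y \<and> finite Y then - (\<Sum>Z\<in>{Z \<in> L. X \<subseteq> Z \<and> Z \<subset> Y}. moebius L X Z)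
      else 0)"
  by pat_completeness auto
termination
  by (relation "measure (\<lambda>(L, X, Y). card Y)") (auto intro: psubset_card_mono)

declare moebius.simps [simp del]

definition matroid_char_poly :: "'a matroid \<Rightarrow> int poly" where
  "matroid_char_poly M =
     (\<Sum>F\<in>flats M. monom (moebius (flats M) (LEAST F0. F0 \<in> flats M) F) (rk M - rk_of M F))"

text \<open>\<open>reverse_poly n p\<close> is $t^n p(t^{-1})$, for \<open>p\<close> of degree at most \<open>n\<close>.\<close>

definition reverse_poly :: "nat \<Rightarrow> int poly \<Rightarrow> int poly" where
  "reverse_poly n p = (\<Sum>i\<le>n. monom (coeff p i) (n - i))"

text \<open>
  Uniqueness is meant on matroids only, so the assignment is fixed to be \<open>0\<close> on those values
  of the type that are not matroids.
\<close>

definition is_kl_assignment :: "('a matroid \<Rightarrow> int poly) \<Rightarrow> bool" where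
  "is_kl_assignment P \<longleftrightarrow>
     (\<forall>M. is_matroid M \<longrightarrow>
        (rk M = 0 \<longrightarrow> P M = 1) \<and>
        (rk M > 0 \<longrightarrow> 2 * degree (P M) < rk M) \<and>
        reverse_poly (rk M) (P M) =
          (\<Sum>F\<in>flats M. matroid_char_poly (localization M F) * P (contraction M F))) \<and>
     (\<forall>M. \<not> is_matroid M \<longrightarrow> P M = 0)"

definition kl_poly :: "'a matroid \<Rightarrow> int poly" where
  "kl_poly = (THE P. is_kl_assignment P)"


section \<open>Removed uniform matroids\<close>

text \<open>
  The possible choices \<open>R\<close> of the \<open>\<rho>\<close> removed bases. For \<open>d = 0\<close> nothing is removed,
  whatever \<open>\<rho>\<close> is.
\<close>

definition removal_choice :: "nat \<Rightarrow> nat \<Rightarrow> nat \<Rightarrow> nat set set \<Rightarrow> bool" where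
  "removal_choice m d \<rho> R \<longleftrightarrow>
     (if d = 0 then R = {}
      else R \<subseteq> {B. B \<subseteq> {1..m + d} \<and> card B = d} \<and> card R = \<rho> \<and> pairwise disjnt R)"

definition removed_uniform :: "nat \<Rightarrow> nat \<Rightarrow> nat set set \<Rightarrow> nat matroid" where
  "removed_uniform m d R =
     matroid_of_bases {1..m + d} ({B. B \<subseteq> {1..m + d} \<and> card B = d} - R)"


section \<open>Skew tableaux\<close>

text \<open>Cells are pairs (row, column); the shape is intended for \<open>i \<ge> 1\<close> and \<open>a, b \<ge> 2\<close>.\<close>

definition skew_cells :: "nat \<Rightarrow> nat \<Rightarrow> nat \<Rightarrow> (nat \<times> nat) set" where
  "skew_cells a i b =
     {1..b - 2} \<times> {i + 1} \<union> {b - 1, b} \<times> {1..i + 1} \<union> {b + 1..b + a - 2} \<times> {1}"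

definition SkYT :: "nat \<Rightarrow> nat \<Rightarrow> nat \<Rightarrow> (nat \<times> nat \<Rightarrow> nat) set" where
  "SkYT a i b =
     (if a < 2 \<or> b < 2 then {}
      else {\<alpha> \<in> extensional (skew_cells a i b).
              bij_betw \<alpha> (skew_cells a i b) {1..a + 2 * i + b - 2} \<and>
              (\<forall>r c c'. (r, c) \<in> skew_cells a i b \<and> (r, c') \<in> skew_cells a i b \<and> c < c'
                 \<longrightarrow> \<alpha> (r, c) < \<alpha> (r, c')) \<and>
              (\<forall>r r' c. (r, c) \<in> skew_cells a i b \<and> (r', c) \<in> skew_cells a i b \<and> r < r'
                 \<longrightarrow> \<alpha> (r, c) < \<alpha> (r', c))})"

text \<open>
  The set $SkYT_\rho(m+1, i, d-2i+1)$ for \<open>i \<ge> 1\<close>. If \<open>d < 2 * i\<close>, the truncated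
  \<open>b\<close> below is less than \<open>2\<close>, as is the integer $d-2i+1$, so the set is empty as required.
  The right-most column occupies rows \<open>1, ..., b\<close>, and the left-most one starts in row \<open>b - 1\<close>.
\<close>

definition SkYT_removed :: "nat \<Rightarrow> nat \<Rightarrow> nat \<Rightarrow> nat \<Rightarrow> (nat \<times> nat \<Rightarrow> nat) set" where
  "SkYT_removed \<rho> m d i =
     (let a = m + 1; b = d + 1 - 2 * i
      in {\<alpha> \<in> SkYT a i b.
            \<alpha> (1, i + 1) = 1 \<or>
            \<alpha> (b, i + 1) > d + \<rho> \<or>
            (b + 1, 1) \<in> skew_cells a i b \<and> \<alpha> (b + 1, 1) < d + 1})"

text \<open>The value for \<open>i = 0\<close> is a convention, not the number of fillings of a shape.\<close>

definition num_SkYT_removed :: "nat \<Rightarrow> nat \<Rightarrow> nat \<Rightarrow> nat \<Rightarrow> nat" where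
  "num_SkYT_removed \<rho> m d i = (if i = 0 then 1 else card (SkYT_removed \<rho> m d i))"

end

theory Submission
  imports Defs
begin

text \<open>
  The relation defining the Kazhdan--Lusztig polynomials is equivalent to the palindromicity of
  $\sum_F t^{\mathrm{rk} F} P_{M_F}(t)$. For $U_{m,d}(\rho)$ all proper contractions are again of this
  kind with at most one removed basis, so that $P = P_{U_{m,d}} - \rho \Delta_d$ with $\Delta_d$
  independent of $m$, and palindromicity becomes a binomial recursion for each of the two parts.
  It is solved by the number of tableaux in $SkYT(m+1,i,d-2i+1)$, which is an alternating sum of hook
  formulas for the shapes $(p,i+1,1^{m-1})$, and by the number of standard tableaux of shape
  $(i+1,i,1^{d-2i-1})$. A tableau violating all three conditions of $SkYT_\rho$ has its
  $m$ largest entries on the tail of the left-most column and at the bottom of the right-most one; the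
  latter entry takes $\rho$ values, and the remaining cells form the second shape up to rotation.
\<close>

text \<open>Removed bases are pairwise disjoint, so a nonempty flat lies in at most one of them, and
  contracting it leaves at most one removed basis. A removed basis B enters the recursion only
  through its own subsets: B becomes a flat of rank d - 1, its (d-1)-subsets cease to be flats, and
  its smaller nonempty subsets contribute a corrected polynomial. These subsets are counted by
  binomials of d, hence the correction does not see m. Palindromicity in the uniform case rests on
  the reciprocal hook product of (p, q, 1^l), which is a term in q minus a term in p: the two sides
  of the palindrome are sums over the two triangles of one rectangle, and over the whole rectangle
  the sum factors into alternating binomial sums. For the correction, a Vandermonde convolution
  gives a closed form symmetric under j -> d - j. Coefficients and cardinalities are matched through
  these closed forms over the reals, not by a bijection.\<close>

lemma smult_sum_right: "smult (a::int) (sum f A) = (\<Sum>x\<in>A. smult a (f x))"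
  by (intro poly_eqI) (simp add: coeff_sum sum_distrib_left)

section \<open>Reversal and lower halves of integer polynomials\<close>

lemma coeff_reverse_poly: "coeff (reverse_poly n p) i = (if i \<le> n then coeff p (n - i) else 0)"
proof -
  have "coeff (reverse_poly n p) i = (\<Sum>j\<le>n. if n - j = i then coeff p j else 0)"
    by (simp add: reverse_poly_def coeff_sum)
  also have "\<dots> = (\<Sum>j\<le>n. if j = n - i then (if i \<le> n then coeff p j else 0) else 0)"
    by (rule sum.cong) auto
  also have "\<dots> = (if i \<le> n then coeff p (n - i) else 0)"
    by (simp add: sum.delta)
  finally show ?thesis .
qed

lemma reverse_poly_diff: "reverse_poly n (p - q) = reverse_poly n p - reverse_poly n q"
  by (intro poly_eqI) (simp add: coeff_reverse_poly)

lemma reverse_poly_sum: "reverse_poly n (sum f A) = (\<Sum>x\<in>A. reverse_poly n (f x))"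
  by (intro poly_eqI) (simp add: coeff_reverse_poly coeff_sum)

lemma reverse_poly_monom_mult:
  "k \<le> n \<Longrightarrow> reverse_poly n (monom 1 k * p) = reverse_poly (n - k) p"
  by (intro poly_eqI) (auto simp: coeff_reverse_poly coeff_monom_mult add.commute)

lemma reverse_poly_reverse_poly:
  assumes "k \<le> n" "degree p \<le> n - k"
  shows "reverse_poly n (reverse_poly (n - k) p) = monom 1 k * p"
  using assms by (intro poly_eqI) (auto simp: coeff_reverse_poly coeff_monom_mult coeff_eq_0)

text \<open>The cut is strict because a Kazhdan--Lusztig polynomial has degree strictly below half
  the rank.\<close>

definition truncate_half :: "nat \<Rightarrow> int poly \<Rightarrow> int poly" where
  "truncate_half n p = (\<Sum>i\<in>{i. 2 * i < n}. monom (coeff p i) i)"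

lemma finite_half: "finite {i::nat. 2 * i < n}"
  by (rule finite_subset[of _ "{..n}"]) auto

lemma coeff_truncate_half: "coeff (truncate_half n p) i = (if 2 * i < n then coeff p i else 0)"
  by (simp add: truncate_half_def coeff_sum finite_half sum.delta')

lemma degree_half_iff:
  assumes "0 < n"
  shows "2 * degree p < n \<longleftrightarrow> (\<forall>i. n \<le> 2 * i \<longrightarrow> coeff p i = 0)" (is "?L \<longleftrightarrow> ?R")
proof
  assume ?L then show ?R by (auto intro: coeff_eq_0)
next
  assume R: ?R
  show ?L
  proof (rule ccontr)
    assume "\<not> ?L"
    then have "coeff p (degree p) = 0" using R by auto
    then have "p = 0" by simp
    then show False using \<open>\<not> ?L\<close> assms by simp
  qed
qed

lemma degree_truncate_half: "0 < n \<Longrightarrow> 2 * degree (- truncate_half n p) < n"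
  by (subst degree_half_iff) (auto simp: coeff_truncate_half)

text \<open>Antisymmetry makes the upper half of \<open>S\<close> the negated mirror image of the
  lower one, so the lower half alone rebuilds \<open>S\<close>.\<close>

lemma reverse_truncate_half:
  assumes "reverse_poly n S = - S"
  shows "reverse_poly n (- truncate_half n S) - (- truncate_half n S) = S"
proof (intro poly_eqI)
  fix i
  have a: "(if i \<le> n then coeff S (n - i) else 0) = - coeff S i" for i
    using assms by (metis coeff_reverse_poly coeff_minus)
  show "coeff (reverse_poly n (- truncate_half n S) - (- truncate_half n S)) i = coeff S i"
  proof (cases "i \<le> n")
    case True
    then have "coeff S (n - i) = - coeff S i" using a[of i] by simp
    \<comment> \<open>In the middle degree antisymmetry reads c = -c, so the one coefficient that
      neither half contains is 0.\<close>
    moreover have "2 * i = n \<Longrightarrow> n - i = i" by auto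
    ultimately show ?thesis
      using True by (auto simp: coeff_reverse_poly coeff_truncate_half)
  qed (use a[of i] in \<open>auto simp: coeff_reverse_poly coeff_truncate_half\<close>)
qed

text \<open>Below degree n/2 the reversed polynomial has no coefficients, so there the difference
  shows -P undisturbed.\<close>

lemma reverse_half_unique:
  assumes "2 * degree P < n" "2 * degree Q < n"
    and "reverse_poly n P - P = reverse_poly n Q - Q"
  shows "P = Q"
proof (intro poly_eqI)
  fix i
  have n: "0 < n" using assms(1) by auto
  show "coeff P i = coeff Q i"
  proof (cases "2 * i < n")
    case True
    have "coeff (reverse_poly n P - P) i = coeff (reverse_poly n Q - Q) i" using assms(3) by simp
    moreover have "coeff P (n - i) = 0" "coeff Q (n - i) = 0"
      using assms(1,2) True by (auto intro!: coeff_eq_0)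
    ultimately show ?thesis using True by (auto simp: coeff_reverse_poly)
  next
    case False
    then show ?thesis using assms(1,2) by (simp add: coeff_eq_0)
  qed
qed

lemma reverse_poly_inject:
  assumes "degree P \<le> n" "degree Q \<le> n" "reverse_poly n P = reverse_poly n Q"
  shows "P = Q"
proof -
  have "reverse_poly n (reverse_poly n P) = P" "reverse_poly n (reverse_poly n Q) = Q"
    using reverse_poly_reverse_poly[of 0 n P] reverse_poly_reverse_poly[of 0 n Q] assms(1,2)
    by (simp_all add: monom_0)
  then show ?thesis using assms(3) by metis
qed

section \<open>Rank, contraction and flats\<close>

locale matroid_structure =
  fixes M :: "'a matroid"
  assumes is_matroid: "is_matroid M"
begin

abbreviation "E \<equiv> ground M"
abbreviation "r \<equiv> rk_of M"

lemma finite_ground: "finite E"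
  and indep_subset: "I \<in> indep M \<Longrightarrow> I \<subseteq> E"
  and indep_empty: "{} \<in> indep M"
  and indep_down: "I \<in> indep M \<Longrightarrow> J \<subseteq> I \<Longrightarrow> J \<in> indep M"
  and indep_exchange: "I \<in> indep M \<Longrightarrow> J \<in> indep M \<Longrightarrow> card J < card I \<Longrightarrow> \<exists>x\<in>I - J. insert x J \<in> indep M"
  using is_matroid unfolding is_matroid_def by blast+

lemma finite_indep: "I \<in> indep M \<Longrightarrow> finite I"
  using finite_ground indep_subset finite_subset by blast

lemma finite_indep_family: "finite {I \<in> indep M. I \<subseteq> A}"
  by (rule finite_subset[of _ "Pow E"]) (use indep_subset finite_ground in auto)

lemma card_le_rank: "I \<in> indep M \<Longrightarrow> I \<subseteq> A \<Longrightarrow> card I \<le> r A"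
  unfolding rk_of_def by (intro Max_ge) (auto simp: finite_indep_family)

lemma rank_attained: obtains I where "I \<in> indep M" "I \<subseteq> A" "card I = r A"
proof -
  have "r A \<in> card ` {I \<in> indep M. I \<subseteq> A}"
    unfolding rk_of_def by (intro Max_in) (use finite_indep_family indep_empty in auto)
  then show ?thesis using that by auto
qed

lemma rank_mono: "A \<subseteq> B \<Longrightarrow> r A \<le> r B"
  by (metis card_le_rank order_trans rank_attained)

lemma rank_le_card: "finite A \<Longrightarrow> r A \<le> card A"
  by (metis card_mono rank_attained)

lemma indep_extend:
  assumes "J \<in> indep M" "J \<subseteq> A"
  obtains B where "B \<in> indep M" "J \<subseteq> B" "B \<subseteq> A" "card B = r A"
proof -
  let ?S = "{I \<in> indep M. J \<subseteq> I \<and> I \<subseteq> A}"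
  have fin: "finite ?S" by (rule finite_subset[OF _ finite_indep_family[of A]]) auto
  have "J \<in> ?S" using assms by auto
  then have "Max (card ` ?S) \<in> card ` ?S" using fin by (intro Max_in) auto
  then obtain B where B: "B \<in> ?S" "card B = Max (card ` ?S)" by auto
  obtain I where I: "I \<in> indep M" "I \<subseteq> A" "card I = r A" by (rule rank_attained)
  have "card B = r A"
  proof (rule ccontr)
    assume "card B \<noteq> r A"
    then have "card B < card I" using card_le_rank[of B A] B I by auto
    then obtain x where x: "x \<in> I - B" "insert x B \<in> indep M"
      using indep_exchange[of I B] I B by auto
    have "insert x B \<in> ?S" using x B I by auto
    then have "card (insert x B) \<le> card B" using fin B by auto
    then show False using x finite_indep[of B] B by auto
  qed
  then show ?thesis using that B by auto
qed

text \<open>Maximality in the definition is by inclusion; extending to an independent set of full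
  rank turns it into a cardinality condition.\<close>

lemma is_basis_iff: "is_basis_of M A B \<longleftrightarrow> B \<in> indep M \<and> B \<subseteq> A \<and> card B = r A"
proof
  assume L: "is_basis_of M A B"
  then obtain B' where "B' \<in> indep M" "B \<subseteq> B'" "B' \<subseteq> A" "card B' = r A"
    using indep_extend[of B A] unfolding is_basis_of_def by blast
  then show "B \<in> indep M \<and> B \<subseteq> A \<and> card B = r A" using L unfolding is_basis_of_def by metis
next
  assume R: "B \<in> indep M \<and> B \<subseteq> A \<and> card B = r A"
  have "I = B" if "I \<in> indep M" "B \<subseteq> I" "I \<subseteq> A" for I
    using card_seteq[of I B] finite_indep[OF that(1)] card_le_rank[OF that(1,3)] that R by auto
  then show "is_basis_of M A B"
    unfolding is_basis_of_def using R by auto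
qed

lemma indep_iff_rank: "I \<in> indep M \<longleftrightarrow> I \<subseteq> E \<and> r I = card I"
proof
  assume "I \<in> indep M"
  then show "I \<subseteq> E \<and> r I = card I"
    using card_le_rank[of I I] rank_le_card[of I] finite_indep indep_subset by force
next
  assume R: "I \<subseteq> E \<and> r I = card I"
  obtain J where "J \<in> indep M" "J \<subseteq> I" "card J = r I" by (rule rank_attained)
  then show "I \<in> indep M" using R finite_ground by (metis card_subset_eq finite_subset)
qed

text \<open>The trace on \<open>F\<close> is independent, so it cannot have more than
  \<open>r F\<close> elements, and \<open>B\<close> already has that many.\<close>

lemma basis_extension_meets:
  assumes "B \<in> indep M" "B \<subseteq> F" "card B = r F" "B' \<in> indep M" "B \<subseteq> B'"
  shows "B' \<inter> F = B"
proof -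
  have "B' \<inter> F \<in> indep M" using assms indep_down by blast
  then have "card (B' \<inter> F) \<le> card B" using card_le_rank[of "B' \<inter> F" F] assms by auto
  then show ?thesis
    using assms finite_indep[of "B' \<inter> F"] \<open>B' \<inter> F \<in> indep M\<close> card_seteq[of "B' \<inter> F" B] by auto
qed

lemma rank_union_le:
  assumes "finite I"
  shows "r (I \<union> F) \<le> card I + r F"
proof -
  obtain B where B: "B \<in> indep M" "B \<subseteq> F" "card B = r F" by (rule rank_attained)
  obtain B' where B': "B' \<in> indep M" "B \<subseteq> B'" "B' \<subseteq> I \<union> F" "card B' = r (I \<union> F)"
    using indep_extend[of B "I \<union> F"] B by auto
  have "B' \<subseteq> I \<union> B" using basis_extension_meets[OF B B'(1,2)] B' by auto
  then have "card B' \<le> card (I \<union> B)" using assms finite_indep[OF B(1)] by (intro card_mono) auto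
  also have "\<dots> \<le> card I + card B" by (rule card_Un_le)
  finally show ?thesis using B B' by simp
qed

text \<open>The right-hand side does not mention \<open>B\<close>: independence in a contraction
  does not depend on the chosen basis of \<open>F\<close>, and becomes a rank computation.\<close>

lemma indep_union_basis_iff:
  assumes "I \<subseteq> E - F" and B: "B \<in> indep M" "B \<subseteq> F" "card B = r F"
  shows "I \<union> B \<in> indep M \<longleftrightarrow> r (I \<union> F) = card I + r F"
proof
  have fI: "finite I" using assms finite_ground finite_subset by blast
  have disj: "I \<inter> B = {}" using assms by auto
  assume "I \<union> B \<in> indep M"
  then have "card (I \<union> B) \<le> r (I \<union> F)" using B by (intro card_le_rank) auto
  moreover have "card (I \<union> B) = card I + card B"
    using disj fI finite_indep[OF B(1)] by (simp add: card_Un_disjoint)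
  ultimately show "r (I \<union> F) = card I + r F" using rank_union_le[OF fI, of F] B by simp
next
  have fI: "finite I" using assms finite_ground finite_subset by blast
  assume R: "r (I \<union> F) = card I + r F"
  obtain B' where B': "B' \<in> indep M" "B \<subseteq> B'" "B' \<subseteq> I \<union> F" "card B' = r (I \<union> F)"
    using indep_extend[of B "I \<union> F"] B by auto
  have "B' \<subseteq> I \<union> B" using basis_extension_meets[OF B B'(1,2)] B' by auto
  moreover have "card (I \<union> B) \<le> card B'" using R B B' card_Un_le[of I B] by simp
  ultimately have "B' = I \<union> B" using fI finite_indep[OF B(1)] by (intro card_seteq) auto
  then show "I \<union> B \<in> indep M" using B' by simp
qed

section \<open>Contractions and their flats\<close>

lemma ground_contraction: "ground (contraction M F) = E - F"
  by (simp add: contraction_def)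

lemma indep_contraction_iff:
  "I \<in> indep (contraction M F) \<longleftrightarrow> I \<subseteq> E - F \<and> r (I \<union> F) = card I + r F"
proof -
  have "I \<in> indep (contraction M F) \<longleftrightarrow>
        I \<subseteq> E - F \<and> (\<exists>B. (B \<in> indep M \<and> B \<subseteq> F \<and> card B = r F) \<and> I \<union> B \<in> indep M)"
    by (simp add: contraction_def is_basis_iff)
  also have "\<dots> \<longleftrightarrow> I \<subseteq> E - F \<and> r (I \<union> F) = card I + r F"
    using indep_union_basis_iff[of I F] rank_attained[of F] by metis
  finally show ?thesis .
qed

lemma is_matroid_contraction: "is_matroid (contraction M F)"
proof -
  obtain B where B: "B \<in> indep M" "B \<subseteq> F" "card B = r F" by (rule rank_attained)
  have iff: "I \<in> indep (contraction M F) \<longleftrightarrow> I \<subseteq> E - F \<and> I \<union> B \<in> indep M" for I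
    using indep_union_basis_iff[OF _ B, of I] indep_contraction_iff[of I F] by blast
  show ?thesis
    unfolding is_matroid_def
  proof (intro conjI ballI allI impI)
    show "finite (ground (contraction M F))" by (simp add: ground_contraction finite_ground)
    show "{} \<in> indep (contraction M F)" using B iff by auto
  next
    fix I assume "I \<in> indep (contraction M F)"
    then show "I \<subseteq> ground (contraction M F)" by (simp add: iff ground_contraction)
  next
    fix I J assume "I \<in> indep (contraction M F)" "J \<subseteq> I"
    then show "J \<in> indep (contraction M F)" using indep_down[of "I \<union> B" "J \<union> B"] by (auto simp: iff)
  next
    fix I J assume I: "I \<in> indep (contraction M F)" and J: "J \<in> indep (contraction M F)" and c: "card J < card I"
    have "card (K \<union> B) = card K + card B" if "K \<in> indep (contraction M F)" for K
    proof (rule card_Un_disjoint)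
      show "finite K" using that iff finite_ground finite_subset by blast
      show "finite B" using B finite_indep by blast
      show "K \<inter> B = {}" using that B iff by auto
    qed
    then have "card (J \<union> B) < card (I \<union> B)" using I J c by simp
    then obtain x where "x \<in> (I \<union> B) - (J \<union> B)" "insert x (J \<union> B) \<in> indep M"
      using indep_exchange[of "I \<union> B" "J \<union> B"] I J iff by blast
    then show "\<exists>x\<in>I - J. insert x J \<in> indep (contraction M F)"
      using I J by (intro bexI[of _ x]) (auto simp: iff)
  qed
qed

lemma rank_contraction:
  assumes "A \<subseteq> E - F"
  shows "rk_of (contraction M F) A = r (A \<union> F) - r F"
proof -
  interpret N: matroid_structure "contraction M F"
    by unfold_locales (rule is_matroid_contraction)
  obtain I where I: "I \<in> indep (contraction M F)" "I \<subseteq> A" "card I = N.r A" by (rule N.rank_attained)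
  have le: "N.r A \<le> r (A \<union> F) - r F"
  proof -
    have "r (I \<union> F) \<le> r (A \<union> F)" using I by (intro rank_mono) auto
    then show ?thesis using I indep_contraction_iff[of I F] by simp
  qed
  obtain B where B: "B \<in> indep M" "B \<subseteq> F" "card B = r F" by (rule rank_attained)
  obtain B' where B': "B' \<in> indep M" "B \<subseteq> B'" "B' \<subseteq> A \<union> F" "card B' = r (A \<union> F)"
    using indep_extend[of B "A \<union> F"] B by auto
  have BF: "B' \<inter> F = B" by (rule basis_extension_meets[OF B B'(1,2)])
  have sub: "B' - F \<subseteq> E - F" using B' indep_subset by auto
  have eq: "(B' - F) \<union> B = B'" using BF by auto
  have "B' - F \<in> indep (contraction M F)"
    using indep_union_basis_iff[OF sub B] indep_contraction_iff[of "B' - F" F] sub eq B' by auto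
  then have "card (B' - F) \<le> N.r A" using B' by (intro N.card_le_rank) auto
  moreover have "card (B' - F) = r (A \<union> F) - r F"
  proof -
    have "B' - F = B' - B" using BF by auto
    then show ?thesis using card_Diff_subset[OF finite_indep[OF B(1)] B'(2)] B B' by simp
  qed
  ultimately show ?thesis using le by simp
qed

lemma contraction_contraction:
  assumes "G \<subseteq> F" "F \<subseteq> E"
  shows "contraction (contraction M G) (F - G) = contraction M F"
proof (rule matroid.expand, intro conjI)
  interpret N: matroid_structure "contraction M G"
    by unfold_locales (rule is_matroid_contraction)
  show "ground (contraction (contraction M G) (F - G)) = ground (contraction M F)"
    using assms by (auto simp: N.ground_contraction ground_contraction)
  show "indep (contraction (contraction M G) (F - G)) = indep (contraction M F)"
  proof (intro set_eqI)
    fix I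
    have "E - G - (F - G) = E - F" using assms by auto
    moreover have "N.r (I \<union> (F - G)) = card I + N.r (F - G) \<longleftrightarrow> r (I \<union> F) = card I + r F" if "I \<subseteq> E - F"
    proof -
      have "I \<union> (F - G) \<union> G = I \<union> F" "F - G \<union> G = F" using assms by auto
      moreover have "I \<union> (F - G) \<subseteq> E - G" "F - G \<subseteq> E - G" using assms that by auto
      ultimately have "N.r (I \<union> (F - G)) = r (I \<union> F) - r G" "N.r (F - G) = r F - r G"
        using rank_contraction[of "I \<union> (F - G)" G] rank_contraction[of "F - G" G] by auto
      then show ?thesis using rank_mono[of G F] rank_mono[of F "I \<union> F"] assms by auto
    qed
    ultimately show "I \<in> indep (contraction (contraction M G) (F - G)) \<longleftrightarrow> I \<in> indep (contraction M F)"
      by (auto simp: N.indep_contraction_iff indep_contraction_iff ground_contraction)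
  qed
qed

lemma finite_flats: "finite (flats M)"
  by (rule finite_subset[of _ "Pow E"]) (auto simp: flats_def finite_ground)

lemma flats_subset: "F \<in> flats M \<Longrightarrow> F \<subseteq> E"
  by (auto simp: flats_def)

lemma finite_flat: "F \<in> flats M \<Longrightarrow> finite F"
  using flats_subset finite_ground finite_subset by blast

lemma ground_flat: "E \<in> flats M"
  by (auto simp: flats_def)

lemma flats_contraction_iff:
  assumes "A \<subseteq> E - G" "G \<subseteq> E"
  shows "A \<in> flats (contraction M G) \<longleftrightarrow> A \<union> G \<in> flats M"
proof -
  have "rk_of (contraction M G) A < rk_of (contraction M G) (insert x A) \<longleftrightarrow> r (A \<union> G) < r (insert x (A \<union> G))"
    if "x \<in> E - G - A" for x
    using that assms rank_contraction[of A G] rank_contraction[of "insert x A" G]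
      rank_mono[of G "A \<union> G"] rank_mono[of G "insert x (A \<union> G)"]
    by auto
  moreover have "E - (A \<union> G) = E - G - A" by auto
  ultimately show ?thesis using assms by (auto simp: flats_def ground_contraction)
qed

lemma bij_betw_flats_contraction:
  assumes "G \<subseteq> E"
  shows "bij_betw (\<lambda>F. F - G) {F \<in> flats M. G \<subseteq> F} (flats (contraction M G))"
proof (rule bij_betw_byWitness[where f' = "\<lambda>A. A \<union> G"])
  interpret N: matroid_structure "contraction M G"
    by unfold_locales (rule is_matroid_contraction)
  have sub: "A \<subseteq> E - G" if "A \<in> flats (contraction M G)" for A
    using N.flats_subset[OF that] by (simp add: ground_contraction)
  show "\<forall>F\<in>{F \<in> flats M. G \<subseteq> F}. F - G \<union> G = F" by auto
  show "\<forall>A\<in>flats (contraction M G). A \<union> G - G = A" using sub by blast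
  show "(\<lambda>F. F - G) ` {F \<in> flats M. G \<subseteq> F} \<subseteq> flats (contraction M G)"
  proof clarify
    fix F assume F: "F \<in> flats M" "G \<subseteq> F"
    have "F - G \<subseteq> E - G" "F - G \<union> G = F" using F flats_subset[OF F(1)] by auto
    then show "F - G \<in> flats (contraction M G)"
      using flats_contraction_iff[of "F - G" G] assms F by simp
  qed
  show "(\<lambda>A. A \<union> G) ` flats (contraction M G) \<subseteq> {F \<in> flats M. G \<subseteq> F}"
    using flats_contraction_iff sub assms by auto
qed

text \<open>Extend a basis of \<open>A\<close> to one of \<open>F\<close> and then to one of
  \<open>insert x F\<close>. As \<open>F\<close> is a flat, the last step must pick up
  \<open>x\<close>, so \<open>x\<close> also extends the basis of \<open>A\<close>.\<close>

lemma rank_insert_flat: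
  assumes "F \<in> flats M" "A \<subseteq> F" "x \<in> E - F"
  shows "r A < r (insert x A)"
proof -
  obtain B where B: "B \<in> indep M" "B \<subseteq> A" "card B = r A" by (rule rank_attained)
  obtain C where C: "C \<in> indep M" "B \<subseteq> C" "C \<subseteq> F" "card C = r F"
    using indep_extend[of B F] B assms by auto
  obtain C' where C': "C' \<in> indep M" "C \<subseteq> C'" "C' \<subseteq> insert x F" "card C' = r (insert x F)"
    using indep_extend[of C "insert x F"] C by auto
  have "r F < r (insert x F)" using assms by (auto simp: flats_def)
  then have "C' \<noteq> C" using C C' by auto
  moreover have "C' \<inter> F = C" using basis_extension_meets[OF C(1,3,4) C'(1,2)] .
  ultimately have "x \<in> C'" using C' by auto
  then have "insert x B \<in> indep M" using C' C indep_down[of C' "insert x B"] by auto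
  then have "card (insert x B) \<le> r (insert x A)" using B by (intro card_le_rank) auto
  moreover have "x \<notin> B" using B assms by auto
  ultimately show ?thesis using B finite_indep[of B] by auto
qed

lemma rank_localization: "A \<subseteq> F \<Longrightarrow> rk_of (localization M F) A = r A"
proof -
  assume "A \<subseteq> F"
  then have "{I \<in> indep (localization M F). I \<subseteq> A} = {I \<in> indep M. I \<subseteq> A}"
    by (auto simp: localization_def)
  then show ?thesis by (simp add: rk_of_def)
qed

lemma flats_localization:
  assumes "F \<in> flats M"
  shows "flats (localization M F) = {G \<in> flats M. G \<subseteq> F}"
proof -
  have g: "ground (localization M F) = F" by (simp add: localization_def)
  have rk: "rk_of (localization M F) A < rk_of (localization M F) (insert x A) \<longleftrightarrow> r A < r (insert x A)"
    if "A \<subseteq> F" "x \<in> F" for A x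
    using that rank_localization[of A F] rank_localization[of "insert x A" F] by auto
  have "G \<in> flats (localization M F) \<longleftrightarrow> G \<in> flats M \<and> G \<subseteq> F" for G
  proof
    assume "G \<in> flats (localization M F)"
    then have G: "G \<subseteq> F" "\<And>x. x \<in> F - G \<Longrightarrow> r G < r (insert x G)"
      using rk unfolding flats_def g by auto
    then show "G \<in> flats M \<and> G \<subseteq> F"
      using rank_insert_flat[OF assms G(1)] flats_subset[OF assms] unfolding flats_def by blast
  next
    assume "G \<in> flats M \<and> G \<subseteq> F"
    then show "G \<in> flats (localization M F)"
      using rk flats_subset[OF assms] unfolding flats_def g by auto
  qed
  then show ?thesis by auto
qed

text \<open>This is the least flat. It may be nonempty, so the term of the recursion that belongs to
  \<open>M\<close> itself sits at \<open>loops\<close> and not at the empty set.\<close>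

definition loops :: "'a set" where "loops = {x \<in> E. r {x} = 0}"

lemma rank_eq_0_iff: "A \<subseteq> E \<Longrightarrow> r A = 0 \<longleftrightarrow> A \<subseteq> loops"
proof -
  assume A: "A \<subseteq> E"
  show ?thesis
  proof
    assume "r A = 0"
    then show "A \<subseteq> loops" using A rank_mono[of "{_}" A] by (fastforce simp: loops_def)
  next
    assume L: "A \<subseteq> loops"
    obtain I where I: "I \<in> indep M" "I \<subseteq> A" "card I = r A" by (rule rank_attained)
    have "I = {}"
    proof (rule ccontr)
      assume "I \<noteq> {}"
      then obtain x where "x \<in> I" by auto
      then have "{x} \<in> indep M" "r {x} = 0" using I L indep_down[of I "{x}"] by (auto simp: loops_def)
      then show False using card_le_rank[of "{x}" "{x}"] by auto
    qed
    then show "r A = 0" using I by simp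
  qed
qed

lemma loops_subset_flat: "F \<in> flats M \<Longrightarrow> loops \<subseteq> F"
proof
  fix x assume F: "F \<in> flats M" and x: "x \<in> loops"
  show "x \<in> F"
    using rank_insert_flat[OF F, of "{}" x] x rank_eq_0_iff[of "{x}"] by (auto simp: loops_def)
qed

lemma loops_flat: "loops \<in> flats M"
proof -
  have "r loops = 0" by (subst rank_eq_0_iff) (auto simp: loops_def)
  moreover have "0 < r (insert x loops)" if "x \<in> E - loops" for x
    using that rank_eq_0_iff[of "insert x loops"] by (auto simp: loops_def)
  ultimately show ?thesis by (auto simp: flats_def loops_def)
qed

lemma rank_loops: "r loops = 0"
  by (subst rank_eq_0_iff) (auto simp: loops_def)

lemma rank_flat_eq_0_iff: "F \<in> flats M \<Longrightarrow> r F = 0 \<longleftrightarrow> F = loops"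
  using rank_eq_0_iff[of F] flats_subset[of F] loops_subset_flat[of F] by auto

lemma rk_contraction: "F \<subseteq> E \<Longrightarrow> rk (contraction M F) = rk M - r F"
  using rank_contraction[of "E - F" F] by (simp add: rk_def ground_contraction Un_absorb2)

lemma rank_le_rk: "F \<subseteq> E \<Longrightarrow> r F \<le> rk M"
  by (simp add: rk_def rank_mono)

lemma least_flat_localization:
  assumes "F \<in> flats M"
  shows "(LEAST F0. F0 \<in> flats (localization M F)) = loops"
  by (rule Least_equality)
     (use assms loops_flat loops_subset_flat in \<open>auto simp: flats_localization[OF assms]\<close>)

text \<open>The recursion for the value at \<open>G\<close> visits only flats below
  \<open>G\<close>, and below \<open>F\<close> both matroids have the same flats.\<close>

lemma moebius_localization:
  assumes "F \<in> flats M" "G \<subseteq> F"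
  shows "moebius (flats (localization M F)) L G = moebius (flats M) L G"
proof -
  have "finite G" using assms finite_flat finite_subset by blast
  then show ?thesis using assms(2)
  proof (induction G rule: finite_psubset_induct)
    case (psubset G)
    have *: "{Z \<in> flats (localization M F). L \<subseteq> Z \<and> Z \<subset> G} = {Z \<in> flats M. L \<subseteq> Z \<and> Z \<subset> G}"
      using psubset.prems by (auto simp: flats_localization[OF assms(1)])
    have "(\<Sum>Z\<in>{Z \<in> flats M. L \<subseteq> Z \<and> Z \<subset> G}. moebius (flats (localization M F)) L Z) =
          (\<Sum>Z\<in>{Z \<in> flats M. L \<subseteq> Z \<and> Z \<subset> G}. moebius (flats M) L Z)"
      using psubset by (intro sum.cong) auto
    then show ?case
      by (simp add: moebius.simps[of _ L G] *)
  qed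
qed

lemma char_poly_localization:
  assumes F: "F \<in> flats M"
  shows "matroid_char_poly (localization M F) =
    (\<Sum>G\<in>{G \<in> flats M. G \<subseteq> F}. monom (moebius (flats M) loops G) (r F - r G))"
proof -
  have rk: "rk (localization M F) = r F"
    using rank_localization[of F F] by (simp add: rk_def localization_def)
  show ?thesis
    unfolding matroid_char_poly_def least_flat_localization[OF F] rk
    by (rule sum.cong)
       (use moebius_localization[OF F] rank_localization flats_localization[OF F] in auto)
qed

lemma sum_moebius:
  assumes F: "F \<in> flats M"
  shows "(\<Sum>G\<in>{G \<in> flats M. G \<subseteq> F}. moebius (flats M) loops G) = (if F = loops then 1 else 0)"
proof (cases "F = loops")
  case True
  then have "{G \<in> flats M. G \<subseteq> F} = {loops}" using loops_subset_flat loops_flat by auto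
  then show ?thesis using True by (simp add: moebius.simps)
next
  case False
  have "{G \<in> flats M. G \<subseteq> F} = insert F {G \<in> flats M. loops \<subseteq> G \<and> G \<subset> F}"
    using F loops_subset_flat by auto
  then have "(\<Sum>G\<in>{G \<in> flats M. G \<subseteq> F}. moebius (flats M) loops G) =
     moebius (flats M) loops F + (\<Sum>G\<in>{G \<in> flats M. loops \<subseteq> G \<and> G \<subset> F}. moebius (flats M) loops G)"
    using finite_flats by simp
  also have "moebius (flats M) loops F = - (\<Sum>G\<in>{G \<in> flats M. loops \<subseteq> G \<and> G \<subset> F}. moebius (flats M) loops G)"
    using False loops_subset_flat[OF F] finite_flat[OF F] by (subst moebius.simps) auto
  finally show ?thesis using False by simp
qed

end

section \<open>The Kazhdan--Lusztig assignment\<close>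

text \<open>
  The defining recursion is solved in the form saying that $\sum_F t^{\mathrm{rk} F} P_{M_F}(t)$ is
  palindromic: there the terms with \<open>F\<close> of positive rank form an antisymmetric polynomial for trivial
  reasons, so its lower half determines $P_M$. Moebius inversion recovers the original form.
\<close>

function KL :: "'a matroid \<Rightarrow> int poly" where
  "KL M =
     (if \<not> is_matroid M then 0 else if rk M = 0 then 1
      else - truncate_half (rk M)
        (\<Sum>F\<in>{F \<in> flats M. 0 < rk_of M F}.
           monom 1 (rk_of M F) * KL (contraction M F) - reverse_poly (rk M - rk_of M F) (KL (contraction M F))))"
  by pat_completeness auto
termination
proof (relation "measure rk")
  have "rk (contraction M F) < rk M" if "is_matroid M" "F \<in> flats M" "0 < rk_of M F" for M :: "'a matroid" and F
  proof -
    interpret matroid_structure M using that by unfold_locales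
    show ?thesis
      using that rank_le_rk[OF flats_subset, of F] by (simp add: rk_contraction flats_subset)
  qed
  then show "(contraction M F, M) \<in> measure rk" "(contraction M F, M) \<in> measure rk"
    if "\<not> \<not> is_matroid M" "F \<in> {F \<in> flats M. 0 < rk_of M F}" for M :: "'a matroid" and F
    using that by auto
qed auto

declare KL.simps [simp del]

context matroid_structure begin

text \<open>Let Z be the sum of t^{rk F} P(M_F). This is the part of Z minus its reversal coming
  from flats of positive rank, so palindromicity of Z says that it equals the reversal of P(M) minus
  P(M).\<close>

definition kl_defect :: "('a matroid \<Rightarrow> int poly) \<Rightarrow> int poly" where
  "kl_defect P = (\<Sum>F\<in>{F \<in> flats M. 0 < r F}.
     monom 1 (r F) * P (contraction M F) - reverse_poly (rk M - r F) (P (contraction M F)))"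

lemma KL_rank_0: "rk M = 0 \<Longrightarrow> KL M = 1"
  by (simp add: KL.simps[of M] is_matroid)

lemma KL_pos: "0 < rk M \<Longrightarrow> KL M = - truncate_half (rk M) (kl_defect KL)"
  unfolding kl_defect_def by (subst KL.simps) (simp add: is_matroid)

lemma degree_KL: "0 < rk M \<Longrightarrow> 2 * degree (KL M) < rk M"
  using KL_pos degree_truncate_half by metis

lemma degree_KL_le: "degree (KL M) \<le> rk M"
  using degree_KL KL_rank_0 by (cases "rk M = 0") auto

lemma degree_KL_contraction: "F \<subseteq> E \<Longrightarrow> degree (KL (contraction M F)) \<le> rk M - r F"
proof -
  assume "F \<subseteq> E"
  interpret N: matroid_structure "contraction M F"
    by unfold_locales (rule is_matroid_contraction)
  show ?thesis using N.degree_KL_le rk_contraction[OF \<open>F \<subseteq> E\<close>] by simp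
qed

text \<open>Reversal in degree \<open>rk M\<close> exchanges the two parts of every summand.\<close>

lemma reverse_kl_defect: "reverse_poly (rk M) (kl_defect KL) = - kl_defect KL"
proof -
  have "reverse_poly (rk M) (kl_defect KL) = (\<Sum>F\<in>{F \<in> flats M. 0 < r F}.
     reverse_poly (rk M - r F) (KL (contraction M F)) - monom 1 (r F) * KL (contraction M F))"
    unfolding kl_defect_def reverse_poly_sum reverse_poly_diff
    by (rule sum.cong)
       (use rank_le_rk flats_subset degree_KL_contraction reverse_poly_monom_mult reverse_poly_reverse_poly in auto)
  then show ?thesis by (simp add: kl_defect_def sum_negf[symmetric])
qed

lemma reverse_KL: "0 < rk M \<Longrightarrow> reverse_poly (rk M) (KL M) - KL M = kl_defect KL"
  using reverse_truncate_half[OF reverse_kl_defect] KL_pos by metis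

lemma KL_eqI:
  assumes "0 < rk M" "2 * degree Q < rk M" "reverse_poly (rk M) Q - Q = kl_defect KL"
  shows "KL M = Q"
  by (rule reverse_half_unique[OF degree_KL]) (use assms reverse_KL in auto)

lemma flats_split: "flats M = insert loops {F \<in> flats M. 0 < r F}"
  using rank_flat_eq_0_iff loops_flat by auto

lemma sum_flats_split:
  fixes f :: "'a set \<Rightarrow> 'b :: comm_monoid_add"
  shows "sum f (flats M) = f loops + sum f {F \<in> flats M. 0 < r F}"
  by (subst flats_split) (simp add: finite_flats rank_loops)

text \<open>Deleting the loops from every flat keeps the ranks and the contractions at flats of
  positive rank, hence the whole recursion. It identifies the term at the least flat with
  \<open>KL M\<close>.\<close>

lemma KL_contraction_loops: "KL (contraction M loops) = KL M"
proof -
  let ?N = "contraction M loops"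
  have L: "loops \<subseteq> E" by (auto simp: loops_def)
  interpret N: matroid_structure ?N by unfold_locales (rule is_matroid_contraction)
  have rk: "rk ?N = rk M" using rk_contraction[OF L] by (simp add: rank_loops)
  show ?thesis
  proof (cases "rk M = 0")
    case True
    then show ?thesis using rk KL_rank_0 N.KL_rank_0 by simp
  next
    case False
    have r: "N.r (F - loops) = r F" if "F \<in> flats M" for F
    proof -
      have "F - loops \<union> loops = F" using loops_subset_flat[OF that] by auto
      then show ?thesis using rank_contraction[of "F - loops" loops] flats_subset[OF that] rank_loops by auto
    qed
    have bij: "bij_betw (\<lambda>F. F - loops) {F \<in> flats M. 0 < r F} {F \<in> flats ?N. 0 < N.r F}"
    proof -
      have "bij_betw (\<lambda>F. F - loops) (flats M) (flats ?N)"
        using bij_betw_flats_contraction[OF L] loops_subset_flat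
        by (metis (no_types, lifting) Collect_cong Collect_mem_eq)
      then have "inj_on (\<lambda>F. F - loops) (flats M)" "(\<lambda>F. F - loops) ` flats M = flats ?N"
        by (simp_all add: bij_betw_def)
      then have inj: "inj_on (\<lambda>F. F - loops) {F \<in> flats M. 0 < r F}"
        and img: "A \<in> flats ?N \<longleftrightarrow> (\<exists>F\<in>flats M. A = F - loops)" for A
        by (auto intro: inj_on_subset)
      have "(\<lambda>F. F - loops) ` {F \<in> flats M. 0 < r F} = {F \<in> flats ?N. 0 < N.r F}"
      proof (intro equalityI subsetI)
        fix A assume "A \<in> {F \<in> flats ?N. 0 < N.r F}"
        then obtain F where "F \<in> flats M" "A = F - loops" "0 < N.r A" using img[of A] by auto
        then show "A \<in> (\<lambda>F. F - loops) ` {F \<in> flats M. 0 < r F}" using r[of F] by auto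
      next
        fix A assume "A \<in> (\<lambda>F. F - loops) ` {F \<in> flats M. 0 < r F}"
        then obtain F where "F \<in> flats M" "A = F - loops" "0 < r F" by auto
        then show "A \<in> {F \<in> flats ?N. 0 < N.r F}" using r[of F] img[of A] by auto
      qed
      then show ?thesis using inj by (simp add: bij_betw_def)
    qed
    \<comment> \<open>Contracting first the loops and then the rest of \<open>F\<close> is
      contracting \<open>F\<close>, so the sums agree term by term.\<close>
    have "N.kl_defect KL = kl_defect KL"
      unfolding N.kl_defect_def kl_defect_def
      by (subst sum.reindex_bij_betw[OF bij, symmetric], rule sum.cong)
         (use r rk contraction_contraction loops_subset_flat flats_subset in auto)
    then show ?thesis using False N.KL_pos KL_pos rk by simp
  qed
qed

lemma Z_palindromic:
  "(\<Sum>F\<in>flats M. monom 1 (r F) * KL (contraction M F)) =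
   (\<Sum>F\<in>flats M. reverse_poly (rk M - r F) (KL (contraction M F)))"
proof (cases "rk M = 0")
  case True
  have rF: "r F = 0" if "F \<in> flats M" for F
    using rank_le_rk[OF flats_subset[OF that]] True by simp
  have "flats M = {loops}"
  proof (intro equalityI subsetI)
    show "F \<in> {loops}" if "F \<in> flats M" for F using rF[OF that] rank_flat_eq_0_iff[OF that] by simp
  qed (simp add: loops_flat)
  moreover have "reverse_poly 0 1 = 1" by (simp add: reverse_poly_def)
  ultimately show ?thesis using True by (simp add: KL_contraction_loops KL_rank_0 rank_loops)
next
  case False
  then have "reverse_poly (rk M) (KL M) = KL M + kl_defect KL"
    using reverse_KL by (simp add: algebra_simps)
  then show ?thesis
    by (simp add: sum_flats_split KL_contraction_loops rank_loops kl_defect_def sum_subtractf monom_0)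
qed

text \<open>Palindromicity of the contraction at \<open>G\<close>, written over the flats of
  \<open>M\<close> above \<open>G\<close>; Moebius inversion needs it for every such upper
  interval.\<close>

lemma Z_palindromic_upper:
  assumes G: "G \<in> flats M"
  shows "(\<Sum>F\<in>{F \<in> flats M. G \<subseteq> F}. monom 1 (r F - r G) * KL (contraction M F)) =
   (\<Sum>F\<in>{F \<in> flats M. G \<subseteq> F}. reverse_poly (rk M - r F) (KL (contraction M F)))"
proof -
  let ?N = "contraction M G"
  have GE: "G \<subseteq> E" using flats_subset[OF G] .
  interpret N: matroid_structure ?N by unfold_locales (rule is_matroid_contraction)
  have r: "N.r (F - G) = r F - r G" if "F \<in> flats M" "G \<subseteq> F" for F
  proof -
    have "F - G \<union> G = F" using that by auto
    then show ?thesis using rank_contraction[of "F - G" G] flats_subset[OF that(1)] by auto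
  qed
  have cc: "contraction ?N (F - G) = contraction M F" if "F \<in> flats M" "G \<subseteq> F" for F
    using contraction_contraction flats_subset that by blast
  have rk: "rk ?N - (r F - r G) = rk M - r F" if "F \<in> flats M" "G \<subseteq> F" for F
    using rk_contraction[OF GE] rank_mono[OF that(2)] by simp
  note bij = bij_betw_flats_contraction[OF GE]
  have 1: "(\<Sum>F\<in>flats ?N. monom 1 (N.r F) * KL (contraction ?N F)) =
     (\<Sum>F\<in>{F \<in> flats M. G \<subseteq> F}. monom 1 (r F - r G) * KL (contraction M F))"
    by (subst sum.reindex_bij_betw[OF bij, symmetric], rule sum.cong) (auto simp: r cc)
  have 2: "(\<Sum>F\<in>flats ?N. reverse_poly (rk ?N - N.r F) (KL (contraction ?N F))) =
     (\<Sum>F\<in>{F \<in> flats M. G \<subseteq> F}. reverse_poly (rk M - r F) (KL (contraction M F)))"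
    by (subst sum.reindex_bij_betw[OF bij, symmetric], rule sum.cong) (auto simp: r cc rk)
  show ?thesis using N.Z_palindromic 1 2 by simp
qed

text \<open>Expand the characteristic polynomials and sum over the flats above a fixed
  \<open>G\<close> first: there palindromicity removes the dependence on \<open>r G\<close>. After
  swapping back, the Moebius sum below \<open>F\<close> vanishes unless \<open>F\<close> is the
  least flat.\<close>

lemma KL_char_poly_equation:
  "reverse_poly (rk M) (KL M) =
     (\<Sum>F\<in>flats M. matroid_char_poly (localization M F) * KL (contraction M F))"
proof -
  let ?\<mu> = "moebius (flats M) loops"
  have mon: "monom a b = smult a (monom 1 b)" for a :: int and b by (simp add: smult_monom)
  have "(\<Sum>F\<in>flats M. matroid_char_poly (localization M F) * KL (contraction M F)) =
     (\<Sum>F\<in>flats M. \<Sum>G\<in>{G \<in> flats M. G \<subseteq> F}. smult (?\<mu> G) (monom 1 (r F - r G) * KL (contraction M F)))"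
  proof (rule sum.cong[OF refl])
    fix F assume F: "F \<in> flats M"
    show "matroid_char_poly (localization M F) * KL (contraction M F) =
      (\<Sum>G\<in>{G \<in> flats M. G \<subseteq> F}. smult (?\<mu> G) (monom 1 (r F - r G) * KL (contraction M F)))"
      unfolding char_poly_localization[OF F] sum_distrib_right
      by (rule sum.cong[OF refl], subst mon) simp
  qed
  also have "\<dots> = (\<Sum>G\<in>flats M. \<Sum>F\<in>{F \<in> flats M. G \<subseteq> F}. smult (?\<mu> G) (monom 1 (r F - r G) * KL (contraction M F)))"
    by (rule sum.swap_restrict[OF finite_flats finite_flats])
  also have "\<dots> = (\<Sum>G\<in>flats M. \<Sum>F\<in>{F \<in> flats M. G \<subseteq> F}. smult (?\<mu> G) (reverse_poly (rk M - r F) (KL (contraction M F))))"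
    by (rule sum.cong[OF refl]) (simp add: smult_sum_right[symmetric] Z_palindromic_upper)
  also have "\<dots> = (\<Sum>F\<in>flats M. \<Sum>G\<in>{G \<in> flats M. G \<subseteq> F}. smult (?\<mu> G) (reverse_poly (rk M - r F) (KL (contraction M F))))"
    by (rule sum.swap_restrict[OF finite_flats finite_flats, symmetric])
  also have "\<dots> = (\<Sum>F\<in>flats M. if F = loops then reverse_poly (rk M - r F) (KL (contraction M F)) else 0)"
    by (rule sum.cong[OF refl]) (auto simp: smult_sum[symmetric] sum_moebius)
  also have "\<dots> = reverse_poly (rk M) (KL M)"
    using finite_flats loops_flat by (simp add: rank_loops KL_contraction_loops)
  finally show ?thesis by simp
qed

end

lemma is_kl_assignment_KL: "is_kl_assignment KL"
  unfolding is_kl_assignment_def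
proof (intro conjI allI impI)
  fix M :: "'a matroid" assume "is_matroid M"
  then interpret matroid_structure M by unfold_locales
  show "rk M = 0 \<Longrightarrow> KL M = 1" by (rule KL_rank_0)
  show "rk M > 0 \<Longrightarrow> 2 * degree (KL M) < rk M" by (rule degree_KL)
  show "reverse_poly (rk M) (KL M) =
     (\<Sum>F\<in>flats M. matroid_char_poly (localization M F) * KL (contraction M F))"
    by (rule KL_char_poly_equation)
qed (simp add: KL.simps)

section \<open>Uniqueness of the assignment\<close>

lemma (in matroid_structure) contraction_empty: "contraction M {} = M"
proof (rule matroid.expand, intro conjI)
  show "indep (contraction M {}) = indep M"
    using rank_eq_0_iff[of "{}"] by (auto simp: indep_contraction_iff indep_iff_rank)
qed (auto simp: ground_contraction)

lemma is_kl_assignmentD: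
  assumes "is_kl_assignment P"
  shows "\<not> is_matroid M \<Longrightarrow> P M = 0"
    and "is_matroid M \<Longrightarrow> rk M = 0 \<Longrightarrow> P M = 1"
    and "is_matroid M \<Longrightarrow> 0 < rk M \<Longrightarrow> 2 * degree (P M) < rk M"
    and "is_matroid M \<Longrightarrow> reverse_poly (rk M) (P M) =
          (\<Sum>F\<in>flats M. matroid_char_poly (localization M F) * P (contraction M F))"
  using conjunct1[OF assms[unfolded is_kl_assignment_def], THEN spec[of _ M]]
    conjunct2[OF assms[unfolded is_kl_assignment_def], THEN spec[of _ M]] by blast+

text \<open>At the least flat the defining equation contains the value at the contraction by the
  loops, not at \<open>M\<close>. These coincide for a loopless matroid, where the degree bound
  decides; so the loopless contraction is settled first, and then the equation for \<open>M\<close>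
  gives the reversal of the value at \<open>M\<close>.\<close>

lemma kl_assignment_unique:
  assumes P: "is_kl_assignment P" and Q: "is_kl_assignment Q"
  shows "P M = Q M"
proof (induction "rk M" arbitrary: M rule: less_induct)
  case (less M)
  show ?case
  proof (cases "is_matroid M \<and> rk M \<noteq> 0")
    case False
    then consider "\<not> is_matroid M" | "is_matroid M" "rk M = 0" by blast
    then show ?thesis using is_kl_assignmentD(1,2)[OF P, of M] is_kl_assignmentD(1,2)[OF Q, of M] by cases auto
  next
    case True
    then have pos: "0 < rk M" by auto
    \<comment> \<open>Stated for every matroid of the same rank, because it is applied both to
      \<open>M\<close> and to its contraction by the loops.\<close>
    have step: "reverse_poly (rk N) (P N) - P (contraction N (matroid_structure.loops N)) =
                reverse_poly (rk N) (Q N) - Q (contraction N (matroid_structure.loops N))"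
      if N: "is_matroid N" "rk N = rk M" for N :: "'a matroid"
    proof -
      interpret N: matroid_structure N using N by unfold_locales
      have chi: "matroid_char_poly (localization N N.loops) = 1"
      proof -
        have "{G \<in> flats N. G \<subseteq> N.loops} = {N.loops}" using N.loops_subset_flat N.loops_flat by auto
        then show ?thesis
          by (simp add: N.char_poly_localization[OF N.loops_flat] moebius.simps monom_0)
      qed
      have eq: "reverse_poly (rk N) (X N) = X (contraction N N.loops) +
          (\<Sum>F\<in>{F \<in> flats N. 0 < N.r F}. matroid_char_poly (localization N F) * X (contraction N F))"
        if "is_kl_assignment X" for X
      proof -
        show ?thesis
          using is_kl_assignmentD(4)[OF that N(1)] chi by (simp add: N.sum_flats_split)
      qed
      have "(\<Sum>F\<in>{F \<in> flats N. 0 < N.r F}. matroid_char_poly (localization N F) * P (contraction N F)) =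
            (\<Sum>F\<in>{F \<in> flats N. 0 < N.r F}. matroid_char_poly (localization N F) * Q (contraction N F))"
      proof (rule sum.cong[OF refl])
        fix F assume F: "F \<in> {F \<in> flats N. 0 < N.r F}"
        then have "rk (contraction N F) < rk M"
          using N.rk_contraction[of F] N.flats_subset[of F] N pos by auto
        then show "matroid_char_poly (localization N F) * P (contraction N F) =
            matroid_char_poly (localization N F) * Q (contraction N F)" using less by simp
      qed
      then show ?thesis using eq[OF P] eq[OF Q] by simp
    qed
    have deg: "2 * degree (P N) < rk N" "2 * degree (Q N) < rk N" if "is_matroid N" "rk N = rk M" for N
      using is_kl_assignmentD(3)[OF P that(1)] is_kl_assignmentD(3)[OF Q that(1)] that pos by auto
    interpret matroid_structure M using True by unfold_locales auto
    let ?N = "contraction M loops"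
    have L: "loops \<subseteq> E" by (auto simp: loops_def)
    interpret N: matroid_structure ?N by unfold_locales (rule is_matroid_contraction)
    have rkN: "rk ?N = rk M" using rk_contraction[OF L] by (simp add: rank_loops)
    \<comment> \<open>Contracting the loops leaves none, so for this matroid the equation involves
      only its own value.\<close>
    have "N.loops = {}"
    proof -
      have "N.r {x} \<noteq> 0" if "x \<in> E - loops" for x
        using that rank_contraction[of "{x}" loops] rank_eq_0_iff[of "insert x loops"] L
        by (auto simp: rank_loops)
      then show ?thesis unfolding N.loops_def ground_contraction by blast
    qed
    then have "P ?N = Q ?N"
      using step[OF N.is_matroid rkN] reverse_half_unique[OF deg[OF N.is_matroid rkN]] N.contraction_empty by simp
    then have eq: "reverse_poly (rk M) (P M) = reverse_poly (rk M) (Q M)"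
      using step[OF is_matroid refl] by simp
    have "degree (P M) \<le> rk M" "degree (Q M) \<le> rk M"
      using deg[OF is_matroid refl] by linarith+
    then show ?thesis using eq by (rule reverse_poly_inject)
  qed
qed

lemma kl_poly_eq_KL: "kl_poly = KL"
  unfolding kl_poly_def
  by (rule the_equality) (use is_kl_assignment_KL kl_assignment_unique in auto)

section \<open>Linear extensions\<close>

text \<open>\<open>C\<close> may be any relation, for instance a covering relation without its
  transitive closure, so comparisons can be added or dropped by changing \<open>C\<close>
  alone.\<close>

definition fillings :: "'a set \<Rightarrow> ('a \<Rightarrow> 'a \<Rightarrow> bool) \<Rightarrow> ('a \<Rightarrow> nat) set" where
  "fillings S C = {\<alpha> \<in> extensional S. bij_betw \<alpha> S {1..card S} \<and> (\<forall>x\<in>S. \<forall>y\<in>S. C x y \<longrightarrow> \<alpha> x < \<alpha> y)}"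

lemma finite_fillings: "finite S \<Longrightarrow> finite (fillings S C)"
  by (rule finite_subset[OF _ finite_PiE[of S "\<lambda>_. {1..card S}"]])
     (auto simp: fillings_def PiE_def bij_betw_def)

lemma fillingsD:
  assumes "\<alpha> \<in> fillings S C"
  shows "\<alpha> \<in> extensional S" "bij_betw \<alpha> S {1..card S}"
    and "x \<in> S \<Longrightarrow> y \<in> S \<Longrightarrow> C x y \<Longrightarrow> \<alpha> x < \<alpha> y"
    and "x \<in> S \<Longrightarrow> 1 \<le> \<alpha> x" "x \<in> S \<Longrightarrow> \<alpha> x \<le> card S"
proof -
  show *: "\<alpha> \<in> extensional S" "bij_betw \<alpha> S {1..card S}"
    "x \<in> S \<Longrightarrow> y \<in> S \<Longrightarrow> C x y \<Longrightarrow> \<alpha> x < \<alpha> y"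
    using assms by (auto simp: fillings_def)
  show "x \<in> S \<Longrightarrow> 1 \<le> \<alpha> x" "x \<in> S \<Longrightarrow> \<alpha> x \<le> card S"
    using bij_betwE[OF *(2)] by auto
qed

lemma fillings_cong:
  assumes "S = S'" "\<And>x y. x \<in> S \<Longrightarrow> y \<in> S \<Longrightarrow> C x y = C' x y"
  shows "fillings S C = fillings S' C'"
  using assms by (auto simp: fillings_def)

lemma card_fillings_empty: "card (fillings {} C) = 1"
proof -
  have "fillings {} C = {\<lambda>x. undefined}"
    by (auto simp: fillings_def bij_betw_def extensional_def)
  then show ?thesis by simp
qed

lemma card_fillings_split:
  assumes "finite S" "x \<in> S" "y \<in> S" "x \<noteq> y"
  shows "card (fillings S C) =
    card (fillings S (\<lambda>a b. C a b \<or> a = x \<and> b = y)) + card (fillings S (\<lambda>a b. C a b \<or> a = y \<and> b = x))"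
proof -
  let ?A = "fillings S (\<lambda>a b. C a b \<or> a = x \<and> b = y)" and ?B = "fillings S (\<lambda>a b. C a b \<or> a = y \<and> b = x)"
  have neq: "\<alpha> x \<noteq> \<alpha> y" if "\<alpha> \<in> fillings S C" for \<alpha>
    using that assms by (auto simp: fillings_def bij_betw_def inj_on_def)
  have "fillings S C = ?A \<union> ?B"
  proof (intro equalityI subsetI)
    fix \<alpha> assume "\<alpha> \<in> fillings S C"
    then show "\<alpha> \<in> ?A \<union> ?B" using neq[of \<alpha>] by (auto simp: fillings_def)
  qed (auto simp: fillings_def)
  moreover have "?A \<inter> ?B = {}"
  proof -
    have False if "\<alpha> \<in> ?A" "\<alpha> \<in> ?B" for \<alpha>
      using fillingsD(3)[OF that(1), of x y] fillingsD(3)[OF that(2), of y x] assms by auto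
    then show ?thesis by auto
  qed
  ultimately show ?thesis using assms by (simp add: card_Un_disjoint finite_fillings)
qed

lemma bij_betw_fillings_remove:
  assumes "finite S" "x \<in> S" "\<forall>y\<in>S. \<not> C x y"
  shows "bij_betw (\<lambda>\<alpha>. restrict \<alpha> (S - {x})) {\<alpha> \<in> fillings S C. \<alpha> x = card S} (fillings (S - {x}) C)"
proof (rule bij_betw_byWitness[where f' = "\<lambda>\<beta>. \<beta>(x := card S)"])
  have c: "card (S - {x}) = card S - 1" "0 < card S" using assms by (auto simp: card_gt_0_iff)
  show "\<forall>\<alpha>\<in>{\<alpha> \<in> fillings S C. \<alpha> x = card S}. (restrict \<alpha> (S - {x}))(x := card S) = \<alpha>"
    by (auto simp: fillings_def extensional_def fun_eq_iff)
  show "\<forall>\<beta>\<in>fillings (S - {x}) C. restrict (\<beta>(x := card S)) (S - {x}) = \<beta>"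
    by (auto simp: fillings_def extensional_def fun_eq_iff)
  show "(\<lambda>\<alpha>. restrict \<alpha> (S - {x})) ` {\<alpha> \<in> fillings S C. \<alpha> x = card S} \<subseteq> fillings (S - {x}) C"
  proof clarify
    fix \<alpha> assume \<alpha>: "\<alpha> \<in> fillings S C" "\<alpha> x = card S"
    have "bij_betw \<alpha> (S - {x}) ({1..card S} - {card S})"
    proof (rule bij_betw_DiffI[OF fillingsD(2)[OF \<alpha>(1)]])
      show "bij_betw \<alpha> {x} {card S}" using \<alpha>(2) by (simp add: bij_betw_def)
    qed (use assms c in auto)
    moreover have "{1..card S} - {card S} = {1..card S - 1}" by auto
    ultimately have "bij_betw \<alpha> (S - {x}) {1..card (S - {x})}" using c by simp
    then have "bij_betw (restrict \<alpha> (S - {x})) (S - {x}) {1..card (S - {x})}"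
      by (subst bij_betw_cong[where g = \<alpha>]) auto
    then show "restrict \<alpha> (S - {x}) \<in> fillings (S - {x}) C"
      using fillingsD(3)[OF \<alpha>(1)] by (auto simp: fillings_def)
  qed
  show "(\<lambda>\<beta>. \<beta>(x := card S)) ` fillings (S - {x}) C \<subseteq> {\<alpha> \<in> fillings S C. \<alpha> x = card S}"
  proof clarify
    fix \<beta> assume \<beta>: "\<beta> \<in> fillings (S - {x}) C"
    have "bij_betw \<beta> (S - {x}) {1..card S - 1}" using fillingsD(2)[OF \<beta>] c by simp
    then have "bij_betw (\<beta>(x := card S)) (S - {x}) {1..card S - 1}"
      by (subst bij_betw_cong[where g = \<beta>]) auto
    then have "bij_betw (\<beta>(x := card S)) ((S - {x}) \<union> {x}) ({1..card S - 1} \<union> {(\<beta>(x := card S)) x})"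
      by (rule notIn_Un_bij_betw[rotated 2]) (use c in auto)
    moreover have "(S - {x}) \<union> {x} = S" "{1..card S - 1} \<union> {card S} = {1..card S}" using assms c by auto
    ultimately have "bij_betw (\<beta>(x := card S)) S {1..card S}" by simp
    moreover have "(\<beta>(x := card S)) a < (\<beta>(x := card S)) b" if "a \<in> S" "b \<in> S" "C a b" for a b
      using that assms fillingsD(3)[OF \<beta>, of a b] fillingsD(5)[OF \<beta>, of a] c by (cases "b = x") auto
    moreover have "\<beta>(x := card S) \<in> extensional S" using fillingsD(1)[OF \<beta>] assms by (auto simp: extensional_def)
    ultimately show "\<beta>(x := card S) \<in> fillings S C \<and> (\<beta>(x := card S)) x = card S" by (auto simp: fillings_def)
  qed
qed

text \<open>The largest value sits on a cell that is maximal for \<open>C\<close>; classify the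
  fillings by this cell and delete it.\<close>

lemma card_fillings_remove_max:
  assumes "finite S" "S \<noteq> {}"
  shows "card (fillings S C) = (\<Sum>x\<in>{x \<in> S. \<forall>y\<in>S. \<not> C x y}. card (fillings (S - {x}) C))"
proof -
  let ?M = "{x \<in> S. \<forall>y\<in>S. \<not> C x y}"
  let ?F = "\<lambda>x. {\<alpha> \<in> fillings S C. \<alpha> x = card S}"
  have c: "0 < card S" using assms by (simp add: card_gt_0_iff)
  have "fillings S C = (\<Union>x\<in>?M. ?F x)"
  proof (intro equalityI subsetI)
    fix \<alpha> assume \<alpha>: "\<alpha> \<in> fillings S C"
    have "card S \<in> \<alpha> ` S" using fillingsD(2)[OF \<alpha>] c by (auto simp: bij_betw_def)
    then obtain x where x: "x \<in> S" "\<alpha> x = card S" by auto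
    have "\<not> C x y" if "y \<in> S" for y
      using fillingsD(3)[OF \<alpha> x(1) that] fillingsD(5)[OF \<alpha> that] x by auto
    then show "\<alpha> \<in> (\<Union>x\<in>?M. ?F x)" using x \<alpha> by auto
  qed auto
  also have "card \<dots> = (\<Sum>x\<in>?M. card (?F x))"
  proof (rule card_UN_disjoint)
    show "\<forall>x\<in>?M. \<forall>y\<in>?M. x \<noteq> y \<longrightarrow> ?F x \<inter> ?F y = {}"
      by (auto simp: fillings_def bij_betw_def inj_on_def)
    show "\<forall>x\<in>?M. finite (?F x)"
      using finite_subset[OF _ finite_fillings[OF assms(1), of C]] by auto
  qed (use assms in auto)
  also have "\<dots> = (\<Sum>x\<in>?M. card (fillings (S - {x}) C))"
    by (rule sum.cong) (use bij_betw_same_card[OF bij_betw_fillings_remove[OF assms(1)]] in auto)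
  finally show ?thesis .
qed

lemma card_fillings_unique_max:
  assumes "finite S" "x \<in> S" "\<forall>y\<in>S. \<not> C x y" "\<And>y. y \<in> S \<Longrightarrow> y \<noteq> x \<Longrightarrow> \<exists>z\<in>S. C y z"
  shows "card (fillings S C) = card (fillings (S - {x}) C)"
proof -
  have "{x \<in> S. \<forall>y\<in>S. \<not> C x y} = {x}" using assms by blast
  then show ?thesis using card_fillings_remove_max[of S C] assms by auto
qed

lemma card_fillings_reverse:
  assumes "finite S"
  shows "card (fillings S C) = card (fillings S (\<lambda>x y. C y x))"
proof -
  let ?f = "\<lambda>\<alpha>. restrict (\<lambda>x. card S + 1 - \<alpha> x) S"
  have into: "?f \<alpha> \<in> fillings S (\<lambda>x y. C y x)" if \<alpha>: "\<alpha> \<in> fillings S C" for \<alpha> and C :: "'a \<Rightarrow> 'a \<Rightarrow> bool"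
  proof -
    have "bij_betw (\<lambda>k. card S + 1 - k) {1..card S} {1..card S}"
      by (rule bij_betw_byWitness[where f' = "\<lambda>k. card S + 1 - k"]) auto
    from bij_betw_trans[OF fillingsD(2)[OF \<alpha>] this]
    have "bij_betw (?f \<alpha>) S {1..card S}" by (simp add: o_def cong: bij_betw_cong)
    moreover have "card S + 1 - \<alpha> x < card S + 1 - \<alpha> y" if "x \<in> S" "y \<in> S" "C y x" for x y
      using fillingsD(3)[OF \<alpha> that(2,1,3)] fillingsD(5)[OF \<alpha> that(1)] by auto
    ultimately show ?thesis by (auto simp: fillings_def)
  qed
  have inv: "?f (?f \<alpha>) = \<alpha>" if "\<alpha> \<in> fillings S C" for \<alpha> and C :: "'a \<Rightarrow> 'a \<Rightarrow> bool"
  proof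
    show "?f (?f \<alpha>) x = \<alpha> x" for x
      using fillingsD(1)[OF that] fillingsD(5)[OF that, of x] by (cases "x \<in> S") (auto simp: extensional_def)
  qed
  have "bij_betw ?f (fillings S C) (fillings S (\<lambda>x y. C y x))"
    by (rule bij_betw_byWitness[where f' = ?f]) (use into inv in blast)+
  then show ?thesis by (rule bij_betw_same_card)
qed

lemma card_fillings_unique_min:
  assumes "finite S" "x \<in> S" "\<forall>y\<in>S. \<not> C y x" "\<And>y. y \<in> S \<Longrightarrow> y \<noteq> x \<Longrightarrow> \<exists>z\<in>S. C z y"
  shows "card (fillings S C) = card (fillings (S - {x}) C)"
proof -
  have "card (fillings S (\<lambda>x y. C y x)) = card (fillings (S - {x}) (\<lambda>x y. C y x))"
    by (rule card_fillings_unique_max) (use assms in auto)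
  then show ?thesis
    using card_fillings_reverse[of S C] card_fillings_reverse[of "S - {x}" C] assms(1) by simp
qed

lemma bij_betw_fillings_iso:
  assumes g: "bij_betw g S S'" and C: "\<And>x y. x \<in> S \<Longrightarrow> y \<in> S \<Longrightarrow> C x y \<longleftrightarrow> C' (g x) (g y)"
  shows "bij_betw (\<lambda>\<alpha>. restrict (\<alpha> \<circ> g) S) (fillings S' C') (fillings S C)"
proof (rule bij_betw_byWitness[where f' = "\<lambda>\<beta>. restrict (\<beta> \<circ> inv_into S g) S'"])
  have card: "card S' = card S" using bij_betw_same_card[OF g] by simp
  have gi: "inv_into S g (g x) = x" if "x \<in> S" for x using g that by (simp add: bij_betw_def)
  have ig: "g (inv_into S g y) = y" "inv_into S g y \<in> S" if "y \<in> S'" for y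
    using g that by (auto simp: bij_betw_def f_inv_into_f inv_into_into)
  have gS: "g x \<in> S'" if "x \<in> S" for x using g that by (auto simp: bij_betw_def)
  show "\<forall>\<alpha>\<in>fillings S' C'. restrict (restrict (\<alpha> \<circ> g) S \<circ> inv_into S g) S' = \<alpha>"
    using ig by (auto simp: fillings_def fun_eq_iff extensional_def)
  show "\<forall>\<beta>\<in>fillings S C. restrict (restrict (\<beta> \<circ> inv_into S g) S' \<circ> g) S = \<beta>"
    using gi gS by (auto simp: fillings_def fun_eq_iff extensional_def)
  show "(\<lambda>\<alpha>. restrict (\<alpha> \<circ> g) S) ` fillings S' C' \<subseteq> fillings S C"
  proof clarify
    fix \<alpha> assume \<alpha>: "\<alpha> \<in> fillings S' C'"
    show "restrict (\<alpha> \<circ> g) S \<in> fillings S C"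
      using bij_betw_trans[OF g fillingsD(2)[OF \<alpha>, unfolded card]] fillingsD(3)[OF \<alpha>] gS C
      by (auto simp: fillings_def cong: bij_betw_cong)
  qed
  show "(\<lambda>\<beta>. restrict (\<beta> \<circ> inv_into S g) S') ` fillings S C \<subseteq> fillings S' C'"
  proof clarify
    fix \<beta> assume \<beta>: "\<beta> \<in> fillings S C"
    show "restrict (\<beta> \<circ> inv_into S g) S' \<in> fillings S' C'"
      using bij_betw_trans[OF bij_betw_inv_into[OF g] fillingsD(2)[OF \<beta>, folded card]] fillingsD(3)[OF \<beta>] ig C
      by (auto simp: fillings_def cong: bij_betw_cong)
  qed
qed

lemma card_fillings_iso:
  assumes "bij_betw g S S'" "\<And>x y. x \<in> S \<Longrightarrow> y \<in> S \<Longrightarrow> C x y \<longleftrightarrow> C' (g x) (g y)"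
  shows "card (fillings S C) = card (fillings S' C')"
  by (rule bij_betw_same_card[OF bij_betw_fillings_iso, symmetric]) (use assms in auto)

text \<open>The cells of \<open>A\<close> lie above \<open>I\<close> and form a chain ordered by
  \<open>f\<close>, so their values are forced; the induction peels off the greatest one.\<close>

lemma card_fillings_top_chain:
  assumes "finite I" "finite A" "I \<inter> A = {}"
    and "\<And>x y. x \<in> I \<Longrightarrow> y \<in> A \<Longrightarrow> C x y \<and> \<not> C y x"
    and "\<And>x y. x \<in> A \<Longrightarrow> y \<in> A \<Longrightarrow> C x y \<longleftrightarrow> f x < (f y :: nat)"
    and "inj_on f A"
  shows "card (fillings (I \<union> A) C) = card (fillings I C)"
  using assms(2-)
proof (induction "card A" arbitrary: A)
  case 0
  then show ?case by simp
next
  case (Suc n)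
  have "Max (f ` A) \<in> f ` A" using Suc by (intro Max_in) auto
  then obtain x where x: "x \<in> A" "f x = Max (f ` A)" by auto
  have less: "f y < f x" if "y \<in> A" "y \<noteq> x" for y
  proof -
    have "f y \<le> f x" using that x Suc.prems(1) by auto
    moreover have "f y \<noteq> f x" using that x(1) Suc.prems(5) by (meson inj_onD)
    ultimately show ?thesis by simp
  qed
  have "card (fillings (I \<union> A) C) = card (fillings ((I \<union> A) - {x}) C)"
  proof (rule card_fillings_unique_max)
    show "finite (I \<union> A)" "x \<in> I \<union> A" using assms(1) Suc.prems x by auto
    show "\<forall>y\<in>I \<union> A. \<not> C x y"
    proof
      fix y assume "y \<in> I \<union> A"
      then show "\<not> C x y"
        using Suc.prems(3)[of y x] Suc.prems(4)[of x y] x less[of y] by (cases "y = x") auto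
    qed
    show "\<exists>z\<in>I \<union> A. C y z" if "y \<in> I \<union> A" "y \<noteq> x" for y
      using that Suc.prems(3)[of y x] Suc.prems(4)[of y x] x less[of y] by (intro bexI[of _ x]) auto
  qed
  also have "(I \<union> A) - {x} = I \<union> (A - {x})" using x Suc.prems(2) by auto
  also have "card (fillings (I \<union> (A - {x})) C) = card (fillings I C)"
    by (rule Suc.hyps(1)) (use Suc x in \<open>auto simp: inj_on_def\<close>)
  finally show ?case .
qed

text \<open>Values are initial segments, so a value is a count of cells. Later bounds on single
  entries are obtained by counting cells below them.\<close>

lemma filling_eq_card:
  assumes "\<alpha> \<in> fillings S C" "x \<in> S"
  shows "\<alpha> x = card {y \<in> S. \<alpha> y \<le> \<alpha> x}"
proof -
  have b: "inj_on \<alpha> S" "\<alpha> ` S = {1..card S}" using fillingsD(2)[OF assms(1)] by (auto simp: bij_betw_def)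
  have "\<alpha> ` {y \<in> S. \<alpha> y \<le> \<alpha> x} = {1..\<alpha> x}"
  proof (intro equalityI subsetI)
    fix k assume k: "k \<in> {1..\<alpha> x}"
    then have "k \<in> \<alpha> ` S" using b fillingsD(5)[OF assms] by auto
    then show "k \<in> \<alpha> ` {y \<in> S. \<alpha> y \<le> \<alpha> x}" using k by auto
  qed (use fillingsD(4)[OF assms(1)] in auto)
  moreover have "inj_on \<alpha> {y \<in> S. \<alpha> y \<le> \<alpha> x}" using b(1) by (rule inj_on_subset) auto
  ultimately show ?thesis using card_image by fastforce
qed

section \<open>Hook formula for a two-rowed shape with a leg\<close>

text \<open>
  The cells form the shape $(p, q, 1^l)$, in row 1 followed by a detached column, encoded as
  $(1,s),\dots,(1,N)$ and filled decreasingly. This encoding lets a column be attached to or detached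
  from the first row by changing only the order relation.
\<close>

definition near_hook_cells :: "nat \<Rightarrow> nat \<Rightarrow> nat \<Rightarrow> nat \<Rightarrow> nat \<Rightarrow> (nat \<times> nat) set" where
  "near_hook_cells p q l s N = {1} \<times> ({1..p} \<union> {s..N}) \<union> {2} \<times> {1..q} \<union> {3..l + 2} \<times> {1}"

text \<open>Covering relations only. Row 1 increases up to column \<open>p\<close>; from column
  \<open>s\<close> on it decreases, so \<open>(1, s)\<close> is the greatest cell of the column
  encoded there. The leg hangs below \<open>(2, 1)\<close>.\<close>

fun near_hook_rel :: "nat \<Rightarrow> nat \<Rightarrow> nat \<times> nat \<Rightarrow> nat \<times> nat \<Rightarrow> bool" where
  "near_hook_rel p s (a, c) (a', c') \<longleftrightarrow>
     a = 1 \<and> a' = 1 \<and> (c' = c + 1 \<and> c' \<le> p \<or> c = c' + 1 \<and> s \<le> c') \<or>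
     a = 1 \<and> a' = 2 \<and> c = c' \<or>
     a = 2 \<and> a' = 2 \<and> c' = c + 1 \<or>
     2 \<le> a \<and> a' = a + 1 \<and> c = 1 \<and> c' = 1"

text \<open>The reciprocal of the product of hook lengths of $(p, q, 1^l)$; p + l + 1 and q + l are
  the hooks of the first two cells of column 1. The formula vanishes at q = p + 1, where the shape
  is invalid.\<close>

definition hook_weight :: "nat \<Rightarrow> nat \<Rightarrow> nat \<Rightarrow> real" where
  "hook_weight p q l =
     (if q = 0 then 1 / fact p
      else (real p + 1 - real q) * real q / ((real p + real l + 1) * (real q + real l) * fact l * fact p * fact q))"

lemma hook_weight_rec_0: "0 < p \<Longrightarrow> hook_weight (p - 1) 0 0 = real p * hook_weight p 0 0"
  by (cases p) (auto simp: hook_weight_def)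

text \<open>The hook-length form of deleting a corner. The case q = 1, l = 0 stands apart since
  deleting \<open>(2, 1)\<close> leads to the branch q = 0 of \<open>hook_weight\<close>.\<close>

lemma hook_weight_rec:
  assumes "1 \<le> q" "q \<le> p"
  shows "real (p + q + l) * hook_weight p q l =
    (if q < p then hook_weight (p - 1) q l else 0) +
    (if 2 \<le> q \<or> l = 0 then hook_weight p (q - 1) l else 0) +
    (if 1 \<le> l then hook_weight p q (l - 1) else 0)"
proof (cases "q = 1 \<and> l = 0")
  case True
  have "real p / fact p = 1 / fact (p - 1)" using assms by (cases p) auto
  then show ?thesis using True assms
    by (cases "p = 1") (auto simp: hook_weight_def divide_simps of_nat_diff fact_reduce, (simp add: algebra_simps)?)
next
  case False
  obtain p' q' where p': "p = Suc p'" and q': "q = Suc q'" using assms by (cases p; cases q) auto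
  have le: "q' \<le> p'" using assms p' q' by simp
  define G :: real where "G = 1 / (fact l * fact p * fact q)"
  have pos: "real p + real l > 0" "real q + real l - 1 > 0" "real q + real l > 0" "real p + real l + 1 > 0"
    using False assms by auto
  have w: "hook_weight p q l = (real p + 1 - real q) * real q / ((real p + real l + 1) * (real q + real l)) * G"
    using assms by (simp add: hook_weight_def G_def)
  \<comment> \<open>In \<open>w1\<close>, \<open>w2\<close> and \<open>w3\<close> the tests
    disappear: the factors p - q, q - 1 and l vanish exactly when the respective corner is
    missing.\<close>
  have w1: "(if q < p then hook_weight (p - 1) q l else 0) =
      (real p - real q) * real p * real q / ((real p + real l) * (real q + real l)) * G"
  proof -
    have f: "fact p = real p * fact (p - 1)" using p' by simp
    show ?thesis using assms p' by (auto simp: hook_weight_def G_def f mult_ac add_ac)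
  qed
  have w2: "(if 2 \<le> q \<or> l = 0 then hook_weight p (q - 1) l else 0) =
      (real p + 2 - real q) * (real q - 1) * real q / ((real p + real l + 1) * (real q + real l - 1)) * G"
  proof -
    have f: "real q / fact q = 1 / fact q'" using q' by simp
    have "(real p + 2 - real q) * (real q - 1) * real q / ((real p + real l + 1) * (real q + real l - 1)) * G =
      (real p + 2 - real q) * (real q - 1) / ((real p + real l + 1) * (real q + real l - 1)) * (real q / fact q) / (fact l * fact p)"
      by (simp add: G_def)
    also have "\<dots> = (real p + 1 - real q') * real q' / ((real p + real l + 1) * (real q' + real l)) / fact q' / (fact l * fact p)"
      unfolding f by (simp add: q')
    also have "\<dots> = (if 2 \<le> q \<or> l = 0 then hook_weight p (q - 1) l else 0)"
      using False q' by (cases "q' = 0") (auto simp: hook_weight_def mult_ac)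
    finally show ?thesis by simp
  qed
  have w3: "(if 1 \<le> l then hook_weight p q (l - 1) else 0) =
      (real p + 1 - real q) * real q * real l / ((real p + real l) * (real q + real l - 1)) * G"
  proof (cases l)
    case (Suc l')
    then show ?thesis using assms by (simp add: hook_weight_def G_def of_nat_diff) 
  qed simp
  define P Q L where "P = real p" "Q = real q" "L = real l"
  have "(P + Q + L) * ((P + 1 - Q) * Q / ((P + L + 1) * (Q + L))) =
     (P - Q) * P * Q / ((P + L) * (Q + L)) + (P + 2 - Q) * (Q - 1) * Q / ((P + L + 1) * (Q + L - 1)) +
     (P + 1 - Q) * Q * L / ((P + L) * (Q + L - 1))"
  proof -
    have nz: "P + L \<noteq> 0" "Q + L - 1 \<noteq> 0" "Q + L \<noteq> 0" "P + L + 1 \<noteq> 0" using pos by (auto simp: P_Q_L_def)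
    \<comment> \<open>In these variables the denominators are a, a + 1, b and b - 1; after
      multiplying them out, their inverses are unknowns of a polynomial identity.\<close>
    define a b where "a = P + L" "b = Q + L"
    have PQ: "P = a - L" "Q = b - L" by (auto simp: a_b_def)
    have nz': "a \<noteq> 0" "b - 1 \<noteq> 0" "b \<noteq> 0" "a + 1 \<noteq> 0" using nz by (auto simp: a_b_def)
    have e: "(a + 1) * b * a * (b - 1) * X = (a + 1) * b * a * (b - 1) * Y \<Longrightarrow> X = Y" for X Y
      using nz' by simp
    have s: "P + L = a" "Q + L = b" by (auto simp: a_b_def)
    have f: "x / (y * z) = x * (inverse y * inverse z)" for x y z :: real by (simp add: divide_simps)
    have i: "a * inverse a = 1" "b * inverse b = 1" "(a + 1) * inverse (a + 1) = 1" "(b - 1) * inverse (b - 1) = 1"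
      using nz' by auto
    show ?thesis
      unfolding s by (rule e, unfold f PQ) (use i in algebra)
  qed
  then have "(P + Q + L) * ((P + 1 - Q) * Q / ((P + L + 1) * (Q + L))) * G =
     ((P - Q) * P * Q / ((P + L) * (Q + L)) + (P + 2 - Q) * (Q - 1) * Q / ((P + L + 1) * (Q + L - 1)) +
     (P + 1 - Q) * Q * L / ((P + L) * (Q + L - 1))) * G" by simp
  then show ?thesis unfolding w w1 w2 w3 P_Q_L_def by (simp only: distrib_right of_nat_add mult.assoc)
qed

lemma finite_near_hook_cells: "finite (near_hook_cells p q l s N)"
  by (simp add: near_hook_cells_def)

text \<open>The candidates for the largest entry: the end of row 1, the top of the detached column,
  the end of row 2 unless a leg hangs from it, and the foot of the leg.\<close>

lemma near_hook_maximal: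
  assumes "q \<le> p" "p < s" "s \<le> N + 1" "q = 0 \<Longrightarrow> l = 0"
  shows "{x \<in> near_hook_cells p q l s N. \<forall>y\<in>near_hook_cells p q l s N. \<not> near_hook_rel p s x y} =
    (if q < p then {(1, p)} else {}) \<union> (if s \<le> N then {(1, s)} else {}) \<union>
    (if 2 \<le> q \<or> q = 1 \<and> l = 0 then {(2, q)} else {}) \<union> (if 1 \<le> l then {(l + 2, 1)} else {})"
    (is "?L = ?R")
proof (intro equalityI subsetI)
  fix x assume x: "x \<in> ?L"
  obtain a c where [simp]: "x = (a, c)" by force
  have m: "\<not> near_hook_rel p s (a, c) y" if "y \<in> near_hook_cells p q l s N" for y using x that by auto
  from x have "a = 1 \<and> 1 \<le> c \<and> c \<le> p \<or> a = 1 \<and> s \<le> c \<and> c \<le> N \<or> a = 2 \<and> 1 \<le> c \<and> c \<le> q \<or> 3 \<le> a \<and> a \<le> l + 2 \<and> c = 1"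
    by (auto simp: near_hook_cells_def)
  then show "x \<in> ?R"
  proof (elim disjE conjE)
    assume "a = 1" "1 \<le> c" "c \<le> p"
    moreover have "c = p"
    proof (rule ccontr)
      assume "c \<noteq> p"
      then show False using m[of "(1, c + 1)"] \<open>a = 1\<close> \<open>c \<le> p\<close> by (auto simp: near_hook_cells_def)
    qed
    moreover have "\<not> c \<le> q" using m[of "(2, c)"] \<open>a = 1\<close> \<open>1 \<le> c\<close> by (auto simp: near_hook_cells_def)
    ultimately show ?thesis by auto
  next
    assume "a = 1" "s \<le> c" "c \<le> N"
    moreover have "c = s"
    proof (rule ccontr)
      assume "c \<noteq> s"
      then have "(1, c - 1) \<in> near_hook_cells p q l s N" "near_hook_rel p s (a, c) (1, c - 1)"
        using \<open>a = 1\<close> \<open>s \<le> c\<close> \<open>c \<le> N\<close> assms by (auto simp: near_hook_cells_def)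
      then show False using m by blast
    qed
    ultimately show ?thesis by auto
  next
    assume "a = 2" "1 \<le> c" "c \<le> q"
    moreover have "c = q"
    proof (rule ccontr)
      assume "c \<noteq> q"
      then show False using m[of "(2, c + 1)"] \<open>a = 2\<close> \<open>c \<le> q\<close> by (auto simp: near_hook_cells_def)
    qed
    moreover have "l = 0" if "c = 1"
      using m[of "(3, 1)"] \<open>a = 2\<close> that by (cases l) (auto simp: near_hook_cells_def)
    ultimately show ?thesis by auto
  next
    assume "3 \<le> a" "a \<le> l + 2" "c = 1"
    moreover have "\<not> a + 1 \<le> l + 2"
      using m[of "(a + 1, 1)"] \<open>3 \<le> a\<close> \<open>c = 1\<close> by (auto simp: near_hook_cells_def)
    ultimately show ?thesis by auto
  qed
next
  fix x assume "x \<in> ?R"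
  then show "x \<in> ?L" using assms by (auto simp: near_hook_cells_def split: if_splits)
qed

text \<open>The detached column is a chain, hence only divides by the factorial of its length; the
  rest is the hook formula. Induction deletes the largest entry.\<close>

lemma card_near_hook_fillings:
  assumes "q \<le> p" "p < s" "s \<le> N + 1" "q = 0 \<Longrightarrow> l = 0"
  shows "real (card (fillings (near_hook_cells p q l s N) (near_hook_rel p s))) =
    fact (p + q + l + (N + 1 - s)) * hook_weight p q l / fact (N + 1 - s)"
  using assms
proof (induction "p + q + l + (N + 1 - s)" arbitrary: p q l s)
  case 0
  then have z: "p = 0" "q = 0" "l = 0" "N + 1 - s = 0" by auto
  then have "near_hook_cells p q l s N = {}" by (auto simp: near_hook_cells_def)
  then show ?case using z by (simp only:) (simp add: card_fillings_empty hook_weight_def)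
next
  case (Suc n)
  let ?S = "near_hook_cells p q l s N" and ?C = "near_hook_rel p s"
  let ?k = "N + 1 - s"
  let ?f = "\<lambda>x. real (card (fillings (?S - {x}) ?C))"
  let ?M = "{x \<in> ?S. \<forall>y\<in>?S. \<not> ?C x y}"
  have ne: "?S \<noteq> {}"
  proof -
    have "1 \<le> p \<or> s \<le> N"
    proof (rule ccontr)
      assume "\<not> ?thesis"
      then have "p = 0" "N + 1 - s = 0" by auto
      then show False using Suc(2) Suc.prems(1,4) by simp
    qed
    then have "(1, 1) \<in> ?S \<or> (1, s) \<in> ?S" by (auto simp: near_hook_cells_def)
    then show ?thesis by auto
  qed
  have "real (card (fillings ?S ?C)) = (\<Sum>x\<in>?M. ?f x)"
    using card_fillings_remove_max[OF finite_near_hook_cells ne, of ?C] by simp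
  also have "\<dots> = (if q < p then ?f (1, p) else 0) + (if s \<le> N then ?f (1, s) else 0) +
      (if 2 \<le> q \<or> q = 1 \<and> l = 0 then ?f (2, q) else 0) + (if 1 \<le> l then ?f (l + 2, 1) else 0)"
  proof -
    have "(\<Sum>x\<in>?M. ?f x) = sum ?f ((if q < p then {(1, p)} else {}) \<union> (if s \<le> N then {(1, s)} else {}) \<union>
      (if 2 \<le> q \<or> q = 1 \<and> l = 0 then {(2, q)} else {}) \<union> (if 1 \<le> l then {(l + 2, 1)} else {}))"
      by (rule sum.cong[OF near_hook_maximal refl]) (use Suc.prems in auto)
    also have "\<dots> = (if q < p then ?f (1, p) else 0) + (if s \<le> N then ?f (1, s) else 0) +
      (if 2 \<le> q \<or> q = 1 \<and> l = 0 then ?f (2, q) else 0) + (if 1 \<le> l then ?f (l + 2, 1) else 0)"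
      using Suc.prems(2) by (simp split: if_split)
    finally show ?thesis .
  qed
  also have "(if q < p then ?f (1, p) else 0) = (if q < p then fact n * hook_weight (p - 1) q l / fact ?k else 0)"
  proof (cases "q < p")
    case True
    have "fillings (?S - {(1, p)}) ?C = fillings (near_hook_cells (p - 1) q l s N) (near_hook_rel (p - 1) s)"
      by (rule fillings_cong) (use True Suc.prems in \<open>auto simp: near_hook_cells_def\<close>)
    moreover have "n = p - 1 + q + l + (N + 1 - s)" using Suc True by simp
    ultimately show ?thesis using Suc.hyps(1)[of "p - 1" q l s] True Suc.prems by simp
  qed simp
  also have "(if s \<le> N then ?f (1, s) else 0) = (if s \<le> N then fact n * hook_weight p q l / fact (?k - 1) else 0)"
  proof (cases "s \<le> N")
    case True
    have "fillings (?S - {(1, s)}) ?C = fillings (near_hook_cells p q l (s + 1) N) (near_hook_rel p (s + 1))"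
      by (rule fillings_cong) (use True Suc.prems in \<open>auto simp: near_hook_cells_def\<close>)
    moreover have "n = p + q + l + (N + 1 - (s + 1))" using Suc True by simp
    ultimately show ?thesis using Suc.hyps(1)[of p q l "s + 1"] True Suc.prems by simp
  qed simp
  also have "(if 2 \<le> q \<or> q = 1 \<and> l = 0 then ?f (2, q) else 0) =
     (if 2 \<le> q \<or> q = 1 \<and> l = 0 then fact n * hook_weight p (q - 1) l / fact ?k else 0)"
  proof (cases "2 \<le> q \<or> q = 1 \<and> l = 0")
    case True
    have "fillings (?S - {(2, q)}) ?C = fillings (near_hook_cells p (q - 1) l s N) (near_hook_rel p s)"
      by (rule fillings_cong) (use True Suc.prems in \<open>auto simp: near_hook_cells_def\<close>)
    moreover have "n = p + (q - 1) + l + (N + 1 - s)" using Suc True by auto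
    ultimately show ?thesis using Suc.hyps(1)[of p "q - 1" l s] True Suc.prems by auto
  next
    case False
    then show ?thesis by (simp only: if_False)
  qed
  also have "(if 1 \<le> l then ?f (l + 2, 1) else 0) = (if 1 \<le> l then fact n * hook_weight p q (l - 1) / fact ?k else 0)"
  proof (cases "1 \<le> l")
    case True
    have "fillings (?S - {(l + 2, 1)}) ?C = fillings (near_hook_cells p q (l - 1) s N) (near_hook_rel p s)"
      by (rule fillings_cong) (use True Suc.prems in \<open>auto simp: near_hook_cells_def\<close>)
    moreover have "n = p + q + (l - 1) + (N + 1 - s)" using Suc True by auto
    ultimately show ?thesis using Suc.hyps(1)[of p q "l - 1" s] True Suc.prems by auto
  qed simp
  finally have eq: "real (card (fillings ?S ?C)) =
     fact n / fact ?k * ((if q < p then hook_weight (p - 1) q l else 0) +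
      (if 2 \<le> q \<or> q = 1 \<and> l = 0 then hook_weight p (q - 1) l else 0) +
      (if 1 \<le> l then hook_weight p q (l - 1) else 0)) +
     (if s \<le> N then fact n * hook_weight p q l / fact (?k - 1) else 0)"
    by (simp add: algebra_simps)
  \<comment> \<open>Deletions in the shape yield p + q + l times the common term, deletions from the
    detached column its length times that term; together this is the total number of cells.\<close>
  have r1: "(if q < p then hook_weight (p - 1) q l else 0) +
      (if 2 \<le> q \<or> q = 1 \<and> l = 0 then hook_weight p (q - 1) l else 0) +
      (if 1 \<le> l then hook_weight p q (l - 1) else 0) = real (p + q + l) * hook_weight p q l"
  proof (cases "q = 0")
    case True
    then show ?thesis using Suc.prems hook_weight_rec_0[of p] by (cases "p = 0") auto
  next
    case False
    then have "(2 \<le> q \<or> q = 1 \<and> l = 0) = (2 \<le> q \<or> l = 0)" by auto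
    then show ?thesis using hook_weight_rec[of q p l] False Suc.prems by simp
  qed
  have r2: "(if s \<le> N then fact n * hook_weight p q l / fact (?k - 1) else 0) = real ?k * (fact n / fact ?k * hook_weight p q l)"
  proof (cases "s \<le> N")
    case True
    then have "fact ?k = real ?k * fact (?k - 1)" by (simp add: fact_reduce)
    then show ?thesis using True by simp
  qed simp
  have "real (card (fillings ?S ?C)) = (real (p + q + l) + real ?k) * fact n / fact ?k * hook_weight p q l"
    unfolding eq r1 r2 by (simp add: algebra_simps add_divide_distrib)
  also have "real (p + q + l) + real ?k = real (Suc n)" using Suc(2) by simp
  also have "real (Suc n) * fact n = fact (Suc n)" by simp
  finally show ?case using Suc(2) by simp
qed

section \<open>Skew tableaux\<close>

text \<open>
  With \<open>near_hook_rel p p\<close> the first row increases up to position \<open>p\<close> and decreases afterwards; with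
  \<open>near_hook_rel p (p + 1)\<close> positions \<open>p\<close> and \<open>p + 1\<close> are not compared. Splitting by their order yields
  the number of peak fillings as an alternating sum of products of hook formulas.
\<close>

definition peak_cells :: "nat \<Rightarrow> nat \<Rightarrow> nat \<Rightarrow> (nat \<times> nat) set" where
  "peak_cells q l N = {1} \<times> {1..N} \<union> {2} \<times> {1..q} \<union> {3..l + 2} \<times> {1}"

lemma finite_peak_cells: "finite (peak_cells q l N)"
  by (simp add: peak_cells_def)

lemma card_peak_cells: "card (peak_cells q l N) = N + q + l"
proof -
  have "card ({1} \<times> {1..N} \<union> {2} \<times> {1..q} \<union> {3..l + 2} \<times> {1::nat}) =
    card ({1::nat} \<times> {1..N} \<union> {2} \<times> {1..q}) + card ({3..l + 2} \<times> {1::nat})"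
    by (rule card_Un_disjoint) auto
  also have "card ({1::nat} \<times> {1..N} \<union> {2} \<times> {1..q}) = card ({1::nat} \<times> {1..N}) + card ({2::nat} \<times> {1..q})"
    by (rule card_Un_disjoint) auto
  finally show ?thesis by (simp add: peak_cells_def card_cartesian_product)
qed

lemma card_peak_fillings_free:
  assumes "q \<le> p" "p \<le> N" "1 \<le> q"
  shows "real (card (fillings (peak_cells q l N) (near_hook_rel p (p + 1)))) =
    fact (N + q + l) * hook_weight p q l / fact (N - p)"
proof -
  have "peak_cells q l N = near_hook_cells p q l (p + 1) N"
    using assms by (auto simp: peak_cells_def near_hook_cells_def)
  moreover have "p + q + l + (N + 1 - (p + 1)) = N + q + l" using assms by simp
  ultimately show ?thesis using card_near_hook_fillings[of q p "p + 1" N l] assms by (simp add: add_ac)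
qed

lemma card_peak_fillings_split:
  assumes "1 \<le> p" "p < N"
  shows "card (fillings (peak_cells q l N) (near_hook_rel p (p + 1))) =
    card (fillings (peak_cells q l N) (near_hook_rel p p)) +
    card (fillings (peak_cells q l N) (near_hook_rel (p + 1) (p + 1)))"
proof -
  let ?S = "peak_cells q l N"
  have "fillings ?S (\<lambda>a b. near_hook_rel p (p + 1) a b \<or> a = (1, p + 1) \<and> b = (1, p)) = fillings ?S (near_hook_rel p p)"
    by (rule fillings_cong) (use assms in \<open>auto simp: peak_cells_def\<close>)
  moreover have "fillings ?S (\<lambda>a b. near_hook_rel p (p + 1) a b \<or> a = (1, p) \<and> b = (1, p + 1)) =
     fillings ?S (near_hook_rel (p + 1) (p + 1))"
    by (rule fillings_cong) (use assms in \<open>auto simp: peak_cells_def\<close>)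
  moreover have "(1, p + 1) \<in> ?S" "(1, p) \<in> ?S" using assms by (auto simp: peak_cells_def)
  ultimately show ?thesis
    using card_fillings_split[of ?S "(1, p + 1)" "(1, p)" "near_hook_rel p (p + 1)"] finite_peak_cells by simp
qed

lemma card_peak_fillings:
  assumes "q \<le> p" "p \<le> N" "1 \<le> q"
  shows "real (card (fillings (peak_cells q l N) (near_hook_rel p p))) =
    (\<Sum>s\<le>N - p. (- 1) ^ s * (fact (N + q + l) * hook_weight (p + s) q l / fact (N - (p + s))))"
  using assms
proof (induction "N - p" arbitrary: p)
  case 0
  then have "p = N" by simp
  \<comment> \<open>At \<open>p = N\<close> nothing is left to descend, so attaching or detaching
    the column makes no difference.\<close>
  have "fillings (peak_cells q l N) (near_hook_rel N N) = fillings (peak_cells q l N) (near_hook_rel N (N + 1))"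
    by (rule fillings_cong) (auto simp: peak_cells_def)
  then show ?case using card_peak_fillings_free[of q N N l] 0 \<open>p = N\<close> by simp
next
  case (Suc k)
  let ?t = "\<lambda>p s. (- 1) ^ s * (fact (N + q + l) * hook_weight (p + s) q l / fact (N - (p + s))) :: real"
  have k: "N - p = Suc k" "N - (p + 1) = k" using Suc(2) by auto
  have IH: "real (card (fillings (peak_cells q l N) (near_hook_rel (p + 1) (p + 1)))) = (\<Sum>s\<le>k. ?t (p + 1) s)"
    using Suc.hyps(1)[of "p + 1"] Suc.prems k by simp
  have "(\<Sum>s\<le>N - p. ?t p s) = ?t p 0 + (\<Sum>s\<le>k. ?t p (Suc s))"
    unfolding k by (rule sum.atMost_Suc_shift)
  also have "(\<Sum>s\<le>k. ?t p (Suc s)) = - (\<Sum>s\<le>k. ?t (p + 1) s)"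
    by (simp add: sum_negf[symmetric])
  also have "?t p 0 = real (card (fillings (peak_cells q l N) (near_hook_rel p (p + 1))))"
    using card_peak_fillings_free Suc.prems by simp
  also have "\<dots> = real (card (fillings (peak_cells q l N) (near_hook_rel p p))) + (\<Sum>s\<le>k. ?t (p + 1) s)"
    using card_peak_fillings_split[of p N q l] Suc.prems k IH by simp
  finally show ?case by simp
qed

fun adjacent_cells :: "nat \<times> nat \<Rightarrow> nat \<times> nat \<Rightarrow> bool" where
  "adjacent_cells (r, c) (r', c') \<longleftrightarrow> r = r' \<and> c' = c + 1 \<or> c = c' \<and> r' = r + 1"

text \<open>Rows b - 1 and b of the skew shape are rows 1 and 2 of the peak shape. The right-most
  column above row b - 1 is folded out to the right of row 1: moving right means climbing it, whence
  the decreasing part.\<close>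

definition skew_cell :: "nat \<Rightarrow> nat \<Rightarrow> nat \<times> nat \<Rightarrow> nat \<times> nat" where
  "skew_cell i b = (\<lambda>(r, c).
     if r = 1 then (if c \<le> i + 1 then (b - 1, c) else (b - 1 - (c - (i + 1)), i + 1)) else (b - 2 + r, c))"

lemma peak_cells_cases:
  assumes "x \<in> peak_cells (i + 1) l (i + 1 + k)"
  obtains (upper) c where "x = (1, c)" "1 \<le> c" "c \<le> i + 1"
    | (arm) j where "x = (1, i + 1 + j)" "1 \<le> j" "j \<le> k"
    | (lower) c where "x = (2, c)" "1 \<le> c" "c \<le> i + 1"
    | (leg) j where "x = (2 + j, 1)" "1 \<le> j" "j \<le> l"
proof -
  obtain r c where x: "x = (r, c)" by force
  have "r = 1 \<and> 1 \<le> c \<and> c \<le> i + 1 \<or> r = 1 \<and> i + 1 < c \<and> c \<le> i + 1 + k \<or> r = 2 \<and> 1 \<le> c \<and> c \<le> i + 1 \<or>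
     3 \<le> r \<and> r \<le> l + 2 \<and> c = 1"
    using assms by (auto simp: peak_cells_def x)
  then show ?thesis
    using upper[of c] arm[of "c - (i + 1)"] lower[of c] leg[of "r - 2"] x by fastforce
qed

lemma skew_cell_simps:
  "c \<le> i + 1 \<Longrightarrow> skew_cell i (k + 2) (1, c) = (k + 1, c)"
  "1 \<le> j \<Longrightarrow> skew_cell i (k + 2) (1, i + 1 + j) = (k + 1 - j, i + 1)"
  "skew_cell i (k + 2) (2, c) = (k + 2, c)"
  "1 \<le> j \<Longrightarrow> skew_cell i (k + 2) (2 + j, c) = (k + 2 + j, c)"
  by (auto simp: skew_cell_def)

lemma near_hook_rel_iff_adjacent:
  assumes "1 \<le> i" and x: "x \<in> peak_cells (i + 1) l (i + 1 + k)" and y: "y \<in> peak_cells (i + 1) l (i + 1 + k)"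
  shows "near_hook_rel (i + 1) (i + 1) x y \<longleftrightarrow> adjacent_cells (skew_cell i (k + 2) x) (skew_cell i (k + 2) y)"
  using x y assms(1)
  by (elim peak_cells_cases; simp only: skew_cell_simps; auto)

lemma bij_betw_skew_cell:
  assumes "1 \<le> i"
  shows "bij_betw (skew_cell i (k + 2)) (peak_cells (i + 1) l (i + 1 + k)) (skew_cells (l + 2) i (k + 2))"
proof (rule bij_betw_imageI)
  show "inj_on (skew_cell i (k + 2)) (peak_cells (i + 1) l (i + 1 + k))"
  proof (rule inj_onI)
    fix x y assume "x \<in> peak_cells (i + 1) l (i + 1 + k)" "y \<in> peak_cells (i + 1) l (i + 1 + k)"
      "skew_cell i (k + 2) x = skew_cell i (k + 2) y"
    then show "x = y"
      using assms by (elim peak_cells_cases; simp only: skew_cell_simps; auto)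
  qed
  have "skew_cell i (k + 2) x \<in> skew_cells (l + 2) i (k + 2)" if "x \<in> peak_cells (i + 1) l (i + 1 + k)" for x
    using that by (elim peak_cells_cases; simp only: skew_cell_simps; auto simp: skew_cells_def)
  moreover have "(r, c) \<in> skew_cell i (k + 2) ` peak_cells (i + 1) l (i + 1 + k)"
    if rc: "(r, c) \<in> skew_cells (l + 2) i (k + 2)" for r c
  proof -
    have mem: "(1, d) \<in> peak_cells (i + 1) l (i + 1 + k) \<longleftrightarrow> 1 \<le> d \<and> d \<le> i + 1 + k"
      "(2, d) \<in> peak_cells (i + 1) l (i + 1 + k) \<longleftrightarrow> 1 \<le> d \<and> d \<le> i + 1"
      "(2 + j, 1) \<in> peak_cells (i + 1) l (i + 1 + k) \<longleftrightarrow> j \<le> l" for d j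
      by (auto simp: peak_cells_def)
    consider "1 \<le> r" "r \<le> k" "c = i + 1" | "r = k + 1" "1 \<le> c" "c \<le> i + 1" | "r = k + 2" "1 \<le> c" "c \<le> i + 1"
      | "k + 3 \<le> r" "r \<le> k + 2 + l" "c = 1"
      using rc by (fastforce simp: skew_cells_def)
    then show ?thesis
    proof cases
      case 1
      have "skew_cell i (k + 2) (1, i + 1 + (k + 1 - r)) = (r, c)"
        by (subst skew_cell_simps) (use 1 in auto)
      moreover have "(1, i + 1 + (k + 1 - r)) \<in> peak_cells (i + 1) l (i + 1 + k)" unfolding mem using 1 by auto
      ultimately show ?thesis by (metis imageI)
    next
      case 2
      then show ?thesis using skew_cell_simps(1)[of c i k] mem(1)[of c] by (metis imageI le_add1 order_trans)
    next
      case 3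
      then show ?thesis using skew_cell_simps(3)[of i k c] mem(2)[of c] by (metis imageI)
    next
      case 4
      have "skew_cell i (k + 2) (2 + (r - (k + 2)), 1) = (r, c)"
        by (subst skew_cell_simps) (use 4 in auto)
      moreover have "(2 + (r - (k + 2)), 1) \<in> peak_cells (i + 1) l (i + 1 + k)" unfolding mem using 4 by auto
      ultimately show ?thesis by (metis imageI)
    qed
  qed
  ultimately show "skew_cell i (k + 2) ` peak_cells (i + 1) l (i + 1 + k) = skew_cells (l + 2) i (k + 2)" by auto
qed

lemma card_skew_cells:
  assumes "1 \<le> i"
  shows "card (skew_cells (l + 2) i (k + 2)) = (l + 2) + 2 * i + (k + 2) - 2"
  using bij_betw_same_card[OF bij_betw_skew_cell[OF assms, where k = k and l = l]] by (simp add: card_peak_cells)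

text \<open>Rows and columns of the skew shape have no gaps, so increasing along adjacent cells
  implies increasing along whole rows and columns.\<close>

lemma SkYT_eq_fillings:
  assumes "1 \<le> i"
  shows "SkYT (l + 2) i (k + 2) = fillings (skew_cells (l + 2) i (k + 2)) adjacent_cells"
proof -
  let ?S = "skew_cells (l + 2) i (k + 2)"
  have row: "\<alpha> (r, c) < \<alpha> (r, c')"
    if \<alpha>: "\<alpha> \<in> fillings ?S adjacent_cells" and "(r, c) \<in> ?S" "(r, c') \<in> ?S" "c < c'" for \<alpha> r c c'
    using that(3,4)
  proof (induction c')
    case (Suc c')
    show ?case
    proof (cases "c = c'")
      case True
      then show ?thesis using fillingsD(3)[OF \<alpha>] that(2) Suc.prems by auto
    next
      case False
      then have "(r, c') \<in> ?S" using that(2) Suc.prems by (auto simp: skew_cells_def)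
      then show ?thesis using Suc False fillingsD(3)[OF \<alpha>, of "(r, c')" "(r, Suc c')"] by auto
    qed
  qed simp
  have col: "\<alpha> (r, c) < \<alpha> (r', c)"
    if \<alpha>: "\<alpha> \<in> fillings ?S adjacent_cells" and "(r, c) \<in> ?S" "(r', c) \<in> ?S" "r < r'" for \<alpha> r r' c
    using that(3,4)
  proof (induction r')
    case (Suc r')
    show ?case
    proof (cases "r = r'")
      case True
      then show ?thesis using fillingsD(3)[OF \<alpha>] that(2) Suc.prems by auto
    next
      case False
      then have "(r', c) \<in> ?S" using that(2) Suc.prems assms by (auto simp: skew_cells_def)
      then show ?thesis using Suc False fillingsD(3)[OF \<alpha>, of "(r', c)" "(Suc r', c)"] by auto
    qed
  qed simp
  show ?thesis
  proof (intro equalityI subsetI)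
    fix \<alpha> assume "\<alpha> \<in> SkYT (l + 2) i (k + 2)"
    then show "\<alpha> \<in> fillings ?S adjacent_cells"
      unfolding SkYT_def fillings_def card_skew_cells[OF assms] by (auto split: if_splits)
  next
    fix \<alpha> assume \<alpha>: "\<alpha> \<in> fillings ?S adjacent_cells"
    have "\<not> (l + 2 < 2 \<or> k + 2 < 2)" by simp
    then show "\<alpha> \<in> SkYT (l + 2) i (k + 2)"
      using fillingsD(1,2)[OF \<alpha>] row[OF \<alpha>] col[OF \<alpha>]
      unfolding SkYT_def card_skew_cells[OF assms] by (simp only: if_False mem_Collect_eq) blast
  qed
qed

abbreviation peak_fillings :: "nat \<Rightarrow> nat \<Rightarrow> nat \<Rightarrow> (nat \<times> nat \<Rightarrow> nat) set" where
  "peak_fillings i l N \<equiv> fillings (peak_cells (i + 1) l N) (near_hook_rel (i + 1) (i + 1))"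

lemma bij_betw_SkYT:
  assumes "1 \<le> i"
  shows "bij_betw (\<lambda>\<alpha>. restrict (\<alpha> \<circ> skew_cell i (k + 2)) (peak_cells (i + 1) l (i + 1 + k)))
    (SkYT (l + 2) i (k + 2)) (peak_fillings i l (i + 1 + k))"
  unfolding SkYT_eq_fillings[OF assms]
  by (rule bij_betw_fillings_iso[OF bij_betw_skew_cell[OF assms]]) (rule near_hook_rel_iff_adjacent[OF assms])

section \<open>Tableaux outside the removed family\<close>

lemma card_filling_le:
  assumes "\<alpha> \<in> fillings S C" "d \<le> card S"
  shows "card {y \<in> S. \<alpha> y \<le> d} = d"
proof -
  have b: "inj_on \<alpha> S" "\<alpha> ` S = {1..card S}" using fillingsD(2)[OF assms(1)] by (auto simp: bij_betw_def)
  have "\<alpha> ` {y \<in> S. \<alpha> y \<le> d} = {1..d}"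
  proof (intro equalityI subsetI)
    fix k assume k: "k \<in> {1..d}"
    then have "k \<in> \<alpha> ` S" using b assms by auto
    then show "k \<in> \<alpha> ` {y \<in> S. \<alpha> y \<le> d}" using k by auto
  qed (use fillingsD(4)[OF assms(1)] in auto)
  moreover have "inj_on \<alpha> {y \<in> S. \<alpha> y \<le> d}" using b(1) by (rule inj_on_subset) auto
  ultimately show ?thesis using card_image by fastforce
qed

text \<open>Step back along the row, the column or the folded arm. Hence the entry 1 can only be on
  \<open>(1, 1)\<close> or \<open>(1, N)\<close>, the tops of the left-most and the right-most
  column.\<close>

lemma peak_cell_predecessor:
  assumes "x \<in> peak_cells (i + 1) l N" "x \<noteq> (1, 1)" "x \<noteq> (1, N)" "i + 1 \<le> N"
  shows "\<exists>y\<in>peak_cells (i + 1) l N. near_hook_rel (i + 1) (i + 1) y x"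
proof -
  obtain r c where [simp]: "x = (r, c)" by force
  consider "r = 1" "1 < c" "c \<le> i + 1" | "r = 1" "i + 1 < c" "c < N" | "r = 2" "1 \<le> c" "c \<le> i + 1" | "3 \<le> r" "r \<le> l + 2" "c = 1"
    using assms(1-3) by (fastforce simp: peak_cells_def)
  then show ?thesis
  proof cases
    case 1
    then show ?thesis using assms by (intro bexI[of _ "(1, c - 1)"]) (auto simp: peak_cells_def)
  next
    case 2
    then show ?thesis using assms by (intro bexI[of _ "(1, c + 1)"]) (auto simp: peak_cells_def)
  next
    case 3
    then show ?thesis using assms by (intro bexI[of _ "(1, c)"]) (auto simp: peak_cells_def)
  next
    case 4
    then show ?thesis using assms by (intro bexI[of _ "(r - 1, c)"]) (auto simp: peak_cells_def)
  qed
qed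

text \<open>The left-most column has height l + 2 = m + 1 and the right-most one k + 2 = d - 2i + 1,
  which determines \<open>d\<close>. \<open>corner\<close> is the bottom of the right-most column,
  \<open>leg\<close> the left-most column without its top two cells, and \<open>inner\<close> the
  other \<open>d\<close> cells.\<close>

locale peak_shape =
  fixes i l k :: nat
  assumes i: "1 \<le> i"
begin

definition "N = i + 1 + k"
definition "d = 2 * i + 1 + k"
definition "cells = peak_cells (i + 1) l N"
definition "inner = {1::nat} \<times> {1..N} \<union> {2} \<times> {1..i}"
definition "leg = {3..l + 2} \<times> {1::nat}"
definition "corner = (2::nat, i + 1)"

abbreviation "rel \<equiv> near_hook_rel (i + 1) (i + 1)"

lemma cells_eq: "cells = inner \<union> insert corner leg"
  by (auto simp: cells_def peak_cells_def inner_def leg_def corner_def)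

lemma finite_parts: "finite cells" "finite inner" "finite leg"
  by (simp_all add: cells_def finite_peak_cells inner_def leg_def)

lemma card_inner: "card inner = d"
proof -
  have "card ({1::nat} \<times> {1..N} \<union> {2} \<times> {1..i}) = card ({1::nat} \<times> {1..N}) + card ({2::nat} \<times> {1..i})"
    by (rule card_Un_disjoint) auto
  then show ?thesis by (simp add: inner_def N_def d_def card_cartesian_product)
qed

lemma card_cells: "card cells = d + l + 1"
  by (simp add: cells_def card_peak_cells N_def d_def)

lemma inner_disjoint: "inner \<inter> insert corner leg = {}" "corner \<notin> leg"
  by (auto simp: inner_def leg_def corner_def)

text \<open>Each inner cell has a successor that is inner or the corner, so the maximum over these
  cells is attained at the corner.\<close>

lemma inner_below_corner:
  assumes \<beta>: "\<beta> \<in> fillings cells rel" and y: "y \<in> inner"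
  shows "\<beta> y < \<beta> corner"
proof -
  let ?I = "insert corner inner"
  have fin: "finite ?I" using finite_parts by simp
  have "Max (\<beta> ` ?I) \<in> \<beta> ` ?I" using fin by (intro Max_in) auto
  then obtain z where z: "z \<in> ?I" "\<beta> z = Max (\<beta> ` ?I)"
    by (metis (no_types, lifting) imageE)
  have max: "\<beta> x \<le> \<beta> z" if "x \<in> ?I" for x
  proof -
    have "\<beta> x \<le> Max (\<beta> ` ?I)" using fin that by (intro Max_ge) auto
    then show ?thesis using z by simp
  qed
  have sub: "?I \<subseteq> cells" using cells_eq by auto
  have "z = corner"
  proof (rule ccontr)
    assume "z \<noteq> corner"
    then have "z \<in> inner" using z by auto
    then obtain w where "w \<in> ?I" "rel z w"
    proof -
      obtain r c where rc: "z = (r, c)" by force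
      consider "r = 1" "1 \<le> c" "c \<le> i + 1" | "r = 1" "i + 1 < c" "c \<le> N" | "r = 2" "1 \<le> c" "c \<le> i"
        using \<open>z \<in> inner\<close> rc by (fastforce simp: inner_def)
      then show ?thesis
      proof cases
        case 1
        then show ?thesis using that[of "(2, c)"] rc by (cases "c = i + 1") (auto simp: inner_def corner_def)
      next
        case 2
        then have "rel z (1, c - 1)" "(1, c - 1) \<in> ?I" using rc by (auto simp: inner_def)
        then show ?thesis using that by blast
      next
        case 3
        then show ?thesis using that[of "(2, c + 1)"] rc by (cases "c = i") (auto simp: inner_def corner_def)
      qed
    qed
    then show False using fillingsD(3)[OF \<beta>, of z w] max[of w] z(1) sub by auto
  qed
  moreover have "y \<noteq> corner" using y inner_disjoint by auto
  moreover have "inj_on \<beta> cells" using fillingsD(2)[OF \<beta>] by (simp add: bij_betw_def)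
  ultimately have "\<beta> y \<noteq> \<beta> corner" using y sub by (meson inj_onD insertCI subsetD)
  then show ?thesis using max[of y] y \<open>z = corner\<close> by auto
qed

lemma leg_increasing:
  assumes \<beta>: "\<beta> \<in> fillings cells rel" and "3 \<le> r" "r < r'" "r' \<le> l + 2"
  shows "\<beta> (r, 1) < \<beta> (r', 1)"
  using assms(3,4)
proof (induction r')
  case (Suc r')
  have "\<beta> (r', 1) < \<beta> (Suc r', 1)"
    using Suc.prems assms(2) by (intro fillingsD(3)[OF \<beta>]) (auto simp: cells_def peak_cells_def)
  then show ?case using Suc by (cases "r = r'") auto
qed simp

lemma corner_gt: "\<beta> \<in> fillings cells rel \<Longrightarrow> d < \<beta> corner"
proof -
  assume \<beta>: "\<beta> \<in> fillings cells rel"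
  have "insert corner inner \<subseteq> {y \<in> cells. \<beta> y \<le> \<beta> corner}"
    using inner_below_corner[OF \<beta>] cells_eq by (auto simp: less_imp_le)
  then have "card (insert corner inner) \<le> card {y \<in> cells. \<beta> y \<le> \<beta> corner}"
    using finite_parts by (intro card_mono) auto
  then have "card (insert corner inner) \<le> \<beta> corner"
    using filling_eq_card[OF \<beta>, of corner] cells_eq by simp
  then show ?thesis using card_inner finite_parts inner_disjoint by auto
qed

text \<open>
  In a filling in \<open>outside v\<close> the \<open>l + 1\<close> largest values lie on the leg and the corner, ordered
  as by \<open>height v\<close>.
\<close>

fun height :: "nat \<Rightarrow> nat \<times> nat \<Rightarrow> nat" where
  "height v (r, c) = (if r = 2 then 2 * v + 3 else 2 * r)"

text \<open>All comparisons that membership in \<open>outside v\<close> entails, so that this set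
  becomes the set of fillings of a larger relation. The corner has odd height 2v + 3, between the
  leg cells in rows v + 1 and v + 2.\<close>

definition forced :: "nat \<Rightarrow> nat \<times> nat \<Rightarrow> nat \<times> nat \<Rightarrow> bool" where
  "forced v x y \<longleftrightarrow> rel x y \<or> x = (1, 1) \<and> y \<noteq> (1, 1) \<or> x \<in> inner \<and> y \<notin> inner \<or>
     x \<notin> inner \<and> y \<notin> inner \<and> height v x < height v y"

text \<open>The negations of the three conditions defining $SkYT_\<rho>$, with the corner entry
  fixed: \<open>(1, N)\<close> is the top of the right-most column and \<open>(3, 1)\<close> the
  third cell of the left-most one.\<close>

definition "outside v = {\<beta> \<in> fillings cells rel. \<beta> (1, N) \<noteq> 1 \<and> \<beta> corner = d + v \<and> (1 \<le> l \<longrightarrow> d < \<beta> (3, 1))}"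

lemma outside_subset:
  assumes v: "1 \<le> v" and \<beta>: "\<beta> \<in> outside v"
  shows "\<beta> \<in> fillings cells (forced v)"
proof -
  have f: "\<beta> \<in> fillings cells rel" and b1: "\<beta> (1, N) \<noteq> 1" and bc: "\<beta> corner = d + v" and b3: "1 \<le> l \<Longrightarrow> d < \<beta> (3, 1)"
    using \<beta> by (auto simp: outside_def)
  have inj: "inj_on \<beta> cells" using fillingsD(2)[OF f] by (simp add: bij_betw_def)
  have leg_gt: "d < \<beta> x" if x: "x \<in> leg" for x
  proof -
    obtain r where r: "x = (r, 1)" "3 \<le> r" "r \<le> l + 2" using x by (auto simp: leg_def)
    then show ?thesis using b3 leg_increasing[OF f, of 3 r] by (cases "r = 3") auto
  qed
  have upper_gt: "d < \<beta> x" if "x \<in> cells - inner" for x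
    using that cells_eq leg_gt[of x] bc v by auto
  \<comment> \<open>Exactly \<open>d\<close> cells carry values up to \<open>d\<close>, none of them
    lies outside \<open>inner\<close>, and \<open>inner\<close> has \<open>d\<close> cells.\<close>
  have "{y \<in> cells. \<beta> y \<le> d} = inner"
  proof (rule card_subset_eq[OF finite_parts(2)])
    show "{y \<in> cells. \<beta> y \<le> d} \<subseteq> inner" using upper_gt by force
    show "card {y \<in> cells. \<beta> y \<le> d} = card inner"
      using card_filling_le[OF f, of d] card_cells card_inner by simp
  qed
  then have inner_le: "\<beta> x \<le> d" if "x \<in> inner" for x using that by blast
  \<comment> \<open>The entry 1 is on a cell without predecessor, and \<open>(1, N)\<close> is
    excluded.\<close>
  have b11: "\<beta> (1, 1) = 1"
  proof -
    have "1 \<in> \<beta> ` cells" using fillingsD(2)[OF f] card_cells by (auto simp: bij_betw_def)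
    then obtain x where x: "x \<in> cells" "\<beta> x = 1" by auto
    have "x = (1, 1)"
    proof (rule ccontr)
      assume "x \<noteq> (1, 1)"
      then obtain y where "y \<in> cells" "rel y x"
      proof -
        have "x \<noteq> (1, N)" using x b1 by auto
        then have "\<exists>y\<in>cells. rel y x"
          using peak_cell_predecessor[of x i l N] x \<open>x \<noteq> (1, 1)\<close> by (simp add: cells_def N_def)
        then show ?thesis using that by blast
      qed
      then show False using fillingsD(3)[OF f, of y x] fillingsD(4)[OF f, of y] x by auto
    qed
    then show ?thesis using x by simp
  qed
  have 11: "(1, 1) \<in> cells" by (auto simp: cells_def peak_cells_def N_def)
  have "\<beta> x < \<beta> y" if x: "x \<in> cells" and y: "y \<in> cells" and "forced v x y" for x y
  proof -
    from that(3) consider "rel x y" | "x = (1, 1)" "y \<noteq> (1, 1)" | "x \<in> inner" "y \<notin> inner"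
      | "x \<notin> inner" "y \<notin> inner" "height v x < height v y" by (auto simp: forced_def)
    then show ?thesis
    proof cases
      case 1
      then show ?thesis using fillingsD(3)[OF f x y] by simp
    next
      case 2
      then have "\<beta> y \<noteq> 1" using inj b11 y 11 by (metis inj_onD)
      then show ?thesis using fillingsD(4)[OF f y] 2 b11 by simp
    next
      case 3
      then show ?thesis using inner_le[of x] upper_gt[of y] y by auto
    next
      case 4
      have xy: "x \<in> insert corner leg" "y \<in> insert corner leg" using 4 x y cells_eq by auto
      then consider r r' where "x = (r, 1)" "y = (r', 1)" "x \<in> leg" "y \<in> leg" | r where "x = corner" "y = (r, 1)" "y \<in> leg"
        | r where "x = (r, 1)" "y = corner" "x \<in> leg" | "x = corner" "y = corner"
        by (auto simp: leg_def)
      then show ?thesis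
      proof cases
        case 1
        then show ?thesis using 4 leg_increasing[OF f, of r r'] by (auto simp: leg_def)
      next
        case 2
        then have r: "3 \<le> r" "r \<le> l + 2" "v + 2 \<le> r" using 4 by (auto simp: leg_def corner_def)
        \<comment> \<open>Below or at the leg cell in row r there are d + r - 2 cells, which is at
          least d + v because r is at least v + 2.\<close>
        have "inner \<union> {3..r} \<times> {1} \<subseteq> {z \<in> cells. \<beta> z \<le> \<beta> y}"
        proof
          fix z assume "z \<in> inner \<union> {3..r} \<times> {1}"
          then consider "z \<in> inner" | r' where "z = (r', 1)" "3 \<le> r'" "r' \<le> r" by auto
          then show "z \<in> {z \<in> cells. \<beta> z \<le> \<beta> y}"
          proof cases
            case 1
            then show ?thesis using inner_le[of z] upper_gt[of y] 4 y cells_eq by auto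
          next
            case 2
            then have "\<beta> z \<le> \<beta> y" using leg_increasing[OF f, of r' r] r \<open>y = (r, 1)\<close> by (cases "r' = r") auto
            then show ?thesis using 2 r by (auto simp: cells_def peak_cells_def)
          qed
        qed
        then have "card (inner \<union> {3..r} \<times> {1}) \<le> card {z \<in> cells. \<beta> z \<le> \<beta> y}"
          using finite_parts by (intro card_mono) auto
        then have "card (inner \<union> {3..r} \<times> {1}) \<le> \<beta> y"
          using filling_eq_card[OF f y] by simp
        moreover have "card (inner \<union> {3..r} \<times> {1}) = d + (r - 2)"
        proof (subst card_Un_disjoint)
          show "inner \<inter> {3..r} \<times> {1} = {}" by (auto simp: inner_def)
        qed (use finite_parts r in \<open>auto simp: card_inner card_cartesian_product\<close>)
        ultimately have "\<beta> x \<le> \<beta> y" using 2 bc r by auto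
        moreover have "\<beta> x \<noteq> \<beta> y" using inj x y 4 by (metis inj_onD less_irrefl)
        ultimately show ?thesis by simp
      next
        case 3
        then have r: "3 \<le> r" "r \<le> l + 2" "r \<le> v + 1" using 4 by (auto simp: leg_def corner_def)
        show ?thesis
        proof (rule ccontr)
          assume "\<not> \<beta> x < \<beta> y"
          then have ge: "\<beta> corner \<le> \<beta> (r, 1)" using 3 by auto
          \<comment> \<open>Otherwise at most d + r - 2 cells would be below or at the corner, fewer
            than its entry d + v because r is at most v + 1.\<close>
          have "{z \<in> cells. \<beta> z \<le> \<beta> corner} \<subseteq> inner \<union> insert corner ({3..<r} \<times> {1})"
          proof
            fix z assume z: "z \<in> {z \<in> cells. \<beta> z \<le> \<beta> corner}"
            then consider "z \<in> inner" | "z = corner" | r' where "z = (r', 1)" "3 \<le> r'" "r' \<le> l + 2"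
              using cells_eq by (auto simp: leg_def)
            then show "z \<in> inner \<union> insert corner ({3..<r} \<times> {1})"
            proof cases
              case z3: 3
              have "\<not> r < r'" using leg_increasing[OF f, of r r'] z3 z r ge by auto
              moreover have "r \<noteq> r'"
              proof
                assume "r = r'"
                then have "\<beta> z = \<beta> corner" using z3 z ge by auto
                moreover have "z \<in> cells" "corner \<in> cells" using z cells_eq by auto
                ultimately have "z = corner" using inj by (meson inj_onD)
                then show False using z3 by (auto simp: corner_def)
              qed
              ultimately show ?thesis using z3 by auto
            qed auto
          qed
          then have "card {z \<in> cells. \<beta> z \<le> \<beta> corner} \<le> card (inner \<union> insert corner ({3..<r} \<times> {1}))"
            using finite_parts by (intro card_mono) auto
          also have "\<dots> \<le> card inner + card (insert corner ({3..<r} \<times> {1::nat}))" by (rule card_Un_le)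
          also have "card (insert corner ({3..<r} \<times> {1::nat})) = Suc (r - 3)"
            by (subst card_insert_disjoint) (auto simp: card_cartesian_product corner_def)
          finally have "card {z \<in> cells. \<beta> z \<le> \<beta> corner} \<le> d + Suc (r - 3)" using card_inner by simp
          then show False using filling_eq_card[OF f, of corner] cells_eq bc r by auto
        qed
      next
        case c4: 4
        then show ?thesis using 4 by simp
      qed
    qed
  qed
  then show ?thesis using fillingsD(1,2)[OF f] by (auto simp: fillings_def)
qed

lemma outside_supset:
  assumes v: "1 \<le> v" "v \<le> l + 1" and \<beta>: "\<beta> \<in> fillings cells (forced v)"
  shows "\<beta> \<in> outside v"
proof -
  have f: "\<beta> \<in> fillings cells rel" using \<beta> by (auto simp: fillings_def forced_def)
  have less: "\<beta> x < \<beta> y" if "x \<in> cells" "y \<in> cells" "forced v x y" for x y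
    using fillingsD(3)[OF \<beta>] that by auto
  have c: "corner \<in> cells" using cells_eq by auto
  have b1: "\<beta> (1, N) \<noteq> 1"
  proof -
    have "(1, 1) \<in> cells" "(1, N) \<in> cells" by (auto simp: cells_def peak_cells_def N_def)
    moreover have "forced v (1, 1) (1, N)" using i by (auto simp: forced_def N_def)
    ultimately show ?thesis using less[of "(1, 1)" "(1, N)"] fillingsD(4)[OF f, of "(1, 1)"] by auto
  qed
  have ci: "corner \<notin> inner" using inner_disjoint by auto
  have li: "(r, 1) \<notin> inner" if "3 \<le> r" for r using that by (auto simp: inner_def)
  \<comment> \<open>The leg cells under the corner are those in rows 3 to v + 1, which are v - 1
    many; with \<open>inner\<close> and the corner itself this makes d + v.\<close>
  have "{z \<in> cells. \<beta> z \<le> \<beta> corner} = inner \<union> insert corner ({3..v + 1} \<times> {1})"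
  proof (intro equalityI subsetI)
    fix z assume z: "z \<in> {z \<in> cells. \<beta> z \<le> \<beta> corner}"
    then consider "z \<in> inner" | "z = corner" | r' where "z = (r', 1)" "3 \<le> r'" "r' \<le> l + 2"
      using cells_eq by (auto simp: leg_def)
    then show "z \<in> inner \<union> insert corner ({3..v + 1} \<times> {1})"
    proof cases
      case 3
      have "\<not> forced v corner z" using less[of corner z] z c by auto
      then have "r' \<le> v + 1" using 3 ci li by (auto simp: forced_def corner_def)
      then show ?thesis using 3 by auto
    qed auto
  next
    fix z assume "z \<in> inner \<union> insert corner ({3..v + 1} \<times> {1})"
    then consider "z \<in> inner" | "z = corner" | r' where "z = (r', 1)" "3 \<le> r'" "r' \<le> v + 1" by auto
    then show "z \<in> {z \<in> cells. \<beta> z \<le> \<beta> corner}"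
    proof cases
      case 1
      then have "forced v z corner" using ci by (auto simp: forced_def)
      then show ?thesis using 1 less[of z corner] c cells_eq by auto
    next
      case 2
      then show ?thesis using c by simp
    next
      case 3
      then have "z \<in> cells" using v by (auto simp: cells_def peak_cells_def)
      moreover have "forced v z corner" using 3 ci li by (auto simp: forced_def corner_def)
      ultimately show ?thesis using less[of z corner] c by auto
    qed
  qed
  moreover have "card (inner \<union> insert corner ({3..v + 1} \<times> {1})) = d + v"
  proof (subst card_Un_disjoint)
    show "inner \<inter> insert corner ({3..v + 1} \<times> {1}) = {}" by (auto simp: inner_def corner_def)
    have "corner \<notin> {3..v + 1} \<times> {1}" by (auto simp: corner_def)
    then show "card inner + card (insert corner ({3..v + 1} \<times> {1})) = d + v"
      using v by (simp add: card_inner card_cartesian_product)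
  qed (use finite_parts in auto)
  ultimately have bc: "\<beta> corner = d + v" using filling_eq_card[OF f c] by simp
  have b3: "d < \<beta> (3, 1)" if "1 \<le> l"
  proof -
    have 3: "(3, 1) \<in> cells" using that by (auto simp: cells_def peak_cells_def)
    have "insert (3, 1) inner \<subseteq> {z \<in> cells. \<beta> z \<le> \<beta> (3, 1)}"
    proof
      fix z assume "z \<in> insert (3, 1) inner"
      then consider "z = (3, 1)" | "z \<in> inner" by auto
      then show "z \<in> {z \<in> cells. \<beta> z \<le> \<beta> (3, 1)}"
      proof cases
        case 2
        then have "forced v z (3, 1)" using li[of 3] by (auto simp: forced_def)
        then show ?thesis using less[of z "(3, 1)"] 2 3 cells_eq by auto
      qed (use 3 in auto)
    qed
    then have "card (insert (3, 1) inner) \<le> card {z \<in> cells. \<beta> z \<le> \<beta> (3, 1)}"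
      using finite_parts by (intro card_mono) auto
    then show ?thesis using filling_eq_card[OF f 3] li[of 3] finite_parts card_inner by simp
  qed
  show ?thesis using f b1 bc b3 by (auto simp: outside_def)
qed

text \<open>A half turn of the two rows, with the folded arm becoming a leg. It would send
  \<open>corner\<close> to \<open>(1, 1)\<close>, and \<open>(1, 1)\<close> out of the target shape;
  \<open>(1, 1)\<close> is therefore deleted on both sides, where it is forced to carry the least
  entry.\<close>

definition flip_cell :: "nat \<times> nat \<Rightarrow> nat \<times> nat" where
  "flip_cell = (\<lambda>(r, c). if r = 1 \<and> c \<le> i + 1 then (2, i + 2 - c) else if r = 1 then (2 + (c - (i + 1)), 1) else (1, i + 2 - c))"

lemma flip_cell_simps:
  "c \<le> i + 1 \<Longrightarrow> flip_cell (1, c) = (2, i + 2 - c)"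
  "1 \<le> j \<Longrightarrow> flip_cell (1, i + 1 + j) = (2 + j, 1)"
  "flip_cell (2, c) = (1::nat, i + 2 - c)"
  by (auto simp: flip_cell_def)

lemma inner_cases:
  assumes "x \<in> inner - {(1, 1)}"
  obtains (upper) c where "x = (1, c)" "2 \<le> c" "c \<le> i + 1"
    | (arm) j where "x = (1, i + 1 + j)" "1 \<le> j" "j \<le> k"
    | (lower) c where "x = (2, c)" "1 \<le> c" "c \<le> i"
proof -
  obtain r c where x: "x = (r, c)" by force
  have "r = 1 \<and> 2 \<le> c \<and> c \<le> i + 1 \<or> r = 1 \<and> i + 1 < c \<and> c \<le> i + 1 + k \<or> r = 2 \<and> 1 \<le> c \<and> c \<le> i"
    using assms by (auto simp: inner_def N_def x)
  then show ?thesis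
    using upper[of c] arm[of "c - (i + 1)"] lower[of c] x by fastforce
qed

text \<open>The partition shape $(i+1, i, 1^k)$ with k = d - 2i - 1; the detached column is empty
  since its start i + 2 exceeds its end i + 1.\<close>

definition "straight = near_hook_cells (i + 1) i k (i + 2) (i + 1)"

lemma bij_betw_flip_cell: "bij_betw flip_cell (inner - {(1, 1)}) (straight - {(1, 1)})"
proof (rule bij_betw_imageI)
  show "inj_on flip_cell (inner - {(1, 1)})"
  proof (rule inj_onI)
    fix x y assume "x \<in> inner - {(1, 1)}" "y \<in> inner - {(1, 1)}" "flip_cell x = flip_cell y"
    then show "x = y"
      using i by (elim inner_cases; simp only: flip_cell_simps; auto)
  qed
  have "flip_cell x \<in> straight - {(1, 1)}" if "x \<in> inner - {(1, 1)}" for x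
    using that i by (elim inner_cases; simp only: flip_cell_simps; auto simp: straight_def near_hook_cells_def)
  moreover have "x \<in> flip_cell ` (inner - {(1, 1)})" if x: "x \<in> straight - {(1, 1)}" for x
  proof -
    obtain r c where rc: "x = (r, c)" by force
    consider "r = 1" "2 \<le> c" "c \<le> i + 1" | "r = 2" "1 \<le> c" "c \<le> i" | "3 \<le> r" "r \<le> k + 2" "c = 1"
      using x rc by (fastforce simp: straight_def near_hook_cells_def)
    then show ?thesis
    proof cases
      case 1
      then have "x = flip_cell (2, i + 2 - c)" by (simp add: flip_cell_simps rc)
      moreover have "(2, i + 2 - c) \<in> inner - {(1, 1)}" using 1 by (auto simp: inner_def)
      ultimately show ?thesis by (rule image_eqI)
    next
      case 2
      then have "x = flip_cell (1, i + 2 - c)" by (subst flip_cell_simps) (auto simp: rc)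
      moreover have "(1, i + 2 - c) \<in> inner - {(1, 1)}" using 2 by (auto simp: inner_def N_def)
      ultimately show ?thesis by (rule image_eqI)
    next
      case 3
      then have "x = flip_cell (1, i + 1 + (r - 2))" by (subst flip_cell_simps) (auto simp: rc)
      moreover have "(1, i + 1 + (r - 2)) \<in> inner - {(1, 1)}" using 3 by (auto simp: inner_def N_def)
      ultimately show ?thesis by (rule image_eqI)
    qed
  qed
  ultimately show "flip_cell ` (inner - {(1, 1)}) = straight - {(1, 1)}"
    by (intro equalityI image_subsetI subsetI)
qed

lemma rel_flip_cell:
  assumes "x \<in> inner - {(1, 1)}" "y \<in> inner - {(1, 1)}"
  shows "rel y x \<longleftrightarrow> near_hook_rel (i + 1) (i + 2) (flip_cell x) (flip_cell y)"
  using assms i by (elim inner_cases; simp only: flip_cell_simps; auto)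

text \<open>The parameter \<open>v\<close> only says where the corner is inserted into the chain of
  leg cells on top, so the count does not depend on it. What remains is \<open>inner\<close> without
  its least cell, which the half turn, reversing the order, carries to the straight shape.\<close>

lemma card_outside:
  assumes v: "1 \<le> v" "v \<le> l + 1"
  shows "card (outside v) = card (fillings straight (near_hook_rel (i + 1) (i + 2)))"
proof -
  let ?A = "insert corner leg"
  have "outside v = fillings cells (forced v)" using outside_subset outside_supset v by blast
  also have "card \<dots> = card (fillings (inner \<union> ?A) (forced v))" by (simp add: cells_eq)
  also have "\<dots> = card (fillings inner (forced v))"
  proof (rule card_fillings_top_chain[where f = "height v"])
    show "inner \<inter> ?A = {}" by (rule inner_disjoint)
    show "forced v x y \<and> \<not> forced v y x" if "x \<in> inner" "y \<in> ?A" for x y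
    proof -
      have "y \<notin> inner" using that inner_disjoint by auto
      moreover have "y \<noteq> (1, 1)" "\<not> rel y x" using that by (auto simp: inner_def corner_def leg_def)
      ultimately show ?thesis using that(1) unfolding forced_def by blast
    qed
    show "forced v x y \<longleftrightarrow> height v x < height v y" if "x \<in> ?A" "y \<in> ?A" for x y
    proof -
      have "x \<notin> inner" "y \<notin> inner" using that inner_disjoint by auto
      moreover have "x \<noteq> (1, 1)" "rel x y \<Longrightarrow> height v x < height v y"
        using that i by (auto simp: corner_def leg_def)
      ultimately show ?thesis unfolding forced_def by blast
    qed
    \<comment> \<open>Leg heights are even and the corner height is odd, so no two heights
      tie.\<close>
    have "2 * r \<noteq> 2 * v + 3" "2 * v + 3 \<noteq> 2 * r" for r :: nat by presburger+
    then show "inj_on (height v) ?A" by (intro inj_onI) (auto simp: corner_def leg_def)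
  qed (use finite_parts in auto)
  also have "\<dots> = card (fillings (inner - {(1, 1)}) (forced v))"
  proof (rule card_fillings_unique_min)
    show "(1, 1) \<in> inner" by (auto simp: inner_def N_def)
    show "\<forall>y\<in>inner. \<not> forced v y (1, 1)" using i by (auto simp: forced_def inner_def N_def)
    show "\<exists>z\<in>inner. forced v z y" if "y \<in> inner" "y \<noteq> (1, 1)" for y
      using that by (intro bexI[of _ "(1, 1)"]) (auto simp: forced_def inner_def N_def)
  qed (rule finite_parts)
  also have "\<dots> = card (fillings (inner - {(1, 1)}) rel)"
    by (rule arg_cong[where f = card], rule fillings_cong) (auto simp: forced_def)
  also have "\<dots> = card (fillings (inner - {(1, 1)}) (\<lambda>x y. rel y x))"
    by (rule card_fillings_reverse) (simp add: finite_parts)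
  also have "\<dots> = card (fillings (straight - {(1, 1)}) (near_hook_rel (i + 1) (i + 2)))"
    by (rule card_fillings_iso[OF bij_betw_flip_cell]) (rule rel_flip_cell)
  also have "\<dots> = card (fillings straight (near_hook_rel (i + 1) (i + 2)))"
  proof (rule card_fillings_unique_min[symmetric])
    show "\<exists>z\<in>straight. near_hook_rel (i + 1) (i + 2) z y" if y: "y \<in> straight" "y \<noteq> (1, 1)" for y
    proof -
      obtain r c where rc: "y = (r, c)" by force
      consider "r = 1" "2 \<le> c" "c \<le> i + 1" | "r = 2" "1 \<le> c" "c \<le> i" | "3 \<le> r" "r \<le> k + 2" "c = 1"
        using y rc by (fastforce simp: straight_def near_hook_cells_def)
      then show ?thesis
      proof cases
        case 1
        then show ?thesis using rc by (intro bexI[of _ "(1, c - 1)"]) (auto simp: straight_def near_hook_cells_def)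
      next
        case 2
        then show ?thesis using rc by (intro bexI[of _ "(1, c)"]) (auto simp: straight_def near_hook_cells_def)
      next
        case 3
        then show ?thesis using rc i by (intro bexI[of _ "(r - 1, 1)"]) (auto simp: straight_def near_hook_cells_def)
      qed
    qed
  qed (auto simp: straight_def near_hook_cells_def)
  finally show ?thesis .
qed

end

context peak_shape begin

lemma card_straight:
  "real (card (fillings straight (near_hook_rel (i + 1) (i + 2)))) = fact d * hook_weight (i + 1) i k"
proof -
  have a: "i + 1 + i + k + 0 = d" "i + 1 + 1 - (i + 2) = 0"
    by (simp_all add: d_def)
  have "real (card (fillings straight (near_hook_rel (i + 1) (i + 2)))) =
      fact (i + 1 + i + k + (i + 1 + 1 - (i + 2))) * hook_weight (i + 1) i k / fact (i + 1 + 1 - (i + 2))"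
    unfolding straight_def by (rule card_near_hook_fillings) (use i in auto)
  then show ?thesis unfolding a by (simp only: fact_0 div_by_1)
qed

lemma card_SkYT:
  "card (SkYT (l + 2) i (k + 2)) = card (fillings cells rel)"
  using bij_betw_same_card[OF bij_betw_SkYT[OF i, where k = k and l = l]] by (simp add: cells_def N_def)

text \<open>The corner entry always exceeds \<open>d\<close>, so violating the condition on it means
  that it is d + v with v between 1 and \<open>\<rho>\<close>; these classes are disjoint and
  equally large. The bound on \<open>\<rho>\<close> keeps d + v within the range of entries.\<close>

lemma card_SkYT_complement:
  assumes \<rho>: "\<rho> \<le> l + 1"
  shows "card (SkYT (l + 2) i (k + 2)) = card (SkYT_removed \<rho> (l + 1) d i) +
    \<rho> * card (fillings straight (near_hook_rel (i + 1) (i + 2)))"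
proof -
  let ?T = "SkYT (l + 2) i (k + 2)" and ?R = "SkYT_removed \<rho> (l + 1) d i"
  define h where "h = (\<lambda>\<alpha> :: nat \<times> nat \<Rightarrow> nat. restrict (\<alpha> \<circ> skew_cell i (k + 2)) cells)"
  have bij: "bij_betw h ?T (fillings cells rel)"
    using bij_betw_SkYT[OF i, where k = k and l = l] by (simp add: h_def cells_def N_def)
  have mem: "(1, N) \<in> cells" "corner \<in> cells" "1 \<le> l \<Longrightarrow> (3, 1) \<in> cells"
    by (auto simp: cells_def peak_cells_def N_def corner_def)
  have h1: "h \<alpha> (1, N) = \<alpha> (1, i + 1)" for \<alpha>
    using mem by (simp add: h_def N_def skew_cell_def)
  have h2: "h \<alpha> corner = \<alpha> (k + 2, i + 1)" for \<alpha>
    using mem by (simp add: h_def corner_def skew_cell_def)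
  have h3: "h \<alpha> (3, 1) = \<alpha> (k + 3, 1)" if "1 \<le> l" for \<alpha>
    using mem that by (simp add: h_def skew_cell_def numeral_3_eq_3)
  have R: "?R = {\<alpha> \<in> ?T. \<alpha> (1, i + 1) = 1 \<or> \<alpha> (k + 2, i + 1) > d + \<rho> \<or> (1 \<le> l \<and> \<alpha> (k + 3, 1) < d + 1)}"
  proof -
    have "l + 1 + 1 = l + 2" "d + 1 - 2 * i = k + 2" "k + 2 + 1 = k + 3" by (simp_all add: d_def)
    moreover have "(k + 3, 1) \<in> skew_cells (l + 2) i (k + 2) \<longleftrightarrow> 1 \<le> l"
      using i by (auto simp: skew_cells_def)
    ultimately show ?thesis unfolding SkYT_removed_def Let_def by (simp only:)
  qed
  have fin: "finite ?T" using bij finite_fillings[OF finite_parts(1)] bij_betw_finite by blast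
  have "h ` (?T - ?R) = (\<Union>v\<in>{1..\<rho>}. outside v)"
  proof (intro equalityI subsetI)
    fix \<beta> assume "\<beta> \<in> h ` (?T - ?R)"
    then obtain \<alpha> where \<alpha>: "\<beta> = h \<alpha>" "\<alpha> \<in> ?T" "\<alpha> \<notin> ?R" by auto
    have f: "\<beta> \<in> fillings cells rel" using \<alpha> bij by (auto simp: bij_betw_def)
    have "d < \<beta> corner" using corner_gt[OF f] .
    moreover have "\<beta> (1, N) \<noteq> 1" "\<beta> corner \<le> d + \<rho>" "1 \<le> l \<longrightarrow> d < \<beta> (3, 1)"
      using \<alpha> h1 h2 h3 unfolding R by auto
    ultimately have "\<beta> \<in> outside (\<beta> corner - d)" "\<beta> corner - d \<in> {1..\<rho>}"
      using f by (auto simp: outside_def)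
    then show "\<beta> \<in> (\<Union>v\<in>{1..\<rho>}. outside v)" by blast
  next
    fix \<beta> assume "\<beta> \<in> (\<Union>v\<in>{1..\<rho>}. outside v)"
    then obtain v where v: "1 \<le> v" "v \<le> \<rho>" and f: "\<beta> \<in> fillings cells rel"
      and c: "\<beta> (1, N) \<noteq> 1" "\<beta> corner = d + v" "1 \<le> l \<longrightarrow> d < \<beta> (3, 1)"
      by (auto simp: outside_def)
    obtain \<alpha> where \<alpha>: "\<alpha> \<in> ?T" "\<beta> = h \<alpha>" using f bij by (auto simp: bij_betw_def)
    have "\<alpha> \<notin> ?R" using c v \<alpha> h1[of \<alpha>] h2[of \<alpha>] h3[of \<alpha>] unfolding R by auto
    then show "\<beta> \<in> h ` (?T - ?R)" using \<alpha> by blast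
  qed
  moreover have "inj_on h (?T - ?R)" using bij by (auto simp: bij_betw_def intro: inj_on_subset)
  ultimately have "card (?T - ?R) = card (\<Union>v\<in>{1..\<rho>}. outside v)" by (metis card_image)
  also have "\<dots> = (\<Sum>v\<in>{1..\<rho>}. card (outside v))"
  proof (rule card_UN_disjoint)
    show "\<forall>v\<in>{1..\<rho>}. finite (outside v)"
      using finite_subset[OF _ finite_fillings[OF finite_parts(1), of rel]] by (auto simp: outside_def)
    show "\<forall>v\<in>{1..\<rho>}. \<forall>w\<in>{1..\<rho>}. v \<noteq> w \<longrightarrow> outside v \<inter> outside w = {}" by (auto simp: outside_def)
  qed simp
  also have "\<dots> = \<rho> * card (fillings straight (near_hook_rel (i + 1) (i + 2)))"
    using card_outside \<rho> by simp
  finally have "card (?T - ?R) = \<rho> * card (fillings straight (near_hook_rel (i + 1) (i + 2)))" .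
  moreover have "card ?T = card ?R + card (?T - ?R)"
  proof -
    have "?R \<subseteq> ?T" unfolding R by auto
    then show ?thesis using fin card_Diff_subset[of ?R ?T] card_mono[of ?T ?R] finite_subset by fastforce
  qed
  ultimately show ?thesis by simp
qed

lemma card_SkYT_formula:
  "real (card (SkYT (l + 2) i (k + 2))) =
    (\<Sum>s\<le>k. (- 1) ^ s * (fact (d + l + 1) * hook_weight (i + 1 + s) (i + 1) l / fact (k - s)))"
proof -
  have a: "N - (i + 1) = k" "N - (i + 1 + s) = k - s" "N + (i + 1) + l = d + l + 1" for s
    by (auto simp: N_def d_def)
  show ?thesis
    unfolding card_SkYT cells_def
  proof (subst card_peak_fillings, goal_cases)
    case 4
    show ?case unfolding a by (simp only: a)
  qed (simp_all add: N_def)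
qed

end

section \<open>Binomial identities\<close>

lemma sum_alternating_inverse_fact:
  "(\<Sum>p\<le>j. (- 1) ^ p / (fact p * fact (j - p))) = (if j = 0 then 1 else 0 :: real)"
proof -
  have "(\<Sum>p\<le>j. (- 1) ^ p / (fact p * fact (j - p)) :: real) = (\<Sum>p\<le>j. (- 1) ^ p * real (j choose p)) / fact j"
    unfolding sum_divide_distrib by (rule sum.cong) (auto simp: binomial_fact)
  also have "\<dots> = (if j = 0 then 1 else 0)"
    using choose_alternating_sum[of j, where ?'a = real] by auto
  finally show ?thesis .
qed

text \<open>Both sides are the Beta integral B(m, k + 1); the induction uses Pascal's rule.\<close>

lemma sum_alternating_choose_divide:
  "0 < m \<Longrightarrow> (\<Sum>q\<le>k. (- 1) ^ q * real (k choose q) / (real q + real m)) = fact k * fact (m - 1) / fact (m + k)"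
proof (induction k arbitrary: m)
  case 0
  then show ?case by (cases m) auto
next
  case (Suc k)
  let ?f = "\<lambda>k m q. (- 1) ^ q * real (k choose q) / (real q + real m)"
  have "(\<Sum>q\<le>Suc k. ?f (Suc k) m q) = ?f (Suc k) m 0 + (\<Sum>q\<le>k. ?f (Suc k) m (Suc q))"
    by (rule sum.atMost_Suc_shift)
  also have "(\<Sum>q\<le>k. ?f (Suc k) m (Suc q)) = (\<Sum>q\<le>k. ?f k m (Suc q)) - (\<Sum>q\<le>k. ?f k (Suc m) q)"
    unfolding sum_subtractf[symmetric]
    by (rule sum.cong) (auto simp: algebra_simps add_divide_distrib diff_divide_distrib)
  also have "?f (Suc k) m 0 + ((\<Sum>q\<le>k. ?f k m (Suc q)) - (\<Sum>q\<le>k. ?f k (Suc m) q)) =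
     (?f k m 0 + (\<Sum>q\<le>k. ?f k m (Suc q))) - (\<Sum>q\<le>k. ?f k (Suc m) q)" by simp
  also have "?f k m 0 + (\<Sum>q\<le>k. ?f k m (Suc q)) = (\<Sum>q\<le>Suc k. ?f k m q)"
    by (rule sum.atMost_Suc_shift[symmetric])
  also have "\<dots> = (\<Sum>q\<le>k. ?f k m q)" by simp
  also have "(\<Sum>q\<le>k. ?f k m q) - (\<Sum>q\<le>k. ?f k (Suc m) q) =
     fact k * fact (m - 1) / fact (m + k) - fact k * fact m / fact (Suc m + k)"
    using Suc.IH[of m] Suc.IH[of "Suc m"] Suc.prems by simp
  also have "\<dots> = fact (Suc k) * fact (m - 1) / fact (m + Suc k)"
  proof -
    have 1: "fact m = real m * fact (m - 1)" using Suc.prems by (cases m) auto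
    have 2: "fact (Suc m + k) = (real m + real k + 1) * fact (m + k)" "fact (m + Suc k) = (real m + real k + 1) * fact (m + k)"
      by (simp_all add: algebra_simps)
    have "real m + real k + 1 > 0" by simp
    then have c: "x / fact (m + k) - y / ((real m + real k + 1) * fact (m + k)) =
        (x * (real m + real k + 1) - y) / ((real m + real k + 1) * fact (m + k))" for x y :: real
      by (simp add: diff_divide_distrib)
    show ?thesis unfolding 1 2 c by (simp add: algebra_simps)
  qed
  finally show ?case .
qed

lemma sum_alternating_fact_divide:
  assumes "0 < m"
  shows "(\<Sum>q\<le>k. (- 1) ^ q / (fact q * fact (k - q)) / (real q + real m)) = fact (m - 1) / fact (m + k)"
proof -
  have "(\<Sum>q\<le>k. (- 1) ^ q / (fact q * fact (k - q)) / (real q + real m)) =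
     (\<Sum>q\<le>k. (- 1) ^ q * real (k choose q) / (real q + real m)) / fact k"
    unfolding sum_divide_distrib by (rule sum.cong) (auto simp: binomial_fact)
  then show ?thesis using sum_alternating_choose_divide[OF assms] by simp
qed

text \<open>
  \<open>cU l d i\<close> and \<open>cD d i\<close> are the coefficients of $t^i$ for the uniform matroid $U_{l+1,d}$ and
  for the loss caused by removing one basis. The $(d-1)$-subsets of a removed basis are not flats;
  the junk value \<open>cD 1 0 = 1\<close> subtracts their terms. \<open>Zpart c n d j\<close> is the coefficient of $t^j$ in
  $\sum_k {n \choose k} t^{d-k} P_{d-k}(t^{-1})$, where $P_e = \sum_i c_{e,i} t^i$.
\<close>

definition cU :: "nat \<Rightarrow> nat \<Rightarrow> nat \<Rightarrow> real" where
  "cU l d i = (if 2 * i < d then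
     \<Sum>s\<le>d - 1 - 2 * i. (- 1) ^ s * (fact (d + l + 1) * hook_weight (i + 1 + s) (i + 1) l / fact (d - 1 - 2 * i - s)) else 0)"

definition cD :: "nat \<Rightarrow> nat \<Rightarrow> real" where
  "cD d i = (if i = 0 then (if d = 1 then 1 else 0)
     else if 2 * i < d then fact d * hook_weight (i + 1) i (d - 1 - 2 * i) else 0)"

definition Zpart :: "(nat \<Rightarrow> nat \<Rightarrow> real) \<Rightarrow> nat \<Rightarrow> nat \<Rightarrow> nat \<Rightarrow> real" where
  "Zpart c n d j = (\<Sum>e\<in>{max 1 j..d}. real (n choose (d - e)) * c e (e - j))"

text \<open>Partial fractions: the numerator p - q is (p + l + 1) - (q + l + 1), the difference of
  the two denominators.\<close>

lemma hook_weight_separate: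
  assumes "q < p"
  shows "hook_weight p (q + 1) l =
    (1 / (real q + real (l + 1)) - 1 / (real p + real (l + 1))) / (fact l * fact p * fact q)"
proof -
  have nz: "real q + real l + 1 > 0" "real p + real l + 1 > 0" by simp_all
  have "hook_weight p (q + 1) l = (real p - real q) / ((real p + real l + 1) * (real q + real l + 1)) * ((real q + 1) / fact (q + 1)) / (fact l * fact p)"
    by (simp add: hook_weight_def mult_ac add_ac)
  also have "(real q + 1) / fact (q + 1) = 1 / fact q"
    by (simp add: add.commute)
  also have "(real p - real q) / ((real p + real l + 1) * (real q + real l + 1)) = 1 / (real q + real (l + 1)) - 1 / (real p + real (l + 1))"
    using nz by (simp add: diff_frac_eq algebra_simps)
  finally show ?thesis by simp
qed

text \<open>The hook weight is a difference of a function of \<open>q\<close> and one of \<open>p\<close>, so the double sum of these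
  terms over a rectangle factors.\<close>

definition sepsum :: "nat \<Rightarrow> nat \<Rightarrow> nat \<Rightarrow> nat \<Rightarrow> nat \<Rightarrow> real" where
  "sepsum l j k p q = (- 1) ^ (p + q) * (1 / (real q + real (l + 1)) - 1 / (real p + real (l + 1))) /
     (fact p * fact q * fact (j - p) * fact (k - q))"

text \<open>Put e = j + q and p = q + 1 + s. Then the binomial coefficient cancels the factorial in
  \<open>cU\<close>, and the alternating sum in \<open>cU\<close> runs over p with q < p \<le> j, so
  the double sum covers a triangle.\<close>

lemma Zpart_cU:
  assumes "j \<le> d"
  shows "Zpart (cU l) (l + 1 + d) d j =
    - (fact (l + 1 + d) / fact l * (\<Sum>q\<le>d - j. \<Sum>p\<le>j. if q < p then sepsum l j (d - j) p q else 0))"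
proof (cases "j = 0")
  case True
  have "Zpart (cU l) (l + 1 + d) d j = 0"
    unfolding Zpart_def using True by (intro sum.neutral) (auto simp: cU_def)
  then show ?thesis using True by simp
next
  case False
  let ?n = "l + 1 + d"
  have "Zpart (cU l) ?n d j = (\<Sum>q\<le>d - j. real (?n choose (d - (j + q))) * cU l (j + q) q)"
    unfolding Zpart_def
    by (rule sum.reindex_bij_witness[of _ "\<lambda>q. j + q" "\<lambda>e. e - j"]) (use False assms in auto)
  also have "\<dots> = (\<Sum>q\<le>d - j. - (fact ?n / fact l * (\<Sum>p\<le>j. if q < p then sepsum l j (d - j) p q else 0)))"
  proof (rule sum.cong[OF refl])
    fix q assume q: "q \<in> {..d - j}"
    have bin: "real (?n choose (d - (j + q))) * fact (j + q + l + 1) = fact ?n / fact (d - j - q)"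
    proof -
      have "?n - (d - (j + q)) = j + q + l + 1" "d - (j + q) = d - j - q" using q assms by auto
      moreover have "d - (j + q) \<le> ?n" by simp
      ultimately have "real (?n choose (d - (j + q))) = fact ?n / (fact (d - j - q) * fact (j + q + l + 1))"
        using binomial_fact[of "d - (j + q)" ?n, where ?'a = real] by (simp only:)
      moreover have "x * c = a / b" if "x = a / (b * c)" "c \<noteq> 0" for x a b c :: real
        using that by simp
      ultimately show ?thesis by (metis fact_nonzero)
    qed
    show "real (?n choose (d - (j + q))) * cU l (j + q) q =
       - (fact ?n / fact l * (\<Sum>p\<le>j. if q < p then sepsum l j (d - j) p q else 0))"
    proof (cases "q < j")
      case False
      then have "cU l (j + q) q = 0" by (simp add: cU_def)
      moreover have "(\<Sum>p\<le>j. if q < p then sepsum l j (d - j) p q else 0) = 0"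
        using False by (intro sum.neutral) auto
      ultimately show ?thesis by simp
    next
      case True
      have a: "j + q - 1 - 2 * q = j - 1 - q" using True by simp
      have "(\<Sum>p\<le>j. if q < p then sepsum l j (d - j) p q else 0) = (\<Sum>p\<in>{q + 1..j}. sepsum l j (d - j) p q)"
        unfolding sum.If_cases[OF finite_atMost] by (simp, rule sum.cong) auto
      also have "\<dots> = (\<Sum>s\<le>j - 1 - q. sepsum l j (d - j) (q + 1 + s) q)"
        by (rule sum.reindex_bij_witness[of _ "\<lambda>s. q + 1 + s" "\<lambda>p. p - (q + 1)"]) (use True in auto)
      finally have S: "(\<Sum>p\<le>j. if q < p then sepsum l j (d - j) p q else 0) = (\<Sum>s\<le>j - 1 - q. sepsum l j (d - j) (q + 1 + s) q)" .
      have "real (?n choose (d - (j + q))) * cU l (j + q) q = (\<Sum>s\<le>j - 1 - q. (real (?n choose (d - (j + q))) * fact (j + q + l + 1)) *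
          ((- 1) ^ s * (hook_weight (q + 1 + s) (q + 1) l / fact (j - 1 - q - s))))"
        using True by (simp add: cU_def a sum_distrib_left mult_ac)
      also have "\<dots> = (\<Sum>s\<le>j - 1 - q. - (fact ?n / fact l * sepsum l j (d - j) (q + 1 + s) q))"
      proof (rule sum.cong[OF refl])
        fix s assume s: "s \<in> {..j - 1 - q}"
        \<comment> \<open>Since p + q = 2q + 1 + s, passing to p and q costs one sign, the origin of
          the global minus.\<close>
        have e: "(- 1) ^ (q + 1 + s + q) = - ((- 1) ^ s :: real)"
          by (simp add: power_add mult.assoc flip: power_mult_distrib)
        have f: "j - (q + 1 + s) = j - 1 - q - s" by simp
        show "(real (?n choose (d - (j + q))) * fact (j + q + l + 1)) *
          ((- 1) ^ s * (hook_weight (q + 1 + s) (q + 1) l / fact (j - 1 - q - s))) =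
          - (fact ?n / fact l * sepsum l j (d - j) (q + 1 + s) q)"
        proof -
          have "N / D * (x * (W / (L * P * Q) / J)) = - (N / L * (- x * W / (P * Q * J * D)))"
            for N D x W L P Q J :: real by simp
          moreover have "q < q + 1 + s" by simp
          ultimately show ?thesis unfolding bin sepsum_def e f hook_weight_separate[OF \<open>q < q + 1 + s\<close>] by blast
        qed
      qed
      also have "\<dots> = - (fact ?n / fact l * (\<Sum>s\<le>j - 1 - q. sepsum l j (d - j) (q + 1 + s) q))"
        by (simp add: sum_negf sum_distrib_left)
      finally show ?thesis unfolding S .
    qed
  qed
  also have "\<dots> = - (fact ?n / fact l * (\<Sum>q\<le>d - j. \<Sum>p\<le>j. if q < p then sepsum l j (d - j) p q else 0))"
    by (simp add: sum_negf sum_distrib_left)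
  finally show ?thesis .
qed

text \<open>Exchanging j and d - j exchanges p and q and flips the sign, so the two terms are the
  triangles on either side of the diagonal, where the summand is 0. The full rectangle factors, and
  each product contains an alternating sum that vanishes unless j is 0 or d. The right side reflects
  the ground set, the flat of rank \<open>d\<close>, which \<open>Zpart\<close> omits.\<close>

lemma Zpart_cU_antisymmetric:
  assumes "j \<le> d" "1 \<le> d"
  shows "Zpart (cU l) (l + 1 + d) d j - Zpart (cU l) (l + 1 + d) d (d - j) = (if j = d then 1 else 0) - (if j = 0 then 1 else 0)"
proof -
  let ?n = "l + 1 + d" and ?k = "d - j"
  let ?S = "sepsum l j ?k"
  have swap: "sepsum l ?k j p q = - sepsum l j ?k q p" for p q
  proof -
    have "x * (a - b) / (f * g * h * w) = - (x * (b - a) / (g * f * w * h))" for x a b f g h w :: real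
      by (simp add: mult_ac right_diff_distrib diff_divide_distrib)
    then show ?thesis unfolding sepsum_def by (subst add.commute)
  qed
  have A: "Zpart (cU l) ?n d j = - (fact ?n / fact l * (\<Sum>q\<le>?k. \<Sum>p\<le>j. if q < p then ?S p q else 0))"
    by (rule Zpart_cU) (rule assms)
  have "Zpart (cU l) ?n d ?k = - (fact ?n / fact l * (\<Sum>q\<le>j. \<Sum>p\<le>?k. if q < p then sepsum l ?k j p q else 0))"
    using Zpart_cU[of ?k d l] diff_diff_cancel[OF assms(1)] by (simp only: diff_le_self)
  also have "\<dots> = fact ?n / fact l * (\<Sum>q\<le>j. \<Sum>p\<le>?k. if q < p then ?S q p else 0)"
  proof -
    have "(\<Sum>q\<le>j. \<Sum>p\<le>?k. if q < p then - ?S q p else 0) = - (\<Sum>q\<le>j. \<Sum>p\<le>?k. if q < p then ?S q p else 0)"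
      unfolding sum_negf[symmetric] by (intro sum.cong refl) auto
    then show ?thesis unfolding swap by (simp only: mult_minus_right minus_minus)
  qed
  also have "(\<Sum>q\<le>j. \<Sum>p\<le>?k. if q < p then ?S q p else 0) = (\<Sum>q\<le>?k. \<Sum>p\<le>j. if p < q then ?S p q else 0)"
    by (rule sum.swap)
  finally have "Zpart (cU l) ?n d j - Zpart (cU l) ?n d ?k =
     - (fact ?n / fact l * ((\<Sum>q\<le>?k. \<Sum>p\<le>j. if q < p then ?S p q else 0) + (\<Sum>q\<le>?k. \<Sum>p\<le>j. if p < q then ?S p q else 0)))"
    unfolding A by (simp add: algebra_simps)
  also have "(\<Sum>q\<le>?k. \<Sum>p\<le>j. if q < p then ?S p q else 0) + (\<Sum>q\<le>?k. \<Sum>p\<le>j. if p < q then ?S p q else 0) = (\<Sum>q\<le>?k. \<Sum>p\<le>j. ?S p q)"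
    unfolding sum.distrib[symmetric] by (intro sum.cong refl) (auto simp: sepsum_def)
  also have "\<dots> = (\<Sum>q\<le>?k. \<Sum>p\<le>j. ((- 1) ^ p / (fact p * fact (j - p))) * ((- 1) ^ q / (fact q * fact (?k - q)) / (real q + real (l + 1))))
     - (\<Sum>q\<le>?k. \<Sum>p\<le>j. ((- 1) ^ p / (fact p * fact (j - p)) / (real p + real (l + 1))) * ((- 1) ^ q / (fact q * fact (?k - q))))"
    unfolding sum_subtractf[symmetric]
    by (intro sum.cong refl) (simp add: sepsum_def power_add right_diff_distrib left_diff_distrib diff_divide_distrib mult_ac)
  also have "\<dots> = (\<Sum>p\<le>j. (- 1) ^ p / (fact p * fact (j - p))) * (\<Sum>q\<le>?k. (- 1) ^ q / (fact q * fact (?k - q)) / (real q + real (l + 1)))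
     - (\<Sum>p\<le>j. (- 1) ^ p / (fact p * fact (j - p)) / (real p + real (l + 1))) * (\<Sum>q\<le>?k. (- 1) ^ q / (fact q * fact (?k - q)))"
    unfolding sum_product by (subst (1 2) sum.swap) simp
  also have "\<dots> = (if j = 0 then 1 else 0) * (fact l / fact (l + 1 + ?k)) - fact l / fact (l + 1 + j) * (if ?k = 0 then 1 else 0)"
    using sum_alternating_fact_divide[of "l + 1"] unfolding sum_alternating_inverse_fact by simp
  finally show ?thesis using assms by auto
qed

text \<open>At j = d \<open>Zpart\<close> reduces to this coefficient, while at j = 0 it vanishes;
  so antisymmetry evaluates the alternating sum.\<close>

lemma cU_constant: "1 \<le> d \<Longrightarrow> cU l d 0 = 1"
proof -
  assume d: "1 \<le> d"
  have "Zpart (cU l) (l + 1 + d) d d = cU l d 0" using d by (simp add: Zpart_def max_def)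
  moreover have "Zpart (cU l) (l + 1 + d) d 0 = 0"
    unfolding Zpart_def by (rule sum.neutral) (auto simp: cU_def)
  ultimately show ?thesis using Zpart_cU_antisymmetric[of d d l] d by simp
qed

text \<open>The second summand is symmetric under j -> d - j, which is the whole point of the closed
  form; the first comes from the junk value \<open>cD 1 0\<close>.\<close>

lemma Zpart_cD:
  assumes "1 \<le> j" "j < d"
  shows "Zpart cD d d j = (if j = 1 then 1 else 0) +
     2 * fact d * fact (d - 1) / (fact (j + 1) * fact (j - 1) * fact (d - j + 1) * fact (d - j - 1))"
proof -
  let ?T = "\<lambda>i. real (d choose (d - (j + i))) * cD (j + i) i"
  have Z: "Zpart cD d d j = (\<Sum>i\<le>d - j. ?T i)"
    unfolding Zpart_def
    by (rule sum.reindex_bij_witness[of _ "\<lambda>i. j + i" "\<lambda>e. e - j"]) (use assms in auto)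
  have dj: "d - j = Suc (d - j - 1)" using assms by simp
  have Z': "Zpart cD d d j = ?T 0 + (\<Sum>r\<le>d - j - 1. ?T (Suc r))"
    unfolding Z by (subst dj) (rule sum.atMost_Suc_shift)
  show ?thesis
  proof (cases "j = 1")
    case True
    have "(\<Sum>r\<le>d - j - 1. ?T (Suc r)) = 0"
      by (rule sum.neutral) (auto simp: cD_def True)
    moreover have "?T 0 = real d"
    proof -
      have "d choose (d - 1) = d choose 1" by (rule binomial_symmetric[symmetric]) (use assms in auto)
      then show ?thesis using True by (simp add: cD_def)
    qed
    moreover have "2 * fact d * fact (d - 1) / (fact (j + 1) * fact (j - 1) * fact (d - j + 1) * fact (d - j - 1)) = real d - 1"
    proof -
      define d' where "d' = d - 2"
      have d': "d = Suc (Suc d')" using assms True by (simp add: d'_def)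
      have "fact (d - 1) = (real d - 1) * fact (d - j - 1)" "d - j + 1 = d" "j + 1 = 2" "j - 1 = 0"
        by (simp_all add: d' True)
      then show ?thesis by (simp only: fact_0 fact_2) simp
    qed
    ultimately show ?thesis unfolding Z' by (simp add: True)
  next
    case False
    then have j2: "2 \<le> j" using assms by simp
    define K where "K = 2 * fact d / ((real j + 1) * (real j - 1) * (fact j * fact (d - j - 1)))"
    \<comment> \<open>\<open>K\<close> collects the factors free of r; the others are the product of
      binomials in a Vandermonde convolution.\<close>
    have T: "?T (Suc r) = (if r \<le> j - 2 then K * real ((d - j - 1 choose r) * (j choose (j - 2 - r))) else 0)"
      if r: "r \<in> {..d - j - 1}" for r
    proof (cases "r \<le> j - 2")
      case True
      have a: "j + Suc r - 1 - 2 * Suc r = j - 2 - r" using j2 True by simp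
      have "2 * Suc r < j + Suc r" using True j2 by simp
      then have c: "cD (j + Suc r) (Suc r) = fact (j + Suc r) * hook_weight (Suc r + 1) (Suc r) (j - 2 - r)"
        by (simp add: cD_def a[symmetric] del: fact_Suc)
      have "d - (j + Suc r) \<le> d" "d - (d - (j + Suc r)) = j + Suc r" "d - (j + Suc r) = d - j - 1 - r"
        using r assms by auto
      then have b: "real (d choose (d - (j + Suc r))) = fact d / (fact (d - j - 1 - r) * fact (j + Suc r))"
        using binomial_fact[of "d - (j + Suc r)" d, where ?'a = real] by (simp only:)
      have h: "hook_weight (Suc r + 1) (Suc r) (j - 2 - r) =
          2 / ((real j + 1) * (real j - 1) * fact (j - 2 - r) * fact (r + 2) * fact r)"
      proof -
        have p: "real (Suc r + 1) + real (j - 2 - r) + 1 = real j + 1" "real (Suc r) + real (j - 2 - r) = real j - 1"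
          using True j2 by (auto simp: of_nat_diff)
        have q: "real (Suc r) / fact (Suc r) = 1 / fact r" by simp
        have "hook_weight (Suc r + 1) (Suc r) (j - 2 - r) =
          2 / ((real j + 1) * (real j - 1) * fact (j - 2 - r) * fact (Suc r + 1)) * (real (Suc r) / fact (Suc r))"
          unfolding hook_weight_def p by (simp del: fact_Suc)
        then show ?thesis unfolding q by simp
      qed
      have v1: "real (d - j - 1 choose r) = fact (d - j - 1) / (fact r * fact (d - j - 1 - r))"
        using r by (intro binomial_fact) auto
      have "j - 2 - r \<le> j" "j - (j - 2 - r) = r + 2" using True j2 by auto
      then have v2: "real (j choose (j - 2 - r)) = fact j / (fact (j - 2 - r) * fact (r + 2))"
        using binomial_fact[of "j - 2 - r" j, where ?'a = real] by (simp only:)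
      have gen: "N / (D * X) * (X * (2 / (J1 * J2 * A * B * C))) = 2 * N / (J1 * J2 * (F * G)) * ((G / (C * D)) * (F / (A * B)))"
        if "X \<noteq> 0" "F \<noteq> 0" "G \<noteq> 0" for N D X J1 J2 A B C F G :: real
        using that by (simp add: mult_ac)
      show ?thesis unfolding if_P[OF True] c b h K_def of_nat_mult v1 v2
        by (rule gen) (rule fact_nonzero)+
    next
      case False
      then show ?thesis by (auto simp: cD_def)
    qed
    have T0: "?T 0 = 0" using False by (simp add: cD_def)
    have "(\<Sum>r\<le>d - j - 1. ?T (Suc r)) = (\<Sum>r\<le>d - j - 1. if r \<le> j - 2 then K * real ((d - j - 1 choose r) * (j choose (j - 2 - r))) else 0)"
      by (rule sum.cong[OF refl T])
    \<comment> \<open>The two ranges may differ in either direction; beyond d - j - 1 the first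
      binomial is 0.\<close>
    also have "\<dots> = (\<Sum>r\<le>j - 2. K * real ((d - j - 1 choose r) * (j choose (j - 2 - r))))"
      by (rule sum.mono_neutral_cong) (auto simp: binomial_eq_0 not_le)
    also have "\<dots> = K * real (\<Sum>r\<le>j - 2. (d - j - 1 choose r) * (j choose (j - 2 - r)))"
      by (simp add: sum_distrib_left)
    also have "(\<Sum>r\<le>j - 2. (d - j - 1 choose r) * (j choose (j - 2 - r))) = (d - 1) choose (j - 2)"
      using vandermonde[of "d - j - 1" j "j - 2"] assms by simp
    also have "real ((d - 1) choose (j - 2)) = fact (d - 1) / (fact (j - 2) * fact (d - j + 1))"
    proof -
      have "j - 2 \<le> d - 1" "d - 1 - (j - 2) = d - j + 1" using assms j2 by auto
      then show ?thesis using binomial_fact[of "j - 2" "d - 1", where ?'a = real] by (simp only:)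
    qed
    also have "K * (fact (d - 1) / (fact (j - 2) * fact (d - j + 1))) =
       2 * fact d * fact (d - 1) / (fact (j + 1) * fact (j - 1) * fact (d - j + 1) * fact (d - j - 1))"
    proof -
      define j' where "j' = j - 2"
      have j': "j = Suc (Suc j')" using j2 by (simp add: j'_def)
      have f: "fact (j + 1) = (real j + 1) * fact j" "fact (j - 1) = (real j - 1) * fact (j - 2)"
        by (simp_all add: j' add.commute)
      show ?thesis unfolding K_def f by (simp add: mult_ac)
    qed
    finally show ?thesis using False T0 unfolding Z' by simp
  qed
qed

text \<open>The right side balances the removed basis itself, a flat of rank d - 1 whose contraction
  has rank 1.\<close>

lemma Zpart_cD_antisymmetric:
  assumes "j \<le> d" "2 \<le> d"
  shows "Zpart cD d d j - Zpart cD d d (d - j) = (if j = 1 then 1 else 0) - (if j = d - 1 then 1 else 0)"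
proof -
  have 0: "Zpart cD d d 0 = 0" unfolding Zpart_def by (rule sum.neutral) (auto simp: cD_def)
  have d: "Zpart cD d d d = 0" using assms by (simp add: Zpart_def cD_def max_def)
  consider "j = 0" | "j = d" | "1 \<le> j" "j < d" using assms by linarith
  then show ?thesis
  proof cases
    case 3
    have "d - (d - j) = j" "d - j = 1 \<longleftrightarrow> j = d - 1" "1 \<le> d - j" "d - j < d" using 3 by auto
    then show ?thesis using Zpart_cD[OF 3] Zpart_cD[of "d - j" d] by (simp add: mult_ac)
  qed (use 0 d assms in auto)
qed

section \<open>Coefficients\<close>

text \<open>The cardinalities behind the real closed form \<open>cU\<close>, in the ring of the
  polynomials; likewise \<open>removal_coeff\<close> for \<open>cD\<close>.\<close>

definition uniform_coeff :: "nat \<Rightarrow> nat \<Rightarrow> nat \<Rightarrow> int" where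
  "uniform_coeff l d i = (if i = 0 then 1 else int (card (SkYT (l + 2) i (d + 1 - 2 * i))))"

definition removal_coeff :: "nat \<Rightarrow> nat \<Rightarrow> int" where
  "removal_coeff d i = (if i = 0 then (if d = 1 then 1 else 0)
     else if 2 * i < d then
       int (card (fillings (near_hook_cells (i + 1) i (d - 1 - 2 * i) (i + 2) (i + 1)) (near_hook_rel (i + 1) (i + 2))))
     else 0)"

lemma peak_shape_params:
  assumes "1 \<le> i" "2 * i < d"
  shows "peak_shape i" "peak_shape.d i (d - 1 - 2 * i) = d" "d + 1 - 2 * i = (d - 1 - 2 * i) + 2"
    "peak_shape.straight i (d - 1 - 2 * i) = near_hook_cells (i + 1) i (d - 1 - 2 * i) (i + 2) (i + 1)"
proof -
  show p: "peak_shape i" using assms by unfold_locales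
  show "peak_shape.d i (d - 1 - 2 * i) = d" using assms by (simp add: peak_shape.d_def[OF p])
  show "d + 1 - 2 * i = (d - 1 - 2 * i) + 2" using assms by simp
  show "peak_shape.straight i (d - 1 - 2 * i) = near_hook_cells (i + 1) i (d - 1 - 2 * i) (i + 2) (i + 1)"
    by (simp add: peak_shape.straight_def[OF p])
qed

lemma SkYT_eq_empty: "b < 2 \<Longrightarrow> SkYT a i b = {}"
  by (simp add: SkYT_def)

lemma real_uniform_coeff:
  assumes "1 \<le> d"
  shows "real_of_int (uniform_coeff l d i) = cU l d i"
proof -
  consider "i = 0" | "1 \<le> i" "d \<le> 2 * i" | "1 \<le> i" "2 * i < d" by linarith
  then show ?thesis
  proof cases
    case 1
    then show ?thesis using cU_constant[OF assms] by (simp add: uniform_coeff_def)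
  next
    case 2
    then have "d + 1 - 2 * i < 2" by simp
    then show ?thesis using 2 by (simp add: uniform_coeff_def cU_def SkYT_eq_empty)
  next
    case 3
    note p = peak_shape_params[OF 3]
    show ?thesis
      using peak_shape.card_SkYT_formula[OF p(1), of l "d - 1 - 2 * i"] 3
      unfolding p(2) uniform_coeff_def p(3) cU_def by (simp del: fact_Suc)
  qed
qed

lemma real_removal_coeff: "real_of_int (removal_coeff d i) = cD d i"
proof -
  consider "i = 0" | "1 \<le> i" "d \<le> 2 * i" | "1 \<le> i" "2 * i < d" by linarith
  then show ?thesis
  proof cases
    case 3
    note p = peak_shape_params[OF 3]
    show ?thesis
      using peak_shape.card_straight[OF p(1), of "d - 1 - 2 * i"] 3
      unfolding p(2,4) removal_coeff_def cD_def by simp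
  qed (auto simp: removal_coeff_def cD_def)
qed

lemma num_SkYT_removed_eq:
  assumes "\<rho> \<le> l + 1" "1 \<le> d" "\<rho> = 0 \<or> 2 \<le> d"
  shows "int (num_SkYT_removed \<rho> (l + 1) d i) = uniform_coeff l d i - int \<rho> * removal_coeff d i"
proof -
  consider "i = 0" | "1 \<le> i" "d \<le> 2 * i" | "1 \<le> i" "2 * i < d" by linarith
  then show ?thesis
  proof cases
    case 1
    then show ?thesis using assms by (auto simp: num_SkYT_removed_def uniform_coeff_def removal_coeff_def)
  next
    case 2
    then have "d + 1 - 2 * i < 2" by simp
    then show ?thesis using 2
      by (simp add: num_SkYT_removed_def uniform_coeff_def removal_coeff_def SkYT_removed_def SkYT_eq_empty Let_def)
  next
    case 3
    note p = peak_shape_params[OF 3]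
    have "int (card (SkYT (l + 2) i (d + 1 - 2 * i))) = int (card (SkYT_removed \<rho> (l + 1) d i)) + int \<rho> * removal_coeff d i"
      using peak_shape.card_SkYT_complement[OF p(1) assms(1), of "d - 1 - 2 * i"] 3
      unfolding p(2,4) p(3)[symmetric] by (simp add: removal_coeff_def)
    then show ?thesis using 3 by (simp add: num_SkYT_removed_def uniform_coeff_def)
  qed
qed

lemma uniform_coeff_eq_0: "1 \<le> d \<Longrightarrow> d \<le> 2 * i \<Longrightarrow> uniform_coeff l d i = 0"
  by (simp add: uniform_coeff_def SkYT_eq_empty)

lemma removal_coeff_eq_0: "1 \<le> d \<Longrightarrow> d \<le> 2 * i \<Longrightarrow> removal_coeff d i = 0"
  by (auto simp: removal_coeff_def)

definition coeff_poly :: "nat \<Rightarrow> (nat \<Rightarrow> int) \<Rightarrow> int poly" where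
  "coeff_poly d f = (\<Sum>i\<in>{i. 2 * i < d}. monom (f i) i)"

lemma coeff_coeff_poly: "coeff (coeff_poly d f) i = (if 2 * i < d then f i else 0)"
  by (simp add: coeff_poly_def coeff_sum finite_half sum.delta')

lemma degree_coeff_poly: "1 \<le> d \<Longrightarrow> 2 * degree (coeff_poly d f) < d"
  by (subst degree_half_iff) (auto simp: coeff_coeff_poly)

text \<open>The contribution of one flat of rank \<open>f\<close> to the coefficient of $t^j$ in
  \<open>kl_defect\<close>, if its contraction has the coefficients \<open>u\<close>.\<close>

definition Zcoeff :: "(nat \<Rightarrow> int) \<Rightarrow> nat \<Rightarrow> nat \<Rightarrow> nat \<Rightarrow> int" where
  "Zcoeff u d f j = coeff (monom 1 f * coeff_poly (d - f) u) j - coeff (reverse_poly (d - f) (coeff_poly (d - f) u)) j"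

lemma Zcoeff_linear: "Zcoeff (\<lambda>i. u i - c * w i) d f j = Zcoeff u d f j - c * Zcoeff w d f j"
  by (auto simp: Zcoeff_def coeff_monom_mult coeff_reverse_poly coeff_coeff_poly algebra_simps)

text \<open>With e = d - f, the coefficient of $t^j$ in $t^f P_e$ has index e - (d - j), and in the
  reversed polynomial e - j; these are the indices in \<open>Zpart\<close> at d - j and at
  j.\<close>

lemma sum_Zcoeff:
  assumes u: "\<And>e i. 1 \<le> e \<Longrightarrow> e \<le> 2 * i \<Longrightarrow> u e i = 0" and d: "1 \<le> d" and j: "j \<le> d"
  shows "real_of_int (\<Sum>f<d. int (n choose f) * Zcoeff (u (d - f)) d f j) =
    Zpart (\<lambda>e i. real_of_int (u e i)) n d (d - j) - Zpart (\<lambda>e i. real_of_int (u e i)) n d j"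
proof -
  let ?c = "\<lambda>e i. real_of_int (u e i)"
  have co: "coeff (coeff_poly e (u e)) i = u e i" if "1 \<le> e" for e i
    using u[OF that, of i] by (auto simp: coeff_coeff_poly)
  have Z: "real_of_int (Zcoeff (u e) d (d - e) j) =
      (if d - j \<le> e then ?c e (e - (d - j)) else 0) - (if j \<le> e then ?c e (e - j) else 0)"
    if "1 \<le> e" "e \<le> d" for e
  proof -
    have "d - (d - e) = e" "j < d - e \<longleftrightarrow> \<not> d - j \<le> e" using that j by auto
    moreover have "j - (d - e) = e - (d - j)" using that j by auto
    ultimately show ?thesis
      using that by (simp add: Zcoeff_def coeff_monom_mult coeff_reverse_poly co)
  qed
  have P: "Zpart ?c n d k = (\<Sum>e\<in>{1..d}. real (n choose (d - e)) * (if k \<le> e then ?c e (e - k) else 0))" for k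
    unfolding Zpart_def by (rule sum.mono_neutral_cong_left) auto
  have "real_of_int (\<Sum>f<d. int (n choose f) * Zcoeff (u (d - f)) d f j) =
     (\<Sum>e\<in>{1..d}. real (n choose (d - e)) * real_of_int (Zcoeff (u e) d (d - e) j))"
    unfolding of_int_sum
    by (rule sum.reindex_bij_witness[of _ "\<lambda>e. d - e" "\<lambda>f. d - f"]) auto
  also have "\<dots> = (\<Sum>e\<in>{1..d}. real (n choose (d - e)) * (if d - j \<le> e then ?c e (e - (d - j)) else 0)
      - real (n choose (d - e)) * (if j \<le> e then ?c e (e - j) else 0))"
    by (rule sum.cong) (simp_all only: Z right_diff_distrib atLeastAtMost_iff)
  finally show ?thesis unfolding P sum_subtractf .
qed

lemma Zpart_cong: "(\<And>e i. 1 \<le> e \<Longrightarrow> c e i = c' e i) \<Longrightarrow> Zpart c n d j = Zpart c' n d j"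
  unfolding Zpart_def by (rule sum.cong) auto

lemma sum_Zcoeff_uniform:
  assumes "1 \<le> d" "j \<le> d"
  shows "(\<Sum>f<d. int (l + 1 + d choose f) * Zcoeff (uniform_coeff l (d - f)) d f j) =
    (if j = 0 then 1 else 0) - (if j = d then 1 else 0)"
proof -
  have "real_of_int (\<Sum>f<d. int (l + 1 + d choose f) * Zcoeff (uniform_coeff l (d - f)) d f j) =
     Zpart (cU l) (l + 1 + d) d (d - j) - Zpart (cU l) (l + 1 + d) d j"
    by (subst sum_Zcoeff) (use assms uniform_coeff_eq_0 in \<open>auto simp: real_uniform_coeff cong: Zpart_cong\<close>)
  also have "\<dots> = real_of_int ((if j = 0 then 1 else 0) - (if j = d then 1 else 0))"
  proof -
    have "Zpart (cU l) (l + 1 + d) d (d - j) - Zpart (cU l) (l + 1 + d) d j =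
       - (Zpart (cU l) (l + 1 + d) d j - Zpart (cU l) (l + 1 + d) d (d - j))" by simp
    then show ?thesis unfolding Zpart_cU_antisymmetric[OF assms(2,1)] by simp
  qed
  finally show ?thesis by (simp only: of_int_eq_iff)
qed

lemma sum_Zcoeff_removal:
  assumes "2 \<le> d" "j \<le> d"
  shows "(\<Sum>f<d. int (d choose f) * Zcoeff (removal_coeff (d - f)) d f j) =
    (if j = d - 1 then 1 else 0) - (if j = 1 then 1 else 0)"
proof -
  have "real_of_int (\<Sum>f<d. int (d choose f) * Zcoeff (removal_coeff (d - f)) d f j) =
     Zpart cD d d (d - j) - Zpart cD d d j"
    by (subst sum_Zcoeff) (use assms removal_coeff_eq_0 in \<open>auto simp: real_removal_coeff\<close>)
  also have "\<dots> = real_of_int ((if j = d - 1 then 1 else 0) - (if j = 1 then 1 else 0))"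
  proof -
    have "Zpart cD d d (d - j) - Zpart cD d d j = - (Zpart cD d d j - Zpart cD d d (d - j))" by simp
    then show ?thesis unfolding Zpart_cD_antisymmetric[OF assms(2,1)] by simp
  qed
  finally show ?thesis by (simp only: of_int_eq_iff)
qed

section \<open>Removed uniform matroids on an arbitrary ground set\<close>

lemma (in matroid_structure) flat_eq_ground: "F \<in> flats M \<Longrightarrow> r F = rk M \<Longrightarrow> F = E"
proof (rule ccontr)
  assume F: "F \<in> flats M" "r F = rk M" "F \<noteq> E"
  then obtain x where "x \<in> E - F" using flats_subset by blast
  then have "r F < r (insert x F)" using F(1) by (simp add: flats_def)
  also have "r (insert x F) \<le> rk M" using \<open>x \<in> E - F\<close> flats_subset[OF F(1)] by (intro rank_le_rk) auto
  finally show False using F by simp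
qed

lemma (in matroid_structure) KL_contraction_ground: "KL (contraction M E) = 1"
proof -
  interpret N: matroid_structure "contraction M E" by unfold_locales (rule is_matroid_contraction)
  show ?thesis by (rule N.KL_rank_0) (simp add: rk_contraction, simp add: rk_def)
qed

lemma (in matroid_structure) KL_rank_1:
  assumes "rk M = 1"
  shows "KL M = 1"
proof -
  have "{F \<in> flats M. 0 < r F} = {E}"
  proof (intro equalityI subsetI)
    fix F assume "F \<in> {F \<in> flats M. 0 < r F}"
    moreover then have "r F \<le> rk M" by (intro rank_le_rk flats_subset) auto
    ultimately show "F \<in> {E}" using flat_eq_ground[of F] assms by auto
  qed (use ground_flat assms in \<open>auto simp: rk_def\<close>)
  then have "kl_defect KL = monom 1 1 - 1"
    using assms by (simp add: kl_defect_def KL_contraction_ground rk_def reverse_poly_def)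
  then have "KL M = - truncate_half 1 (monom 1 1 - 1)" using KL_pos assms by simp
  also have "\<dots> = 1"
    by (intro poly_eqI) (auto simp: coeff_truncate_half coeff_1)
  finally show ?thesis .
qed

lemma sum_by_card:
  assumes "finite A"
  shows "(\<Sum>F | F \<subseteq> A \<and> 1 \<le> card F \<and> card F < d. h (card F)) = (\<Sum>f\<in>{1..<d}. int (card A choose f) * (h f :: int))"
proof -
  have "{F. F \<subseteq> A \<and> 1 \<le> card F \<and> card F < d} = (\<Union>f\<in>{1..<d}. {F. F \<subseteq> A \<and> card F = f})" by auto
  then have "(\<Sum>F | F \<subseteq> A \<and> 1 \<le> card F \<and> card F < d. h (card F)) = (\<Sum>f\<in>{1..<d}. \<Sum>F | F \<subseteq> A \<and> card F = f. h (card F))"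
    using assms by (simp only:) (subst sum.UNION_disjoint, auto)
  also have "\<dots> = (\<Sum>f\<in>{1..<d}. int (card A choose f) * h f)"
    by (rule sum.cong[OF refl]) (simp add: n_subsets[OF assms])
  finally show ?thesis .
qed

text \<open>Contractions live on the complement of a flat, so the induction needs arbitrary ground
  sets instead of initial segments.\<close>

definition removed_uniform_on :: "'a set \<Rightarrow> nat \<Rightarrow> 'a set set \<Rightarrow> 'a matroid" where
  "removed_uniform_on E d R = matroid_of_bases E ({B. B \<subseteq> E \<and> card B = d} - R)"

text \<open>\<open>l\<close> is invariant under contraction at an independent set: the size of the
  ground set and the rank drop equally. Rank at least 2 makes the common part of two neighbouring
  \<open>d\<close>-sets nonempty, so that disjointness can bite.\<close>

locale removed_uniform_structure =
  fixes E :: "'a set" and d l :: nat and R :: "'a set set"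
  assumes finite_E: "finite E" and card_E: "card E = l + 1 + d" and d_pos: "1 \<le> d"
    and R_subset: "R \<subseteq> {B. B \<subseteq> E \<and> card B = d}" and R_disjoint: "pairwise disjnt R"
    and R_rank: "R \<noteq> {} \<Longrightarrow> 2 \<le> d"
begin

definition "M = removed_uniform_on E d R"

lemma ground_M: "ground M = E"
  by (simp add: M_def removed_uniform_on_def matroid_of_bases_def)

lemma R_meet: "B \<in> R \<Longrightarrow> B' \<in> R \<Longrightarrow> x \<in> B \<Longrightarrow> x \<in> B' \<Longrightarrow> B = B'"
  using R_disjoint by (auto simp: pairwise_def disjnt_def)

lemma finite_R: "finite R"
  by (rule finite_subset[OF R_subset]) (use finite_E in auto)

text \<open>A (d-1)-set \<open>C\<close> above \<open>X\<close> has at least two extensions inside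
  \<open>A\<close>; these meet in the nonempty \<open>C\<close>, so not both of them are
  removed.\<close>

lemma basis_between:
  assumes "A \<subseteq> E" "d < card A" "X \<subseteq> A" "card X < d"
  obtains B where "X \<subseteq> B" "B \<subseteq> A" "card B = d" "B \<notin> R"
proof -
  have fA: "finite A" using assms finite_E finite_subset by blast
  have "card X \<le> d - 1" "d - 1 \<le> card A" using assms d_pos by auto
  then obtain C where C: "X \<subseteq> C" "C \<subseteq> A" "card C = d - 1"
    using exists_subset_between[of X "d - 1" A] assms(3) fA by blast
  have fC: "finite C" using C fA finite_subset by blast
  have "2 \<le> card (A - C)" using C assms d_pos fC by (simp add: card_Diff_subset)
  then obtain D where "D \<subseteq> A - C" "card D = 2" by (rule obtain_subset_with_card_n)
  then obtain x y where xy: "x \<in> A - C" "y \<in> A - C" "x \<noteq> y"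
    by (auto simp: card_2_iff)
  have "insert x C \<notin> R \<or> insert y C \<notin> R"
  proof (rule ccontr)
    assume "\<not> ?thesis"
    then have R: "insert x C \<in> R" "insert y C \<in> R" by auto
    then have "C \<noteq> {}" using R_rank C by (cases "C = {}") auto
    then have "insert x C = insert y C" using R_meet[OF R] by blast
    then show False using xy by auto
  qed
  then obtain z where "z \<in> A - C" "insert z C \<notin> R" using xy by auto
  then show ?thesis using that[of "insert z C"] C fC d_pos by auto
qed

lemma indep_M_iff: "I \<in> indep M \<longleftrightarrow> I \<subseteq> E \<and> card I \<le> d \<and> I \<notin> R"
proof
  assume "I \<in> indep M"
  then obtain B where B: "B \<subseteq> E" "card B = d" "B \<notin> R" "I \<subseteq> B"
    by (auto simp: M_def removed_uniform_on_def matroid_of_bases_def)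
  then have fB: "finite B" using finite_E finite_subset by blast
  have "I = B" if "I \<in> R" using card_subset_eq[OF fB B(4)] that R_subset B by auto
  then show "I \<subseteq> E \<and> card I \<le> d \<and> I \<notin> R" using B card_mono[OF fB B(4)] by auto
next
  assume I: "I \<subseteq> E \<and> card I \<le> d \<and> I \<notin> R"
  have "\<exists>B. B \<subseteq> E \<and> card B = d \<and> B \<notin> R \<and> I \<subseteq> B"
  proof (cases "card I = d")
    case False
    then obtain B where "I \<subseteq> B" "B \<subseteq> E" "card B = d" "B \<notin> R"
      using basis_between[of E I] I card_E by auto
    then show ?thesis by blast
  qed (use I in auto)
  then show "I \<in> indep M" by (auto simp: M_def removed_uniform_on_def matroid_of_bases_def)
qed

lemma is_matroid_M: "is_matroid M"
  unfolding is_matroid_def ground_M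
proof (intro conjI ballI allI impI)
  show "finite E" by (rule finite_E)
  show "{} \<in> indep M" using R_subset d_pos by (auto simp: indep_M_iff)
next
  fix I assume "I \<in> indep M" then show "I \<subseteq> E" by (simp add: indep_M_iff)
next
  fix I J assume I: "I \<in> indep M" and J: "J \<subseteq> I"
  have fI: "finite I" using I finite_E finite_subset by (auto simp: indep_M_iff)
  have "J = I" if "J \<in> R"
    using card_seteq[OF fI J] that R_subset I by (auto simp: indep_M_iff)
  then show "J \<in> indep M" using I J card_mono[OF fI J] by (auto simp: indep_M_iff)
next
  fix I J assume I: "I \<in> indep M" and J: "J \<in> indep M" and less: "card J < card I"
  have fI: "finite I" and fJ: "finite J" using I J finite_E finite_subset by (auto simp: indep_M_iff)
  show "\<exists>x\<in>I - J. insert x J \<in> indep M"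
  proof (rule ccontr)
    \<comment> \<open>All extensions of \<open>J\<close> by elements of \<open>I\<close> would be
      removed bases through the nonempty \<open>J\<close>, hence equal; then \<open>I\<close> would
      itself be that removed basis.\<close>
    assume "\<not> ?thesis"
    then have bad: "insert x J \<in> R" if "x \<in> I - J" for x
      using that I J less fJ by (auto simp: indep_M_iff)
    have "\<not> I \<subseteq> J" using less card_mono[OF fJ, of I] by auto
    then obtain x where x: "x \<in> I - J" by auto
    have "J \<noteq> {}"
    proof
      assume "J = {}"
      then have "{x} \<in> R" using bad[OF x] by simp
      then show False using R_rank R_subset by fastforce
    qed
    have "I - J \<subseteq> {x}"
    proof
      fix y assume y: "y \<in> I - J"
      have "insert x J = insert y J" using R_meet[OF bad[OF x] bad[OF y]] \<open>J \<noteq> {}\<close> by blast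
      then show "y \<in> {x}" using x y by auto
    qed
    then have "I \<subseteq> insert x J" by auto
    moreover have "card (insert x J) \<le> card I" using less x fJ by simp
    ultimately have "I = insert x J" using card_seteq[of "insert x J" I] fJ by auto
    then show False using bad[OF x] I by (simp add: indep_M_iff)
  qed
qed

sublocale matroid_structure M
  rewrites "ground M = E"
  by unfold_locales (rule is_matroid_M, rule ground_M)

lemma rank_M: "A \<subseteq> E \<Longrightarrow> rk_of M A = (if A \<in> R then d - 1 else min (card A) d)"
proof -
  assume A: "A \<subseteq> E"
  have fA: "finite A" using A finite_E finite_subset by blast
  consider "A \<in> R" | "A \<notin> R" "card A \<le> d" | "A \<notin> R" "d < card A" by linarith
  then show ?thesis
  proof cases
    case 1
    then have cA: "card A = d" using R_subset by auto
    then obtain x where "x \<in> A" using d_pos by (metis card.empty ex_in_conv not_one_le_zero)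
    then have "A - {x} \<in> indep M" "card (A - {x}) = d - 1"
      using A cA fA R_subset d_pos by (auto simp: indep_M_iff)
    then have "d - 1 \<le> rk_of M A" using card_le_rank[of "A - {x}" A] by auto
    moreover have "rk_of M A \<noteq> d" using indep_iff_rank[of A] 1 cA A by (simp add: indep_M_iff)
    moreover have "rk_of M A \<le> d" using rank_le_card[OF fA] cA by simp
    ultimately show ?thesis using 1 by auto
  next
    case 2
    then have "A \<in> indep M" using A by (simp add: indep_M_iff)
    then show ?thesis using indep_iff_rank[of A] 2 by simp
  next
    case 3
    obtain B where B: "B \<subseteq> A" "card B = d" "B \<notin> R" using basis_between[of A "{}"] A 3 d_pos by auto
    then have "B \<in> indep M" using A by (auto simp: indep_M_iff)
    then have "d \<le> rk_of M A" using card_le_rank[of B A] B by auto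
    moreover obtain I where "I \<in> indep M" "card I = rk_of M A" by (rule rank_attained)
    ultimately show ?thesis using 3 by (auto simp: indep_M_iff)
  qed
qed

lemma E_notin_R: "E \<notin> R"
  using R_subset card_E by auto

lemma rk_M: "rk M = d"
  using rank_M[of E] E_notin_R card_E by (simp add: rk_def ground_M)

text \<open>A removed basis is a circuit of rank d - 1 and a flat; it is the closure of each of its
  (d-1)-subsets, which therefore are not flats.\<close>

lemma flats_M_iff:
  "F \<in> flats M \<longleftrightarrow> F = E \<or> F \<in> R \<or> F \<subseteq> E \<and> card F < d \<and> \<not> (card F = d - 1 \<and> (\<exists>B\<in>R. F \<subseteq> B))"
proof (cases "F \<subseteq> E \<and> F \<noteq> E \<and> F \<notin> R")
  case False
  moreover have "F \<in> flats M" if "F \<in> R"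
  proof -
    have F: "F \<subseteq> E" "card F = d" using that R_subset by auto
    have "finite F" using F finite_E finite_subset by blast
    have "rk_of M F < rk_of M (insert x F)" if x: "x \<in> E - F" for x
    proof -
      have "card (insert x F) = d + 1" using x F \<open>finite F\<close> by simp
      moreover from this have "insert x F \<notin> R" using R_subset by auto
      moreover have "rk_of M F = d - 1" using rank_M[of F] F \<open>F \<in> R\<close> by simp
      ultimately show ?thesis using rank_M[of "insert x F"] F x d_pos by simp
    qed
    then show ?thesis using F by (auto simp: flats_def ground_M)
  qed
  ultimately show ?thesis using ground_flat flats_subset by blast
next
  case True
  then have F: "F \<subseteq> E" "F \<noteq> E" "F \<notin> R" "finite F" using finite_E finite_subset by auto
  have ins: "rk_of M F < rk_of M (insert x F) \<longleftrightarrow> card F < d \<and> insert x F \<notin> R" if x: "x \<in> E - F" for x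
  proof -
    have c: "card (insert x F) = card F + 1" using x F by simp
    have "insert x F \<in> R \<Longrightarrow> card F + 1 = d" using c R_subset by auto
    then show ?thesis using rank_M[of F] rank_M[of "insert x F"] F x c by auto
  qed
  have "F \<in> flats M \<longleftrightarrow> (\<forall>x\<in>E - F. card F < d \<and> insert x F \<notin> R)"
    using F ins by (auto simp: flats_def ground_M)
  also have "\<dots> \<longleftrightarrow> card F < d \<and> (\<forall>x\<in>E - F. insert x F \<notin> R)" using F by auto
  also have "\<dots> \<longleftrightarrow> card F < d \<and> \<not> (card F = d - 1 \<and> (\<exists>B\<in>R. F \<subseteq> B))"
  proof -
    have "(\<exists>x\<in>E - F. insert x F \<in> R) \<longleftrightarrow> card F = d - 1 \<and> (\<exists>B\<in>R. F \<subseteq> B)" if "card F < d"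
    proof
      assume "\<exists>x\<in>E - F. insert x F \<in> R"
      then obtain x where x: "x \<in> E - F" "insert x F \<in> R" by auto
      then have "card (insert x F) = d" using R_subset by auto
      then show "card F = d - 1 \<and> (\<exists>B\<in>R. F \<subseteq> B)" using x F by auto
    next
      assume "card F = d - 1 \<and> (\<exists>B\<in>R. F \<subseteq> B)"
      then obtain B where B: "B \<in> R" "F \<subseteq> B" "card F = d - 1" by auto
      then have cB: "card B = d" "B \<subseteq> E" using R_subset by auto
      then have "card (B - F) = 1" using B F d_pos by (simp add: card_Diff_subset)
      then obtain x where "B - F = {x}" by (auto simp: card_1_singleton_iff)
      then have "insert x F = B" "x \<in> E - F" using B cB by auto
      then show "\<exists>x\<in>E - F. insert x F \<in> R" using B by auto
    qed
    then show ?thesis by blast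
  qed
  finally show ?thesis using F by auto
qed

text \<open>The third assumption keeps the class stable: if a removed basis survives the
  contraction, the remaining rank is at least 2.\<close>

lemma contraction_M:
  assumes F: "F \<subseteq> E" "card F < d" "\<not> (card F = d - 1 \<and> (\<exists>B\<in>R. F \<subseteq> B))"
  defines "R' \<equiv> (\<lambda>B. B - F) ` {B \<in> R. F \<subseteq> B}"
  shows "removed_uniform_structure (E - F) (d - card F) l R'"
    and "contraction M F = removed_uniform_on (E - F) (d - card F) R'"
proof -
  have fF: "finite F" using F finite_E finite_subset by blast
  have cardR: "card (B - F) = d - card F" "B \<subseteq> E" if "B \<in> R" "F \<subseteq> B" for B
    using that R_subset fF by (auto simp: card_Diff_subset)
  show struct: "removed_uniform_structure (E - F) (d - card F) l R'"
  proof
    show "finite (E - F)" using finite_E by simp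
    show "card (E - F) = l + 1 + (d - card F)" using F fF card_E by (simp add: card_Diff_subset)
    show "1 \<le> d - card F" using F by simp
    show "R' \<subseteq> {B. B \<subseteq> E - F \<and> card B = d - card F}" using cardR by (auto simp: R'_def)
    show "pairwise disjnt R'"
      using R_meet unfolding pairwise_def disjnt_def R'_def by blast
    show "2 \<le> d - card F" if "R' \<noteq> {}" using that F by (auto simp: R'_def)
  qed
  interpret C: removed_uniform_structure "E - F" "d - card F" l R' by (rule struct)
  show "contraction M F = removed_uniform_on (E - F) (d - card F) R'"
    unfolding C.M_def[symmetric]
  proof (rule matroid.expand, intro conjI)
    show "ground (contraction M F) = ground C.M" by (simp add: ground_contraction C.ground_M)
    have "I \<in> indep (contraction M F) \<longleftrightarrow> I \<in> indep C.M" if I: "I \<subseteq> E - F" for I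
    proof -
      have fI: "finite I" using I finite_E finite_subset by blast
      have c: "card (I \<union> F) = card I + card F" using I fI fF by (intro card_Un_disjoint) auto
      have "F \<notin> R" using F R_subset by auto
      then have rF: "rk_of M F = card F" using rank_M[OF F(1)] F by simp
      have "I \<union> F \<in> R \<longleftrightarrow> I \<in> R'"
      proof
        assume "I \<union> F \<in> R"
        moreover have "I = (I \<union> F) - F" using I by auto
        ultimately show "I \<in> R'" unfolding R'_def by blast
      next
        assume "I \<in> R'"
        then obtain B where "B \<in> R" "F \<subseteq> B" "I = B - F" by (auto simp: R'_def)
        moreover then have "I \<union> F = B" by auto
        ultimately show "I \<union> F \<in> R" by simp
      qed
      moreover have "I \<in> indep (contraction M F) \<longleftrightarrow> I \<union> F \<in> indep M"
        using I F indep_contraction_iff[of I F] indep_iff_rank[of "I \<union> F"] rF c by auto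
      ultimately show ?thesis using I F c by (auto simp: indep_M_iff C.indep_M_iff)
    qed
    moreover have "I \<subseteq> E - F" if "I \<in> indep (contraction M F) \<or> I \<in> indep C.M" for I
      using that indep_contraction_iff[of I F] C.indep_M_iff by blast
    ultimately show "indep (contraction M F) = indep C.M" by blast
  qed
qed

lemma positive_flats:
  "{F \<in> flats M. 0 < rk_of M F} =
    {F. F \<subseteq> E \<and> 1 \<le> card F \<and> card F < d \<and> \<not> (card F = d - 1 \<and> (\<exists>B\<in>R. F \<subseteq> B))} \<union> R \<union> {E}"
    (is "?L = ?S \<union> R \<union> {E}")
proof -
  have "F \<in> ?L \<longleftrightarrow> F \<in> ?S \<or> F \<in> R \<or> F = E" for F
  proof -
    consider "F = E" | "F \<in> R" "F \<noteq> E" | "F \<subseteq> E" "card F < d" "F \<notin> R" "F \<noteq> E" | "F \<notin> flats M" "F \<notin> ?S" "F \<notin> R" "F \<noteq> E"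
      by (auto simp: flats_M_iff)
    then show ?thesis
    proof cases
      case 1
      then show ?thesis using rk_M d_pos by (auto simp: flats_M_iff rk_def ground_M)
    next
      case 2
      have "F \<subseteq> E" using 2 R_subset by auto
      moreover have "2 \<le> d" using 2 by (intro R_rank) auto
      ultimately have "0 < rk_of M F" using rank_M[of F] 2 by simp
      then show ?thesis using 2 by (auto simp: flats_M_iff)
    next
      case 3
      then have "rk_of M F = card F" using rank_M[of F] by simp
      then show ?thesis using 3 by (auto simp: flats_M_iff)
    qed auto
  qed
  then show ?thesis by blast
qed

text \<open>For nonempty \<open>F\<close> this is the number of removed bases that survive in the
  contraction, by disjointness at most one.\<close>

definition "below F = (if \<exists>B\<in>R. F \<subseteq> B then 1 else 0 :: int)"

lemma card_contracted_R:
  assumes "F \<noteq> {}"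
  shows "int (card ((\<lambda>B. B - F) ` {B \<in> R. F \<subseteq> B})) = below F"
proof (cases "\<exists>B\<in>R. F \<subseteq> B")
  case True
  then obtain B where B: "B \<in> R" "F \<subseteq> B" by auto
  have "{B \<in> R. F \<subseteq> B} = {B}" using B R_meet assms by blast
  then show ?thesis using B by (auto simp: below_def)
next
  case False
  then have "{B \<in> R. F \<subseteq> B} = {}" by auto
  then show ?thesis using False by (simp only: below_def image_empty) simp
qed

text \<open>A nonempty set lies in at most one removed basis, so the sum splits over the bases, each
  of which has \<open>d\<close> elements.\<close>

lemma sum_below:
  "(\<Sum>F | F \<subseteq> E \<and> 1 \<le> card F \<and> card F < d. below F * w (card F)) =
    int (card R) * (\<Sum>f\<in>{1..<d}. int (d choose f) * w f)"
proof -
  let ?S = "{F. F \<subseteq> E \<and> 1 \<le> card F \<and> card F < d}"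
  let ?T = "\<lambda>B. {F. F \<subseteq> B \<and> 1 \<le> card F \<and> card F < d}"
  have finB: "finite B" "B \<subseteq> E" "card B = d" if "B \<in> R" for B
    using that R_subset finite_subset[OF _ finite_E, of B] by auto
  have "(\<Sum>F\<in>?S. below F * w (card F)) = (\<Sum>F\<in>(\<Union>B\<in>R. ?T B). w (card F))"
  proof (rule sum.mono_neutral_cong_right)
    show "finite ?S" using finite_E by simp
    show "(\<Union>B\<in>R. ?T B) \<subseteq> ?S" using finB by blast
    show "\<forall>F\<in>?S - (\<Union>B\<in>R. ?T B). below F * w (card F) = 0" by (auto simp: below_def)
    show "below F * w (card F) = w (card F)" if "F \<in> (\<Union>B\<in>R. ?T B)" for F
      using that by (auto simp: below_def)
  qed
  also have "\<dots> = (\<Sum>B\<in>R. \<Sum>F\<in>?T B. w (card F))"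
  proof (rule sum.UNION_disjoint[OF finite_R])
    show "\<forall>B\<in>R. finite (?T B)" using finB by auto
    show "\<forall>B\<in>R. \<forall>B'\<in>R. B \<noteq> B' \<longrightarrow> ?T B \<inter> ?T B' = {}"
    proof (intro ballI impI)
      fix B B' assume B: "B \<in> R" "B' \<in> R" "B \<noteq> B'"
      have False if "F \<in> ?T B" "F \<in> ?T B'" for F
      proof -
        have "F \<noteq> {}" using that by auto
        then show False using that R_meet[OF B(1,2)] B(3) by blast
      qed
      then show "?T B \<inter> ?T B' = {}" by blast
    qed
  qed
  also have "\<dots> = (\<Sum>B\<in>R. \<Sum>f\<in>{1..<d}. int (d choose f) * w f)"
  proof (rule sum.cong[OF refl])
    fix B assume B: "B \<in> R"
    show "(\<Sum>F\<in>?T B. w (card F)) = (\<Sum>f\<in>{1..<d}. int (d choose f) * w f)"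
      using sum_by_card[OF finB(1)[OF B], where h = w and d = d] by (simp only: finB(3)[OF B])
  qed
  finally show ?thesis by simp
qed

text \<open>The inductive step of the main computation: if all proper contractions have the expected
  coefficients, the conjectured polynomial of \<open>M\<close> satisfies the recursion.\<close>

lemma coeff_kl_defect:
  assumes IH: "\<And>F. F \<subseteq> E \<Longrightarrow> 1 \<le> card F \<Longrightarrow> card F < d \<Longrightarrow> \<not> (card F = d - 1 \<and> (\<exists>B\<in>R. F \<subseteq> B)) \<Longrightarrow>
      KL (contraction M F) = coeff_poly (d - card F) (\<lambda>i. uniform_coeff l (d - card F) i - below F * removal_coeff (d - card F) i)"
    and j: "j \<le> d"
  shows "coeff (kl_defect KL) j = - Zcoeff (\<lambda>i. uniform_coeff l d i - int (card R) * removal_coeff d i) d 0 j"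
proof -
  define h where "h f = Zcoeff (uniform_coeff l (d - f)) d f j" for f
  define w where "w f = Zcoeff (removal_coeff (d - f)) d f j" for f
  define g where "g F = coeff (monom 1 (rk_of M F) * KL (contraction M F)) j
     - coeff (reverse_poly (d - rk_of M F) (KL (contraction M F))) j" for F
  let ?good = "{F. F \<subseteq> E \<and> 1 \<le> card F \<and> card F < d \<and> \<not> (card F = d - 1 \<and> (\<exists>B\<in>R. F \<subseteq> B))}"
  let ?S = "{F. F \<subseteq> E \<and> 1 \<le> card F \<and> card F < d}"
  have fS: "finite ?S" using finite_E by simp
  have g_good: "g F = h (card F) - below F * w (card F)" if F: "F \<in> ?good" for F
  proof -
    have "F \<notin> R" using F R_subset by auto
    then have "rk_of M F = card F" using rank_M[of F] F by auto
    moreover have "KL (contraction M F) = coeff_poly (d - card F) (\<lambda>i. uniform_coeff l (d - card F) i - below F * removal_coeff (d - card F) i)"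
      using IH[of F] F by blast
    ultimately show ?thesis by (simp only: g_def h_def w_def flip: Zcoeff_linear) (simp only: Zcoeff_def)
  qed
  \<comment> \<open>A (d-1)-subset of a removed basis is not a flat, but its formal term is 0
    because the coefficients of the two kinds agree in rank 1, by the junk value. So the sum may run
    over all small sets.\<close>
  have h_bad: "h (card F) - below F * w (card F) = 0" if "F \<in> ?S - ?good" for F
  proof -
    have c: "d - card F = 1" and b: "below F = 1" using that d_pos by (auto simp: below_def)
    have "coeff_poly 1 (uniform_coeff l 1) = coeff_poly 1 (removal_coeff 1)"
      by (intro poly_eqI) (auto simp: coeff_coeff_poly uniform_coeff_def removal_coeff_def)
    then show ?thesis by (simp add: h_def w_def c b Zcoeff_def)
  qed
  have "(\<Sum>F\<in>?good. g F) = (\<Sum>F\<in>?good. h (card F) - below F * w (card F))"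
    by (rule sum.cong[OF refl g_good])
  also have "\<dots> = (\<Sum>F\<in>?S. h (card F) - below F * w (card F))"
    by (rule sum.mono_neutral_left[OF fS]) (use h_bad in auto)
  also have "\<dots> = (\<Sum>f\<in>{1..<d}. int (l + 1 + d choose f) * h f) - int (card R) * (\<Sum>f\<in>{1..<d}. int (d choose f) * w f)"
    unfolding sum_subtractf sum_below sum_by_card[OF finite_E] card_E ..
  finally have good: "(\<Sum>F\<in>?good. g F) =
    (\<Sum>f\<in>{1..<d}. int (l + 1 + d choose f) * h f) - int (card R) * (\<Sum>f\<in>{1..<d}. int (d choose f) * w f)" .
  have g_R: "g B = (if j = d - 1 then 1 else 0) - (if j = 1 then 1 else 0)" if B: "B \<in> R" for B
  proof -
    have BE: "B \<subseteq> E" using B R_subset by auto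
    have r: "rk_of M B = d - 1" using rank_M[OF BE] B by simp
    have d: "d - (d - 1) = 1" using d_pos by linarith
    interpret N: matroid_structure "contraction M B" by unfold_locales (rule is_matroid_contraction)
    have "rk (contraction M B) = 1" using rk_contraction[OF BE] unfolding rk_M r d .
    then have "KL (contraction M B) = 1" by (rule N.KL_rank_1)
    then show ?thesis unfolding g_def r d by (auto simp: coeff_reverse_poly coeff_1)
  qed
  have g_E: "g E = (if j = d then 1 else 0) - (if j = 0 then 1 else 0)"
  proof -
    have "rk_of M E = d" using rk_M by (simp add: rk_def ground_M)
    then show ?thesis using KL_contraction_ground by (auto simp: g_def coeff_reverse_poly coeff_1)
  qed
  have "coeff (kl_defect KL) j = (\<Sum>F\<in>{F \<in> flats M. 0 < rk_of M F}. g F)"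
    by (simp add: kl_defect_def coeff_sum g_def rk_M)
  also have "\<dots> = (\<Sum>F\<in>?good. g F) + (\<Sum>B\<in>R. g B) + g E"
  proof -
    have "finite ?good" by (rule finite_subset[OF _ fS]) auto
    moreover have "?good \<inter> R = {}" using R_subset by auto
    moreover have "E \<notin> ?good \<union> R" using E_notin_R card_E by auto
    ultimately show ?thesis unfolding positive_flats
      using finite_R by (simp add: sum.union_disjoint)
  qed
  finally have eq: "coeff (kl_defect KL) j =
    (\<Sum>f\<in>{1..<d}. int (l + 1 + d choose f) * h f) - int (card R) * (\<Sum>f\<in>{1..<d}. int (d choose f) * w f)
     + int (card R) * ((if j = d - 1 then 1 else 0) - (if j = 1 then 1 else 0)) + ((if j = d then 1 else 0) - (if j = 0 then 1 else 0))"
    unfolding good g_E by (simp add: g_R)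
  have ins: "{..<d} = insert 0 {1..<d}" using d_pos by auto
  \<comment> \<open>Completed by f = 0, both sums are given by the palindromicity identities, whose
    right sides cancel against the flats \<open>E\<close> and \<open>B\<close>; only the terms with
    f = 0 remain.\<close>
  have U: "h 0 + (\<Sum>f\<in>{1..<d}. int (l + 1 + d choose f) * h f) = (if j = 0 then 1 else 0) - (if j = d then 1 else 0)"
    using sum_Zcoeff_uniform[OF d_pos j, of l] unfolding ins h_def by simp
  have D: "int (card R) * (w 0 + (\<Sum>f\<in>{1..<d}. int (d choose f) * w f)) =
      int (card R) * ((if j = d - 1 then 1 else 0) - (if j = 1 then 1 else 0))"
  proof (cases "R = {}")
    case False
    then show ?thesis using sum_Zcoeff_removal[OF R_rank j] unfolding ins w_def by simp
  qed simp
  have "coeff (kl_defect KL) j = - (h 0 - int (card R) * w 0)"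
    using eq U D by (simp only: distrib_left)
  then show ?thesis unfolding Zcoeff_linear h_def w_def by simp
qed

end

text \<open>Strong induction on the rank with \<open>l\<close> fixed; \<open>KL_eqI\<close>
  identifies the polynomial from its degree bound and the palindromic recursion, without
  characteristic polynomials.\<close>

lemma KL_removed_uniform_on:
  assumes "removed_uniform_structure E d l R"
  shows "KL (removed_uniform_on E d R) =
    coeff_poly d (\<lambda>i. uniform_coeff l d i - int (card R) * removal_coeff d i)"
  using assms
proof (induction d arbitrary: E R rule: less_induct)
  case (less d)
  interpret removed_uniform_structure E d l R by (rule less.prems)
  let ?Q = "coeff_poly d (\<lambda>i. uniform_coeff l d i - int (card R) * removal_coeff d i)"
  have IH: "KL (contraction M F) = coeff_poly (d - card F) (\<lambda>i. uniform_coeff l (d - card F) i - below F * removal_coeff (d - card F) i)"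
    if F: "F \<subseteq> E" "1 \<le> card F" "card F < d" "\<not> (card F = d - 1 \<and> (\<exists>B\<in>R. F \<subseteq> B))" for F
  proof -
    have "F \<noteq> {}" using F by auto
    then show ?thesis
      using less.IH[OF _ contraction_M(1)[OF F(1,3,4)]] contraction_M(2)[OF F(1,3,4)] card_contracted_R[of F] F by simp
  qed
  have "reverse_poly d ?Q - ?Q = kl_defect KL"
  proof (rule poly_eqI)
    fix j
    show "coeff (reverse_poly d ?Q - ?Q) j = coeff (kl_defect KL) j"
    proof (cases "j \<le> d")
      case True
      then show ?thesis using coeff_kl_defect[OF IH True] by (simp add: Zcoeff_def monom_0)
    next
      case False
      \<comment> \<open>Above degree \<open>d\<close> the reversal is 0, so antisymmetry kills the
        defect there as well.\<close>
      have "coeff (reverse_poly d (kl_defect KL)) j = - coeff (kl_defect KL) j"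
        using reverse_kl_defect by (simp add: rk_M)
      then have "coeff (kl_defect KL) j = 0" using False by (simp add: coeff_reverse_poly)
      then show ?thesis using False by (simp add: coeff_reverse_poly coeff_coeff_poly)
    qed
  qed
  then have "KL M = ?Q"
    using degree_coeff_poly[OF d_pos] d_pos by (intro KL_eqI) (simp_all add: rk_M)
  then show ?case by (simp add: M_def)
qed

theorem theorem1:
  fixes \<rho> d m i :: nat and R :: "nat set set"
  assumes "m \<ge> 1"
    and "\<rho> > 1 \<Longrightarrow> m \<ge> d * (\<rho> - 1)"
    and "\<rho> \<ge> 1 \<Longrightarrow> d \<ge> 2 \<or> d = 0"
    and "removal_choice m d \<rho> R"
  shows "coeff (kl_poly (removed_uniform m d R)) i = int (num_SkYT_removed \<rho> m d i)"
proof (cases "d = 0")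
  case True
  let ?M = "removed_uniform m 0 {}"
  have R: "R = {}" using assms(4) True by (simp add: removal_choice_def)
  have M: "ground ?M = {1..m}" "indep ?M = {{}}"
  proof -
    have "{B. B \<subseteq> {1..m} \<and> card B = 0} = {{}}"
      using finite_subset[of _ "{1..m}"] by (auto simp: card_eq_0_iff)
    then show "ground ?M = {1..m}" "indep ?M = {{}}"
      by (simp_all add: removed_uniform_def matroid_of_bases_def)
  qed
  interpret matroid_structure ?M by unfold_locales (simp add: is_matroid_def M)
  have "rk ?M = 0" using rank_attained[of "{1..m}"] by (auto simp: rk_def M)
  then have "KL ?M = 1" by (rule KL_rank_0)
  \<comment> \<open>For d = 0 and positive i the truncated height of the right-most column is 0, so
    there are no tableaux; i = 0 is the convention.\<close>
  then show ?thesis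
    by (simp add: kl_poly_eq_KL R True coeff_1 num_SkYT_removed_def SkYT_removed_def SkYT_def Let_def)
next
  case False
  define l where "l = m - 1"
  have m: "m = l + 1" using assms(1) by (simp add: l_def)
  have R: "R \<subseteq> {B. B \<subseteq> {1..m + d} \<and> card B = d}" "card R = \<rho>" "pairwise disjnt R"
    using assms(4) False by (auto simp: removal_choice_def)
  have fR: "finite R" by (rule finite_subset[OF R(1)]) auto
  have d2: "\<rho> = 0 \<or> 2 \<le> d" using assms(3) False by linarith
  interpret removed_uniform_structure "{1..m + d}" d l R
  proof
    show "2 \<le> d" if "R \<noteq> {}" using that R(2) fR d2 by auto
  qed (use R False m in auto)
  \<comment> \<open>For \<open>\<rho>\<close> > 1 the rank is at least 2, so m is at least
    2(\<open>\<rho>\<close> - 1), hence at least \<open>\<rho>\<close>; the corner entries d + 1,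
    ..., d + \<open>\<rho>\<close> then fit among the d + m entries.\<close>
  have \<rho>: "\<rho> \<le> l + 1"
  proof (cases "\<rho> > 1")
    case True
    then have "2 * (\<rho> - 1) \<le> d * (\<rho> - 1)" using d2 by simp
    then show ?thesis using assms(2)[OF True] True m by linarith
  qed simp
  have "kl_poly (removed_uniform m d R) = coeff_poly d (\<lambda>i. uniform_coeff l d i - int \<rho> * removal_coeff d i)"
    using KL_removed_uniform_on[OF removed_uniform_structure_axioms] R(2)
    by (simp add: kl_poly_eq_KL removed_uniform_def removed_uniform_on_def)
  then have "coeff (kl_poly (removed_uniform m d R)) i = uniform_coeff l d i - int \<rho> * removal_coeff d i"
    using uniform_coeff_eq_0[OF d_pos, of i] removal_coeff_eq_0[OF d_pos, of i] by (simp add: coeff_coeff_poly)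
  also have "\<dots> = int (num_SkYT_removed \<rho> m d i)"
    unfolding m by (rule num_SkYT_removed_eq[symmetric]) (use \<rho> d_pos d2 in auto)
  finally show ?thesis .
qed

end
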